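(* There is no non-empty open subset of $M(H^\infty+C)$ that is a $t$-analytic set for $H^\infty+C$.
   Context: Let $\mathbb T$ be the unit circle, $L^\infty(\mathbb T)$ the algebra of (equivalence classes of) essentially bounded measurable functions on $\mathbb T$ with the essential supremum norm, $H^\infty(\mathbb T)$ the closed subalgebra of those functions in $L^\infty(\mathbb T)$ whose negative Fourier coefficients vanish, and $C(\mathbb T)$ the continuous functions on $\mathbb T$. $H^\infty+C$ denotes the (closed) algebra $H^\infty(\mathbb T)+C(\mathbb T)\subseteq L^\infty(\mathbb T)$. For a commutative unital semisimple Banach algebra $A$, $M(A)$ is its character space with the Gelfand (weak-$*$) topology, and elements of $A$ are regarded as continuous functions on $M(A)$ via the Gelfand transform. A set $E\subseteq M(A)$ is a $t$-analytic set for $A$ if for every $f\in A$ and every non-empty relatively open subset $U$ of $E$, $f\equiv 0$ on $U$ implies $f\equiv 0$ on $E$. *)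

theory Defs
  imports "HOL-Probability.Probability"
begin

text \<open>
  Commutative unital complex algebras. Subalgebras are carrier sets \<open>A\<close>, so that
  characters are functions that are \<^emph>\<open>extensional\<close> on \<open>A\<close> (equal to \<^term>\<open>undefined\<close>
  off \<open>A\<close>) and two characters are equal iff they agree on \<open>A\<close>. No norm occurs below:
  characters of a Banach algebra are automatically continuous, and the Gelfand topology
  is that of pointwise convergence on \<open>A\<close>.
\<close>

class comm_complex_algebra_1 = comm_ring_1 +
  fixes scaleC :: "complex \<Rightarrow> 'a \<Rightarrow> 'a"  (infixr \<open>*\<^sub>C\<close> 75)
  assumes scaleC_add_right: "c *\<^sub>C (x + y) = c *\<^sub>C x + c *\<^sub>C y"
    and scaleC_add_left: "(c + d) *\<^sub>C x = c *\<^sub>C x + d *\<^sub>C x"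
    and scaleC_scaleC: "c *\<^sub>C (d *\<^sub>C x) = (c * d) *\<^sub>C x"
    and scaleC_one: "1 *\<^sub>C x = x"
    and mult_scaleC_left: "(c *\<^sub>C x) * y = c *\<^sub>C (x * y)"

definition character_space :: "'a::comm_complex_algebra_1 set \<Rightarrow> ('a \<Rightarrow> complex) set" where
  "character_space A = {\<phi> \<in> extensional A.
     (\<forall>f\<in>A. \<forall>g\<in>A. \<phi> (f + g) = \<phi> f + \<phi> g) \<and>
     (\<forall>c. \<forall>f\<in>A. \<phi> (c *\<^sub>C f) = c * \<phi> f) \<and>
     (\<forall>f\<in>A. \<forall>g\<in>A. \<phi> (f * g) = \<phi> f * \<phi> g) \<and>
     (\<exists>f\<in>A. \<phi> f \<noteq> 0)}"

definition gelfand_topology :: "'a::comm_complex_algebra_1 set \<Rightarrow> ('a \<Rightarrow> complex) topology" where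
  "gelfand_topology A = subtopology (product_topology (\<lambda>_. euclidean) A) (character_space A)"

lemma topspace_gelfand_topology [simp]: "topspace (gelfand_topology A) = character_space A"
  by (auto simp: gelfand_topology_def character_space_def PiE_def)

definition gelfand_transform :: "'a \<Rightarrow> ('a \<Rightarrow> complex) \<Rightarrow> complex" where
  "gelfand_transform f \<phi> = \<phi> f"

lemma continuous_map_gelfand_transform:
  "f \<in> A \<Longrightarrow> continuous_map (gelfand_topology A) euclidean (gelfand_transform f)"
  unfolding gelfand_topology_def gelfand_transform_def [abs_def]
  by (intro continuous_map_from_subtopology continuous_map_product_projection)

definition t_analytic_set :: "'a::comm_complex_algebra_1 set \<Rightarrow> ('a \<Rightarrow> complex) set \<Rightarrow> bool" where
  "t_analytic_set A E \<longleftrightarrow> E \<subseteq> character_space A \<and>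
     (\<forall>f\<in>A. \<forall>U. openin (subtopology (gelfand_topology A) E) U \<and> U \<noteq> {} \<and>
        (\<forall>\<phi>\<in>U. gelfand_transform f \<phi> = 0) \<longrightarrow> (\<forall>\<phi>\<in>E. gelfand_transform f \<phi> = 0))"


text \<open>Normalised arc length on the unit circle, on the Borel sets of the circle.\<close>

definition circle_measure :: "complex measure" where
  "circle_measure =
     distr (uniform_measure lborel {0..<2 * pi}) (restrict_space borel (sphere 0 1)) cis"

lemma measurable_cis_circle:
  "cis \<in> measurable (uniform_measure lborel {0..<2 * pi}) (restrict_space borel (sphere 0 1))"
proof -
  have "cis \<in> borel_measurable borel"
    by (intro borel_measurable_continuous_onI continuous_intros)
  then show ?thesis
    by (intro measurable_restrict_space2) auto
qed

lemma sets_circle_measure [measurable_cong]: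
  "sets circle_measure = sets (restrict_space borel (sphere 0 1))"
  by (simp add: circle_measure_def)

lemma space_circle_measure: "space circle_measure = sphere 0 1"
  by (simp add: circle_measure_def space_restrict_space)

lemma prob_space_circle_measure: "prob_space circle_measure"
  unfolding circle_measure_def
  by (intro prob_space.prob_space_distr measurable_cis_circle prob_space_uniform_measure) auto

lemma integral_circle_measure:
  fixes f :: "complex \<Rightarrow> complex"
  assumes "f \<in> borel_measurable circle_measure"
  shows "(\<integral>z. f z \<partial>circle_measure) = (1 / (2 * pi)) *\<^sub>R (LBINT t:{0..<2 * pi}. f (cis t))"
proof -
  let ?U = "uniform_measure lborel {0..<2 * pi}"
  have cis: "cis \<in> measurable ?U (restrict_space borel (sphere 0 1))"
    by (rule measurable_cis_circle)
  have f: "f \<in> borel_measurable (restrict_space borel (sphere 0 1))"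
    using assms by (simp cong: measurable_cong_sets add: sets_circle_measure)
  have fcis: "(\<lambda>t. f (cis t)) \<in> borel_measurable lborel"
    using measurable_compose[OF cis f] by (simp cong: measurable_cong_sets)
  have "(\<integral>z. f z \<partial>circle_measure) = (\<integral>t. f (cis t) \<partial>?U)"
    unfolding circle_measure_def by (rule integral_distr[OF cis f])
  also have "\<dots> = (\<integral>t. f (cis t) \<partial>density lborel (\<lambda>t. ennreal (indicator {0..<2 * pi} t / (2 * pi))))"
    unfolding uniform_measure_def
    by (intro arg_cong2[where f = "lebesgue_integral"] density_cong refl)
       (auto simp: divide_ennreal indicator_def ennreal_1[symmetric] simp del: ennreal_1)
  also have "\<dots> = (\<integral>t. (indicator {0..<2 * pi} t / (2 * pi)) *\<^sub>R f (cis t) \<partial>lborel)"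
    using fcis by (intro integral_density) auto
  also have "\<dots> = (1 / (2 * pi)) *\<^sub>R (LBINT t:{0..<2 * pi}. f (cis t))"
    unfolding set_lebesgue_integral_def integral_scaleR_right[symmetric]
    by (intro Bochner_Integration.integral_cong) auto
  finally show ?thesis .
qed

definition ess_bounded :: "(complex \<Rightarrow> complex) \<Rightarrow> bool" where
  "ess_bounded f \<longleftrightarrow> f \<in> borel_measurable circle_measure \<and>
     (\<exists>B. AE z in circle_measure. norm (f z) \<le> B)"

lemma ess_bounded_const: "ess_bounded (\<lambda>_. c)"
  by (auto simp: ess_bounded_def)

lemma ess_bounded_add:
  assumes "ess_bounded f" "ess_bounded g"
  shows "ess_bounded (\<lambda>z. f z + g z)"
proof -
  from assms obtain B C where "AE z in circle_measure. norm (f z) \<le> B"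
    and "AE z in circle_measure. norm (g z) \<le> C"
    by (auto simp: ess_bounded_def)
  then have "AE z in circle_measure. norm (f z + g z) \<le> B + C"
    by eventually_elim (rule norm_triangle_mono)
  with assms show ?thesis by (auto simp: ess_bounded_def)
qed

lemma ess_bounded_mult:
  assumes "ess_bounded f" "ess_bounded g"
  shows "ess_bounded (\<lambda>z. f z * g z)"
proof -
  from assms obtain B C where "AE z in circle_measure. norm (f z) \<le> B"
    and "AE z in circle_measure. norm (g z) \<le> C"
    by (auto simp: ess_bounded_def)
  then have "AE z in circle_measure. norm (f z * g z) \<le> B * C"
    by eventually_elim (auto simp: norm_mult intro!: mult_mono intro: order_trans[OF norm_ge_zero])
  with assms show ?thesis by (auto simp: ess_bounded_def)
qed

lemma ess_bounded_cmult: "ess_bounded f \<Longrightarrow> ess_bounded (\<lambda>z. c * f z)"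
  by (intro ess_bounded_mult ess_bounded_const)

lemma ess_bounded_uminus: "ess_bounded f \<Longrightarrow> ess_bounded (\<lambda>z. - f z)"
  using ess_bounded_cmult[of f "-1"] by simp

lemma ess_bounded_diff:
  "ess_bounded f \<Longrightarrow> ess_bounded g \<Longrightarrow> ess_bounded (\<lambda>z. f z - g z)"
  using ess_bounded_add[of f "\<lambda>z. - g z"] ess_bounded_uminus[of g] by simp

definition ess_eq :: "(complex \<Rightarrow> complex) \<Rightarrow> (complex \<Rightarrow> complex) \<Rightarrow> bool" where
  "ess_eq f g \<longleftrightarrow> ess_bounded f \<and> ess_bounded g \<and> (AE z in circle_measure. f z = g z)"

lemma part_equivp_ess_eq: "part_equivp ess_eq"
proof (rule part_equivpI)
  show "\<exists>f. ess_eq f f"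
    using ess_bounded_const by (auto simp: ess_eq_def)
  show "symp ess_eq"
    by (auto simp: symp_def ess_eq_def)
  show "transp ess_eq"
    by (auto simp: transp_def ess_eq_def elim: eventually_elim2)
qed


text \<open>
  The algebra \<open>L\<^sup>\<infinity>\<close> of the circle. Values of representatives off the circle are irrelevant.
  Working with Borel functions loses nothing: every Lebesgue measurable function is
  almost everywhere equal to a Borel one.
\<close>

quotient_type linfty = "complex \<Rightarrow> complex" / partial: ess_eq
  by (rule part_equivp_ess_eq)

instantiation linfty :: comm_complex_algebra_1
begin

lift_definition zero_linfty :: linfty is "\<lambda>_. 0"
  by (simp add: ess_eq_def ess_bounded_const)

lift_definition one_linfty :: linfty is "\<lambda>_. 1"
  by (simp add: ess_eq_def ess_bounded_const)

lift_definition plus_linfty :: "linfty \<Rightarrow> linfty \<Rightarrow> linfty" is "\<lambda>f g z. f z + g z"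
  by (auto simp: ess_eq_def ess_bounded_add elim: eventually_elim2)

lift_definition minus_linfty :: "linfty \<Rightarrow> linfty \<Rightarrow> linfty" is "\<lambda>f g z. f z - g z"
  by (auto simp: ess_eq_def ess_bounded_diff elim: eventually_elim2)

lift_definition uminus_linfty :: "linfty \<Rightarrow> linfty" is "\<lambda>f z. - f z"
  by (auto simp: ess_eq_def ess_bounded_uminus)

lift_definition times_linfty :: "linfty \<Rightarrow> linfty \<Rightarrow> linfty" is "\<lambda>f g z. f z * g z"
  by (auto simp: ess_eq_def ess_bounded_mult elim: eventually_elim2)

lift_definition scaleC_linfty :: "complex \<Rightarrow> linfty \<Rightarrow> linfty" is "\<lambda>c f z. c * f z"
  by (auto simp: ess_eq_def ess_bounded_cmult elim: eventually_mono)

instance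
proof
  show "(0::linfty) \<noteq> 1"
  proof transfer
    interpret prob_space circle_measure by (rule prob_space_circle_measure)
    show "\<not> ess_eq (\<lambda>_. 0) (\<lambda>_. 1)" by (simp add: ess_eq_def)
  qed
qed (transfer; auto simp: ess_eq_def algebra_simps ess_bounded_add ess_bounded_mult
       ess_bounded_cmult ess_bounded_uminus ess_bounded_diff ess_bounded_const)+

end

lemma fourier_integral_cong:
  assumes "ess_eq f g"
  shows "(\<integral>z. f z * z powi (- n) \<partial>circle_measure) = (\<integral>z. g z * z powi (- n) \<partial>circle_measure)"
proof -
  have [measurable]: "(\<lambda>z::complex. z powi (- n)) \<in> borel_measurable circle_measure"
    unfolding measurable_cong_sets[OF sets_circle_measure refl]
    by (intro borel_measurable_continuous_on_restrict continuous_intros) auto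
  from assms have [measurable]: "f \<in> borel_measurable circle_measure"
      "g \<in> borel_measurable circle_measure"
    and "AE z in circle_measure. f z = g z"
    by (auto simp: ess_eq_def ess_bounded_def)
  then show ?thesis
    by (intro integral_cong_AE) (auto elim: eventually_mono)
qed

lift_definition fourier_coeff :: "linfty \<Rightarrow> int \<Rightarrow> complex"
  is "\<lambda>f n. \<integral>z. f z * z powi (- n) \<partial>circle_measure"
  by (intro ext fourier_integral_cong)

lift_definition has_continuous_rep :: "linfty \<Rightarrow> bool"
  is "\<lambda>f. \<exists>g. continuous_on (sphere 0 1) g \<and> (AE z in circle_measure. f z = g z)"
proof -
  have "\<exists>h. continuous_on (sphere 0 1) h \<and> (AE z in circle_measure. g z = h z)"
    if "ess_eq f g" "\<exists>h. continuous_on (sphere 0 1) h \<and> (AE z in circle_measure. f z = h z)"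
    for f g :: "complex \<Rightarrow> complex"
  proof -
    from that obtain h where h: "continuous_on (sphere 0 1) h"
        "AE z in circle_measure. f z = h z" and "AE z in circle_measure. f z = g z"
      by (auto simp: ess_eq_def)
    then have "AE z in circle_measure. g z = h z"
      by (auto elim: eventually_elim2)
    with h show ?thesis by blast
  qed
  moreover have "ess_eq g f" if "ess_eq f g" for f g
    using that by (auto simp: ess_eq_def elim: eventually_mono)
  ultimately show "\<And>f g. ess_eq f g \<Longrightarrow>
      (\<exists>h. continuous_on (sphere 0 1) h \<and> (AE z in circle_measure. f z = h z)) =
      (\<exists>h. continuous_on (sphere 0 1) h \<and> (AE z in circle_measure. g z = h z))"
    by blast
qed

lemma ess_bounded_continuous:
  assumes "continuous_on (sphere 0 1) g"
  shows "ess_bounded g"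
proof -
  have "bounded (g ` sphere 0 1)"
    using assms by (intro compact_imp_bounded compact_continuous_image) auto
  then obtain B where "\<forall>z\<in>sphere 0 1. norm (g z) \<le> B"
    by (auto simp: bounded_iff)
  then have "AE z in circle_measure. norm (g z) \<le> B"
    by (intro AE_I2) (simp add: space_circle_measure)
  moreover have "g \<in> borel_measurable circle_measure"
    unfolding measurable_cong_sets[OF sets_circle_measure refl]
    by (rule borel_measurable_continuous_on_restrict[OF assms])
  ultimately show ?thesis by (auto simp: ess_bounded_def)
qed

definition hinfty :: "linfty set" where
  "hinfty = {f. \<forall>n<0. fourier_coeff f n = 0}"

definition cont_circle :: "linfty set" where
  "cont_circle = {f. has_continuous_rep f}"

text \<open>By a theorem of Sarason this is a (closed) subalgebra of \<open>L\<^sup>\<infinity>\<close>.\<close>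

definition hinfty_plus_C :: "linfty set" where
  "hinfty_plus_C = {f + g |f g. f \<in> hinfty \<and> g \<in> cont_circle}"

end

theory Submission
  imports Defs "HOL-Computational_Algebra.Polynomial"
begin

text \<open>
  The proof avoids the corona theorem. By cutting off with continuous functions, a \<open>t\<close>-analytic set
  lies in a single fibre \<open>z = l\<close> of the character space. Let \<open>E\<close> be open, \<open>t\<close>-analytic and contain
  \<open>\<phi>\<close>; then \<open>E\<close> contains all characters of the fibre on which finitely many \<open>g \<in> H\<^sup>\<infinity>\<close>
  with \<open>\<phi> g = 0\<close> vanish. Decompose a neighbourhood of \<open>l\<close> into the scales \<open>\<bar>z - l\<bar> \<approx> 4^(-j)\<close>.
  If the equation \<open>\<Sum> g h\<^sub>g = 1\<close> could be solved on all small scales with one bound for the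
  \<open>h\<^sub>g \<in> H\<^sup>\<infinity>\<close>, a partition of unity consisting of \<open>H\<^sup>\<infinity>\<close> functions would patch the solutions
  together, contradicting \<open>\<phi> g = 0\<close>. So there are arbitrarily sparse sequences of scales along
  which the best bounds tend to infinity. Split one of them into its even and its odd members, and let
  \<open>a\<close>, \<open>b\<close> be \<open>H\<^sup>\<infinity>\<close> functions that are close to \<open>1\<close> on the even and on the odd scales,
  respectively, with \<open>a b \<rightarrow> 0\<close> at \<open>l\<close>. One of them, say \<open>a\<close>, vanishes on \<open>E\<close> by
  \<open>t\<close>-analyticity, so by Gelfand theory \<open>\<Sum> g h\<^sub>g + (1 - a) k = 1\<close> for some
  \<open>h\<^sub>g, k \<in> H\<^sup>\<infinity>\<close>. That solves the equation with one bound on almost all even scales, a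
  contradiction.
\<close>


section \<open>Characters of commutative Banach algebras\<close>

text \<open>No non-zero function in H^inf vanishes on an arc, so every cut-off must be analytic:
  with s = 1 - cnj l * z in the right half plane, the functions 1 / (1 + c * s) act as soft switches
  at |s| = 1 / c. Their tails never vanish, and much of the work on scales consists in controlling
  those tails. Patching has to survive two losses: a local solution is accurate only near its own
  scale, and the tails must stay summable. Hence the square root in the weights: a bump is at most
  the square of its weight, so one factor absorbs the local error and the other is summed, to at
  most 4. The total error is then 4/250. On the other side, the sum of the bumps has real part at
  least 1/20 near l, which forces its value under a homomorphism over l to have modulus at least
  1/50 > 4/250. The order of quantifiers gives the contradiction: the m-th bad scale resists the
  bound m, whereas a Bezout identity has one fixed bound and serves infinitely many scales. Two
  interleaved sequences are used because t-analyticity turns a vanishing product into the vanishing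
  of one factor.\<close>

abbreviation scalar :: "complex \<Rightarrow> 'a::comm_complex_algebra_1" where
  "scalar c \<equiv> c *\<^sub>C 1"

lemma scaleC_conv_mult: "c *\<^sub>C x = scalar c * (x::'a::comm_complex_algebra_1)"
  by (simp add: mult_scaleC_left)

lemma scalar_add: "scalar (c + d) = (scalar c + scalar d :: 'a::comm_complex_algebra_1)"
  by (rule scaleC_add_left)

lemma scalar_mult: "scalar (c * d) = (scalar c * scalar d :: 'a::comm_complex_algebra_1)"
  by (simp add: mult_scaleC_left scaleC_scaleC)

lemma scalar_1: "scalar 1 = (1 :: 'a::comm_complex_algebra_1)"
  by (rule scaleC_one)

lemma scalar_0: "scalar 0 = (0 :: 'a::comm_complex_algebra_1)"
  using scalar_add[of 0 0, where ?'a = 'a] by simp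

lemma scalar_minus: "scalar (- c) = (- scalar c :: 'a::comm_complex_algebra_1)"
  using scalar_add[of c "- c", where ?'a = 'a] by (simp add: scalar_0 eq_neg_iff_add_eq_0 add.commute)

lemma scalar_diff: "scalar (c - d) = (scalar c - scalar d :: 'a::comm_complex_algebra_1)"
  using scalar_add[of c "- d", where ?'a = 'a] by (simp add: scalar_minus)

lemma scalar_power: "scalar (c ^ n) = (scalar c ^ n :: 'a::comm_complex_algebra_1)"
  by (induction n) (simp_all add: scalar_1 scalar_mult)

lemma scalar_sum: "scalar (sum f S) = (\<Sum>i\<in>S. scalar (f i) :: 'a::comm_complex_algebra_1)"
  by (induction S rule: infinite_finite_induct) (simp_all add: scalar_0 scalar_add)

text \<open>The relation \<open>bd x B\<close> plays the role of the inequality \<open>norm x \<le> B\<close>, and completeness enters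
  only through the convergence of the Neumann series.\<close>

locale bounded_algebra =
  fixes A :: "'a::comm_complex_algebra_1 set" and bd :: "'a \<Rightarrow> real \<Rightarrow> bool"
  assumes one_closed [simp]: "1 \<in> A"
    and add_closed: "x \<in> A \<Longrightarrow> y \<in> A \<Longrightarrow> x + y \<in> A"
    and mult_closed: "x \<in> A \<Longrightarrow> y \<in> A \<Longrightarrow> x * y \<in> A"
    and scaleC_closed: "x \<in> A \<Longrightarrow> c *\<^sub>C x \<in> A"
    and bd_nonneg: "bd x B \<Longrightarrow> 0 \<le> B"
    and bd_ex: "x \<in> A \<Longrightarrow> \<exists>B. bd x B"
    and bd_add: "bd x B \<Longrightarrow> bd y C \<Longrightarrow> bd (x + y) (B + C)"
    and bd_mult: "bd x B \<Longrightarrow> bd y C \<Longrightarrow> bd (x * y) (B * C)"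
    and bd_scaleC: "bd x B \<Longrightarrow> bd (c *\<^sub>C x) (norm c * B)"
    and bd_one: "bd 1 1"
    and neumann: "x \<in> A \<Longrightarrow> bd x B \<Longrightarrow> B < 1 \<Longrightarrow> \<exists>y\<in>A. (1 - x) * y = 1"
begin

lemma scalar_closed [simp]: "scalar c \<in> A"
  by (simp add: scaleC_closed)

lemma zero_closed [simp]: "0 \<in> A"
  using scalar_closed[of 0] by (simp only: scalar_0)

lemma minus_closed: "x \<in> A \<Longrightarrow> - x \<in> A"
  using mult_closed[OF scalar_closed[of "-1"], of x] by (simp add: scalar_minus scalar_1)

lemma diff_closed: "x \<in> A \<Longrightarrow> y \<in> A \<Longrightarrow> x - y \<in> A"
  using add_closed[of x "- y"] minus_closed[of y] by simp

lemma power_closed: "x \<in> A \<Longrightarrow> x ^ n \<in> A"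
  by (induction n) (auto intro: mult_closed)

lemma sum_closed: "(\<And>i. i \<in> S \<Longrightarrow> f i \<in> A) \<Longrightarrow> sum f S \<in> A"
  by (induction S rule: infinite_finite_induct) (auto intro: add_closed)

lemmas closed_intros = add_closed mult_closed minus_closed diff_closed power_closed sum_closed
  scalar_closed one_closed zero_closed

section \<open>Ideals of a bounded algebra and Zorn's lemma\<close>

definition is_ideal :: "'a set \<Rightarrow> bool" where
  "is_ideal I \<longleftrightarrow> I \<subseteq> A \<and> 0 \<in> I \<and> (\<forall>x\<in>I. \<forall>y\<in>I. x + y \<in> I) \<and> (\<forall>a\<in>A. \<forall>x\<in>I. a * x \<in> I)"

text \<open>Maximality is phrased as invertibility modulo \<open>M\<close>: the quotient is a field.
  This is the form in which the spectral argument uses it.\<close>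

definition maximal_ideal :: "'a set \<Rightarrow> bool" where
  "maximal_ideal M \<longleftrightarrow> is_ideal M \<and> 1 \<notin> M \<and> (\<forall>a\<in>A. a \<notin> M \<longrightarrow> (\<exists>b\<in>A. a * b - 1 \<in> M))"

lemma maximal_ideal_exists:
  assumes I: "is_ideal I" "1 \<notin> I"
  shows "\<exists>M. maximal_ideal M \<and> I \<subseteq> M"
proof -
  define P where "P = {J. is_ideal J \<and> I \<subseteq> J \<and> 1 \<notin> J}"
  have "\<exists>M\<in>P. \<forall>J\<in>P. M \<subseteq> J \<longrightarrow> J = M"
  proof (rule subset_Zorn_nonempty)
    show "P \<noteq> {}" using I by (auto simp: P_def)
    fix C assume C: "C \<noteq> {}" "subset.chain P C"
    have CP: "C \<subseteq> P" using C(2) by (auto simp: subset.chain_def)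
    have chain: "J \<subseteq> K \<or> K \<subseteq> J" if "J \<in> C" "K \<in> C" for J K
      using that C(2) unfolding subset_chain_def by blast
    have "is_ideal (\<Union>C)"
      unfolding is_ideal_def
    proof (intro conjI ballI)
      show "\<Union>C \<subseteq> A" using CP by (auto simp: P_def is_ideal_def)
      show "0 \<in> \<Union>C" using CP C(1) by (auto simp: P_def is_ideal_def)
      fix x assume "x \<in> \<Union>C"
      then obtain J where J: "J \<in> C" "x \<in> J" by auto
      show "x + y \<in> \<Union>C" if "y \<in> \<Union>C" for y
      proof -
        from that obtain K where K: "K \<in> C" "y \<in> K" by auto
        from chain[OF J(1) K(1)] obtain L where "L \<in> C" "x \<in> L" "y \<in> L"
          using J K by blast
        with CP show ?thesis unfolding P_def is_ideal_def by blast
      qed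
      show "a * x \<in> \<Union>C" if "a \<in> A" for a
        using J(1) J(2) that CP unfolding P_def is_ideal_def by blast
    qed
    then show "\<Union>C \<in> P" using CP C(1) by (auto simp: P_def)
  qed
  then obtain M where M: "M \<in> P" and max: "\<And>J. J \<in> P \<Longrightarrow> M \<subseteq> J \<Longrightarrow> J = M" by blast
  have idM: "is_ideal M" "I \<subseteq> M" "1 \<notin> M" using M by (auto simp: P_def)
  have "\<exists>b\<in>A. a * b - 1 \<in> M" if a: "a \<in> A" "a \<notin> M" for a
  proof -
    \<comment> \<open>The ideal generated by \<open>M\<close> and \<open>a\<close>; maximality of
      \<open>M\<close> forces it to contain 1.\<close>
    define J where "J = {m + a * b |m b. m \<in> M \<and> b \<in> A}"
    have "is_ideal J"
      unfolding is_ideal_def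
    proof (intro conjI ballI)
      show "J \<subseteq> A" using idM a by (auto simp: J_def is_ideal_def intro!: closed_intros)
      show "0 \<in> J" using idM by (auto simp: J_def is_ideal_def intro!: exI[of _ 0])
      fix x assume "x \<in> J"
      then obtain m b where x: "x = m + a * b" "m \<in> M" "b \<in> A" by (auto simp: J_def)
      show "x + y \<in> J" if "y \<in> J" for y
      proof -
        from that obtain m' b' where y: "y = m' + a * b'" "m' \<in> M" "b' \<in> A" by (auto simp: J_def)
        have "x + y = (m + m') + a * (b + b')" using x y by (simp add: algebra_simps)
        then show ?thesis using x y idM unfolding J_def is_ideal_def
          by (blast intro: add_closed)
      qed
      show "c * x \<in> J" if "c \<in> A" for c
      proof -
        have "c * x = c * m + a * (c * b)" using x by (simp add: algebra_simps)
        then show ?thesis using x that idM unfolding J_def is_ideal_def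
          by (blast intro: mult_closed)
      qed
    qed
    moreover have "M \<subseteq> J"
    proof
      fix m assume "m \<in> M"
      then show "m \<in> J" unfolding J_def by (intro CollectI exI[of _ m] exI[of _ 0]) simp
    qed
    moreover have "a \<in> J"
      using idM unfolding J_def is_ideal_def by (intro CollectI exI[of _ 0] exI[of _ 1]) simp
    ultimately have "1 \<in> J"
      using max[of J] a(2) idM(2) by (auto simp: P_def)
    then obtain m b where mb: "1 = m + a * b" "m \<in> M" "b \<in> A" by (auto simp: J_def)
    have "a * b - 1 = scalar (-1) * m"
      using mb(1) by (simp add: scalar_minus scalar_1 algebra_simps)
    then have "a * b - 1 \<in> M" using idM(1) mb(2) by (simp add: is_ideal_def)
    with mb(3) show ?thesis by blast
  qed
  with idM show ?thesis by (auto simp: maximal_ideal_def)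
qed

end

section \<open>The normed quotient by a maximal ideal and the Gelfand-Mazur theorem\<close>

locale maximal_ideal = bounded_algebra +
  fixes M
  assumes maximal: "maximal_ideal M"
begin

lemma ideal_sub: "x \<in> M \<Longrightarrow> x \<in> A"
  and ideal_zero [simp]: "0 \<in> M"
  and ideal_add: "x \<in> M \<Longrightarrow> y \<in> M \<Longrightarrow> x + y \<in> M"
  and ideal_mult: "a \<in> A \<Longrightarrow> x \<in> M \<Longrightarrow> a * x \<in> M"
  and one_notin: "1 \<notin> M"
  and inverse_mod: "a \<in> A \<Longrightarrow> a \<notin> M \<Longrightarrow> \<exists>b\<in>A. a * b - 1 \<in> M"
  using maximal unfolding maximal_ideal_def is_ideal_def by blast+

lemma ideal_minus: "x \<in> M \<Longrightarrow> - x \<in> M"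
  using ideal_mult[OF scalar_closed[of "-1"], of x] by (simp add: scalar_minus scalar_1)

lemma ideal_diff: "x \<in> M \<Longrightarrow> y \<in> M \<Longrightarrow> x - y \<in> M"
  using ideal_add[of x "- y"] ideal_minus[of y] by simp

lemma ideal_sum: "(\<And>i. i \<in> S \<Longrightarrow> f i \<in> M) \<Longrightarrow> sum f S \<in> M"
  by (induction S rule: infinite_finite_induct) (auto intro: ideal_add)

lemma ideal_scaled: "c \<noteq> 0 \<Longrightarrow> x \<in> A \<Longrightarrow> scalar c * x \<in> M \<Longrightarrow> x \<in> M"
  using ideal_mult[OF scalar_closed[of "1/c"], of "scalar c * x"]
  by (simp flip: mult.assoc scalar_mult add: scalar_1)

lemma ideal_rearrange: "x \<in> M \<Longrightarrow> y = x \<Longrightarrow> y \<in> M" by simp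

text \<open>Since \<open>bd\<close> records only upper bounds, the norm of a coset is recovered as
  the infimum of all bounds of all its representatives.\<close>

definition qnorm :: "'a \<Rightarrow> real" where
  "qnorm x = Inf {B. \<exists>m\<in>M. bd (x - m) B}"

lemma qnorm_le: "m \<in> M \<Longrightarrow> bd (x - m) B \<Longrightarrow> qnorm x \<le> B"
  unfolding qnorm_def by (rule cInf_lower) (auto intro!: bdd_belowI[of _ 0] dest: bd_nonneg)

lemma qnorm_nonempty: "x \<in> A \<Longrightarrow> {B. \<exists>m\<in>M. bd (x - m) B} \<noteq> {}"
  using bd_ex[of x] ideal_zero by (metis (mono_tags, lifting) diff_zero empty_iff mem_Collect_eq)

lemma qnorm_approx:
  assumes "x \<in> A" "qnorm x < C" obtains m B where "m \<in> M" "bd (x - m) B" "B < C"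
  using cInf_lessD[OF qnorm_nonempty[OF assms(1)] assms(2)[unfolded qnorm_def]] by auto

lemma qnorm_nonneg: "x \<in> A \<Longrightarrow> 0 \<le> qnorm x"
  unfolding qnorm_def by (rule cInf_greatest[OF qnorm_nonempty]) (auto intro: bd_nonneg)

lemma qnorm_add: assumes "x \<in> A" "y \<in> A" shows "qnorm (x + y) \<le> qnorm x + qnorm y"
proof (rule field_le_epsilon)
  fix e :: real assume e: "0 < e"
  obtain m B where 1: "m \<in> M" "bd (x - m) B" "B < qnorm x + e/2"
    using qnorm_approx[of x "qnorm x + e/2"] assms e by auto
  obtain n C where 2: "n \<in> M" "bd (y - n) C" "C < qnorm y + e/2"
    using qnorm_approx[of y "qnorm y + e/2"] assms e by auto
  have "qnorm (x + y) \<le> B + C"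
    using 1 2 bd_add[OF 1(2) 2(2)] by (intro qnorm_le[of "m + n"]) (auto intro: ideal_add simp: algebra_simps)
  with 1 2 show "qnorm (x + y) \<le> qnorm x + qnorm y + e" by simp
qed

lemma qnorm_mult: assumes "x \<in> A" "y \<in> A" shows "qnorm (x * y) \<le> qnorm x * qnorm y"
proof (rule tendsto_lowerbound)
  show "((\<lambda>e. (qnorm x + e) * (qnorm y + e)) \<longlongrightarrow> qnorm x * qnorm y) (at_right 0)"
    by (auto intro!: tendsto_eq_intros)
  show "\<forall>\<^sub>F e in at_right 0. qnorm (x * y) \<le> (qnorm x + e) * (qnorm y + e)"
    unfolding eventually_at_right_field
  proof (intro exI[of _ 1] conjI allI impI)
    fix e :: real assume e: "0 < e"
    obtain m B where 1: "m \<in> M" "bd (x - m) B" "B < qnorm x + e"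
      using qnorm_approx[of x "qnorm x + e"] assms e by auto
    obtain n C where 2: "n \<in> M" "bd (y - n) C" "C < qnorm y + e"
      using qnorm_approx[of y "qnorm y + e"] assms e by auto
    have "qnorm (x * y) \<le> B * C"
    proof (rule qnorm_le)
      \<comment> \<open>The representative of the product coset is (x - m) * (y - n).\<close>
      show "y * m + x * n - m * n \<in> M"
        by (intro ideal_add ideal_diff ideal_mult assms 1 2 ideal_sub)
      show "bd (x * y - (y * m + x * n - m * n)) (B * C)"
        using bd_mult[OF 1(2) 2(2)] by (simp add: algebra_simps)
    qed
    also have "\<dots> \<le> (qnorm x + e) * (qnorm y + e)"
      using 1 2 bd_nonneg[OF 1(2)] bd_nonneg[OF 2(2)] by (intro mult_mono) linarith+
    finally show "qnorm (x * y) \<le> (qnorm x + e) * (qnorm y + e)" .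
  qed simp
qed simp

lemma qnorm_cong: assumes "x \<in> A" "y \<in> A" "x - y \<in> M" shows "qnorm x = qnorm y"
proof -
  have "qnorm x \<le> qnorm y" if xy: "x \<in> A" "y \<in> A" "x - y \<in> M" for x y
  proof (rule field_le_epsilon)
    fix e :: real assume e: "0 < e"
    obtain m B where 1: "m \<in> M" "bd (y - m) B" "B < qnorm y + e"
      using qnorm_approx[OF xy(2), of "qnorm y + e"] e by auto
    have "qnorm x \<le> B"
      using 1 ideal_add[OF 1(1) xy(3)] by (intro qnorm_le[of "m + (x - y)"]) simp_all
    with 1 show "qnorm x \<le> qnorm y + e" by simp
  qed
  from this[of x y] this[of y x] ideal_minus[OF assms(3)] assms show ?thesis by simp
qed

lemma qnorm_scalar: assumes "x \<in> A" shows "qnorm (scalar c * x) \<le> norm c * qnorm x"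
proof -
  have "qnorm (scalar c) \<le> norm c"
    using bd_scaleC[OF bd_one, of c] by (intro qnorm_le[of 0]) auto
  then show ?thesis
    using qnorm_mult[of "scalar c" x] assms qnorm_nonneg[of x]
    by (meson mult_right_mono order_trans scalar_closed)
qed

lemma qnorm_minus: assumes "x \<in> A" shows "qnorm (- x) = qnorm x"
proof -
  have "qnorm (- x) \<le> qnorm x" if "x \<in> A" for x
    using qnorm_scalar[of x "-1"] that by (simp add: scalar_minus scalar_1)
  from this[of x] this[of "- x"] assms show ?thesis by (simp add: minus_closed)
qed

lemma qnorm_diff: assumes "x \<in> A" "y \<in> A" shows "qnorm (x - y) \<le> qnorm x + qnorm y"
  using qnorm_add[of x "- y"] assms by (simp add: qnorm_minus minus_closed)

text \<open>If \<open>1 - m\<close> with \<open>m\<close> in \<open>M\<close> had a bound below 1,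
  the Neumann series would invert \<open>m\<close> and put 1 into \<open>M\<close>. Here
  completeness keeps the quotient norm from degenerating.\<close>

lemma qnorm_one_ge: "1 \<le> qnorm 1"
proof (rule ccontr)
  assume "\<not> 1 \<le> qnorm 1"
  then obtain m B where m: "m \<in> M" "bd (1 - m) B" "B < 1"
    using qnorm_approx[of 1 1] by auto
  have "1 - m \<in> A" using m(1) by (intro diff_closed ideal_sub[of m] one_closed)
  from neumann[OF this m(2,3)] obtain y where "y \<in> A" "y * m = 1"
    by (auto simp: mult.commute)
  with ideal_mult[of y m] m one_notin show False by simp
qed

lemma qnorm_one: "qnorm 1 = 1"
  using qnorm_one_ge qnorm_le[of 0 1 1] bd_one by simp

lemma qnorm_power: assumes "x \<in> A" shows "qnorm (x ^ n) \<le> qnorm x ^ n"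
proof (induction n)
  case (Suc n)
  have "qnorm (x ^ Suc n) \<le> qnorm x * qnorm (x ^ n)" using qnorm_mult[of x "x ^ n"] assms by (simp add: power_closed)
  also have "\<dots> \<le> qnorm x * qnorm x ^ n" using Suc qnorm_nonneg[OF assms] by (intro mult_left_mono) auto
  finally show ?case by simp
qed (simp add: qnorm_one)

lemma qnorm_sum: assumes "\<And>i. i \<in> S \<Longrightarrow> f i \<in> A" "finite S" shows "qnorm (sum f S) \<le> (\<Sum>i\<in>S. qnorm (f i))"
  using assms(2,1)
proof (induction S rule: finite_induct)
  case empty
  have "qnorm 0 \<le> 0" using qnorm_scalar[of 1 0] by (simp add: scalar_0)
  then show ?case by simp
next
  case (insert x F)
  then have "qnorm (f x + sum f F) \<le> qnorm (f x) + qnorm (sum f F)" by (intro qnorm_add sum_closed) auto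
  with insert show ?case by force
qed


text \<open>Modulo \<open>M\<close>, \<open>F\<close> is the inverse of 1 - x, so F - 1 = x * F = x
  + x * (F - 1); both estimates read this equation in norm. The gap between 1/4 and 1/3 is left for
  a Lipschitz estimate to consume.\<close>

lemma inverse_close_to_one:
  assumes "x \<in> A" "F \<in> A" "(1 - x) * F - 1 \<in> M"
  shows "qnorm x \<le> 1/8 \<Longrightarrow> qnorm (F - 1) \<le> 1/4" and "qnorm (F - 1) \<le> 1/3 \<Longrightarrow> qnorm x < 1"
proof -
  have xF: "qnorm (F - 1) = qnorm (x * F)"
    using assms by (intro qnorm_cong closed_intros) (auto simp: algebra_simps)
  have *: "qnorm (x * F - x) \<le> qnorm x * qnorm (F - 1)"
    using qnorm_mult[of x "F - 1"] assms by (auto intro: closed_intros simp: algebra_simps)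
  have nn: "0 \<le> qnorm x" "0 \<le> qnorm (F - 1)" using assms by (auto intro!: qnorm_nonneg closed_intros)
  have "qnorm (x * F) \<le> qnorm x + qnorm (x * F - x)"
    using qnorm_add[of x "x * F - x"] assms by (auto intro: closed_intros)
  with * xF have 1: "qnorm (F - 1) \<le> qnorm x + qnorm x * qnorm (F - 1)" by simp
  show "qnorm (F - 1) \<le> 1/4" if "qnorm x \<le> 1/8"
    using 1 mult_right_mono[OF that nn(2)] that by simp
  have "qnorm x \<le> qnorm (x * F) + qnorm (x * F - x)"
    using qnorm_diff[of "x * F" "x * F - x"] assms by (auto intro: closed_intros)
  with * xF have 2: "qnorm x \<le> qnorm (F - 1) + qnorm x * qnorm (F - 1)" by simp
  show "qnorm x < 1" if "qnorm (F - 1) \<le> 1/3"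
    using 2 mult_left_mono[OF that nn(1)] that by simp
qed

text \<open>Partial fractions: 1 / (1 - y^N) is the mean of 1 / (1 - w^k * y) over the N-th roots of
  unity. Each quotient (1 - y^N) / (1 - w^k * y) is a geometric sum, and summing over k kills all
  powers of y but the zeroth.\<close>

lemma mult_inverse_average:
  fixes y :: "'a" and s :: "nat \<Rightarrow> 'a" and w :: complex
  assumes w: "w ^ N = 1" "\<And>j. 0 < j \<Longrightarrow> j < N \<Longrightarrow> w ^ j \<noteq> 1" and N: "0 < N"
    and y: "y \<in> A" and s: "\<And>k. s k \<in> A" "\<And>k. (1 - scalar (w ^ k) * y) * s k - 1 \<in> M"
  shows "(1 - y ^ N) * (scalar (1 / of_nat N) * (\<Sum>k<N. s k)) - 1 \<in> M"
proof -
  let ?g = "\<lambda>k. \<Sum>j<N. (scalar (w ^ k) * y) ^ j"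
  have factor: "U * G * S - G = G * (U * S - 1)" for U G S :: 'a
    by (simp add: algebra_simps)
  have m: "(1 - y ^ N) * s k - ?g k \<in> M" for k
  proof -
    have "(scalar (w ^ k) * y) ^ N = y ^ N"
      using w(1) by (simp add: power_mult_distrib flip: scalar_power power_mult)
        (simp add: mult.commute power_mult scalar_1)
    moreover have "1 - (scalar (w ^ k) * y) ^ N = (1 - scalar (w ^ k) * y) * ?g k"
      by (rule one_diff_power_eq)
    ultimately have "1 - y ^ N = (1 - scalar (w ^ k) * y) * ?g k"
      by simp
    then have "(1 - y ^ N) * s k - ?g k = ?g k * ((1 - scalar (w ^ k) * y) * s k - 1)"
      by (simp only: factor)
    moreover have "?g k \<in> A" using y by (intro closed_intros)
    ultimately show ?thesis using s ideal_mult by simp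
  qed
  have root_sum: "(\<Sum>k<N. (w ^ k) ^ j) = (if j = 0 then of_nat N else 0)" if "j < N" for j
  proof (cases "j = 0")
    case False
    have "(\<Sum>k<N. (w ^ j) ^ k) = ((w ^ j) ^ N - 1) / (w ^ j - 1)"
      using w(2)[of j] False that by (intro geometric_sum) auto
    also have "(w ^ j) ^ N = 1" using w(1) by (simp flip: power_mult) (simp add: mult.commute power_mult)
    finally show ?thesis using False by (simp flip: power_mult add: mult.commute)
  qed simp
  have "(\<Sum>k<N. ?g k) = (\<Sum>j<N. scalar (\<Sum>k<N. (w ^ k) ^ j) * y ^ j)"
    by (subst sum.swap) (simp add: power_mult_distrib scalar_sum sum_distrib_right scalar_power)
  also have "\<dots> = (\<Sum>j<N. if j = 0 then scalar (of_nat N) else 0)"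
    by (intro sum.cong) (auto simp: root_sum scalar_0)
  also have "\<dots> = scalar (of_nat N)" using N by simp
  finally have g: "(\<Sum>k<N. ?g k) = scalar (of_nat N)" .
  have "scalar (1 / of_nat N) * (\<Sum>k<N. (1 - y ^ N) * s k - ?g k) \<in> M"
    using m by (intro ideal_mult ideal_sum) auto
  also have "(\<Sum>k<N. (1 - y ^ N) * s k - ?g k) = (1 - y ^ N) * (\<Sum>k<N. s k) - scalar (of_nat N)"
    using g by (simp add: sum_subtractf sum_distrib_left)
  also have "scalar (1 / of_nat N) * \<dots> =
      (1 - y ^ N) * (scalar (1 / of_nat N) * (\<Sum>k<N. s k)) - scalar (1 / of_nat N) * scalar (of_nat N)"
    by (simp add: algebra_simps)
  also have "scalar (1 / of_nat N) * scalar (of_nat N) = (1::'a)"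
    using N by (simp flip: scalar_mult add: scalar_1)
  finally show ?thesis .
qed

text \<open>Rickart's elementary proof of the Gelfand-Mazur theorem. If \<open>a - z\<close> were invertible for all
  \<open>z\<close>, then \<open>(1 - (a / t) ^ N)\<close> would have the inverse \<open>F N t\<close>, an average of values of a Lipschitz
  function, so \<open>F N\<close> is Lipschitz uniformly in \<open>N\<close>. But \<open>F N t\<close> tends to \<open>1\<close>
  exactly for \<open>t\<close> beyond the spectral radius.\<close>

theorem spectrum_nonempty:
  assumes a: "a \<in> A"
  shows "\<exists>z. a - scalar z \<in> M"
proof (rule ccontr)
  assume neg: "\<nexists>z. a - scalar z \<in> M"
  have "\<exists>r\<in>A. (a - scalar z) * r - 1 \<in> M" for z
    using neg a by (intro inverse_mod closed_intros) auto
  then obtain r where r: "\<And>z. r z \<in> A" "\<And>z. (a - scalar z) * r z - 1 \<in> M" by metis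
  define G where "G z = qnorm (r z)" for z
  have Gnn: "0 \<le> G z" for z unfolding G_def by (intro qnorm_nonneg r)
  have inv_p: "1 \<le> qnorm x * qnorm y" if "x \<in> A" "y \<in> A" "x * y - 1 \<in> M" for x y
  proof -
    have "1 = qnorm (x * y)" using that by (subst qnorm_one[symmetric], intro qnorm_cong[symmetric] closed_intros) auto
    also have "\<dots> \<le> qnorm x * qnorm y" by (rule qnorm_mult) fact+
    finally show ?thesis .
  qed
  have Gpos: "0 < G z" for z
    using inv_p[of "a - scalar z" "r z"] r[of z] a Gnn[of z] unfolding G_def
    by (cases "qnorm (r z) = 0") (auto intro: closed_intros simp: less_le)
  have res: "r z - r w - scalar (z - w) * (r z * r w) \<in> M" for z w
  proof -
    have "r z * ((a - scalar w) * r w - 1) - r w * ((a - scalar z) * r z - 1) \<in> M"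
      by (intro ideal_diff ideal_mult r)
    then have "scalar (-1) * (r z * ((a - scalar w) * r w - 1) - r w * ((a - scalar z) * r z - 1)) \<in> M"
      by (intro ideal_mult) auto
    then show ?thesis
      by (rule ideal_rearrange) (simp add: scalar_minus scalar_1 scalar_diff algebra_simps)
  qed
  have Gdiff: "qnorm (r z - r w) \<le> norm (z - w) * (G z * G w)" for z w
  proof -
    have "qnorm (r z - r w) = qnorm (scalar (z - w) * (r z * r w))"
      using res by (intro qnorm_cong closed_intros r)
    also have "\<dots> \<le> norm (z - w) * qnorm (r z * r w)" by (intro qnorm_scalar closed_intros r)
    also have "\<dots> \<le> norm (z - w) * (G z * G w)"
      unfolding G_def by (intro mult_left_mono qnorm_mult r) auto
    finally show ?thesis .
  qed
  \<comment> \<open>Working with 1 / G makes the estimate global: it has Lipschitz constant 1, so it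
    attains a minimum on a disc, which bounds the resolvent there.\<close>
  have lip: "1 / G w - 1 / G z \<le> norm (z - w)" for z w
  proof -
    have "G z \<le> G w + qnorm (r z - r w)"
      unfolding G_def using qnorm_add[of "r w" "r z - r w"] r by (auto intro: closed_intros)
    with Gdiff[of z w] have "G z - G w \<le> norm (z - w) * (G z * G w)" by simp
    then show ?thesis using Gpos[of z] Gpos[of w] by (simp add: field_simps)
  qed
  have lip': "\<bar>1 / G w - 1 / G z\<bar> \<le> norm (w - z)" for z w
    using lip[of z w] lip[of w z] by (auto simp: norm_minus_commute)
  have cont: "continuous_on UNIV (\<lambda>z. 1 / G z)"
  proof (rule continuous_onI)
    show "\<exists>d>0. \<forall>x'\<in>UNIV. dist x' x < d \<longrightarrow> dist (1 / G x') (1 / G x) \<le> e" if "0 < e" for x :: complex and e :: real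
      using lip' that by (intro exI[of _ e]) (auto simp: dist_norm intro: order_trans[OF lip'] less_imp_le)
  qed
  \<comment> \<open>The infimum of \<open>P\<close> is the spectral radius of \<open>a\<close>
    modulo \<open>M\<close>, as the infimum of the N-th roots of the norms of
    \<open>a ^ N\<close>.\<close>
  define P where "P = {t. 0 < t \<and> (\<exists>N>0. qnorm (a ^ N) < t ^ N)}"
  have P_up: "t \<in> P" if "s \<in> P" "s \<le> t" for s t :: real
  proof -
    from that(1) obtain N where N: "0 < s" "0 < N" "qnorm (a ^ N) < s ^ N" by (auto simp: P_def)
    then have "qnorm (a ^ N) < t ^ N" using power_mono[OF that(2), of N] by simp
    with N that(2) show ?thesis by (auto simp: P_def)
  qed
  have "\<exists>t>0. t \<notin> P"
  proof -
    \<comment> \<open>\<open>r 0\<close> inverts \<open>a\<close> modulo \<open>M\<close>, so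
      \<open>a ^ N\<close> has norm at least (1 / G 0)^N. Anything below 1 / G 0 is outside
      \<open>P\<close>, and the spectral radius is positive.\<close>
    define t where "t = 1 / (2 * G 0)"
    have t: "0 < t" "t * G 0 < 1" using Gpos[of 0] by (auto simp: t_def)
    have "t \<notin> P"
    proof
      assume "t \<in> P"
      then obtain N where N: "N > 0" "qnorm (a ^ N) < t ^ N" by (auto simp: P_def)
      have "a ^ N * r 0 ^ N - 1 \<in> M"
      proof -
        have "(\<Sum>j<N. (a * r 0) ^ j) * (a * r 0 - 1) \<in> M"
          using r(2)[of 0] r(1) a by (intro ideal_mult closed_intros) (auto simp: scalar_0)
        then show ?thesis
          by (rule ideal_rearrange) (simp add: power_diff_1_eq mult.commute flip: power_mult_distrib)
      qed
      then have "1 \<le> qnorm (a ^ N) * qnorm (r 0 ^ N)" using a r by (intro inv_p closed_intros)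
      also have "\<dots> \<le> t ^ N * G 0 ^ N"
        unfolding G_def using N a r by (intro mult_mono qnorm_power qnorm_nonneg closed_intros) (auto simp: t less_imp_le)
      also have "\<dots> < 1"
        using t Gpos[of 0] N by (simp flip: power_mult_distrib add: power_less_one_iff)
      finally show False by simp
    qed
    with t show ?thesis by blast
  qed
  then obtain t0 where t0: "0 < t0" "t0 \<notin> P" by blast
  have P_ne: "qnorm a + 1 \<in> P" using qnorm_nonneg[OF a] by (auto simp: P_def intro!: exI[of _ 1])
  define rho where "rho = Inf P"
  have bdd: "bdd_below P" by (auto simp: P_def intro!: bdd_belowI[of _ 0])
  have rho: "t0 \<le> rho"
    unfolding rho_def using P_ne t0(2) P_up by (intro cInf_greatest) (auto intro: ccontr)
  define T where "T = rho + 1"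
  have "\<exists>z0\<in>cball 0 T. \<forall>z\<in>cball 0 T. 1 / G z0 \<le> 1 / G z"
    using rho t0 by (intro continuous_attains_inf continuous_on_subset[OF cont]) (auto simp: T_def)
  then obtain z0 where z0: "\<And>z. norm z \<le> T \<Longrightarrow> 1 / G z0 \<le> 1 / G z"
    by (metis mem_cball dist_0_norm)
  have K: "G z \<le> G z0" if "norm z \<le> T" for z
    using z0[OF that] Gpos[of z] Gpos[of z0] by (simp add: field_simps)
  define L where "L = G z0 + T * (G z0 * G z0)"
  have L: "0 < L" unfolding L_def using Gpos[of z0] rho t0 by (intro add_pos_nonneg) (auto simp: T_def)
  \<comment> \<open>For z other than 0 this is the inverse of 1 - a / z modulo \<open>M\<close>,
    because (1 - a / z) * (- z) = a - z.\<close>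
  define H where "H z = - (scalar z * r z)" for z
  have HA: "H z \<in> A" for z unfolding H_def by (intro closed_intros r)
  have H_lip: "qnorm (H z - H w) \<le> L * norm (z - w)" if "norm z \<le> T" "norm w \<le> T" for z w
  proof -
    have "H z - H w = - (scalar (z - w) * r z + scalar w * (r z - r w))"
      by (simp add: H_def scalar_diff algebra_simps)
    then have "qnorm (H z - H w) = qnorm (scalar (z - w) * r z + scalar w * (r z - r w))"
      by (simp only:) (intro qnorm_minus closed_intros r)
    also have "\<dots> \<le> qnorm (scalar (z - w) * r z) + qnorm (scalar w * (r z - r w))"
      by (intro qnorm_add closed_intros r)
    also have "\<dots> \<le> norm (z - w) * G z + norm w * qnorm (r z - r w)"
      unfolding G_def by (intro add_mono qnorm_scalar closed_intros r)
    also have "\<dots> \<le> norm (z - w) * G z0 + T * (norm (z - w) * (G z0 * G z0))"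
    proof (intro add_mono mult_mono mult_left_mono K that)
      have "qnorm (r z - r w) \<le> norm (z - w) * (G z * G w)" by (rule Gdiff)
      also have "\<dots> \<le> norm (z - w) * (G z0 * G z0)"
        using that Gnn by (intro mult_left_mono mult_mono K) auto
      finally show "qnorm (r z - r w) \<le> norm (z - w) * (G z0 * G z0)" .
    qed (auto intro!: qnorm_nonneg closed_intros r Gnn simp: T_def intro: order_trans[OF _ rho] less_imp_le[OF t0(1)],
      use rho t0 in auto)
    also have "\<dots> = L * norm (z - w)" by (simp add: L_def algebra_simps)
    finally show ?thesis .
  qed
  define w where "w N = cis (2 * pi / real N)" for N
  have wN: "w N ^ N = 1" if "0 < N" for N using that by (simp add: w_def Complex.DeMoivre)
  have wj: "w N ^ j \<noteq> 1" if "0 < j" "j < N" for N j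
  proof
    assume "w N ^ j = 1"
    then have "cos (real j * (2 * pi / real N)) = 1"
      by (simp add: w_def Complex.DeMoivre complex_eq_iff)
    then obtain n where n: "real j * (2 * pi / real N) = of_int n * (2 * pi)"
      by (auto simp: cos_one_2pi_int)
    then have "real j = of_int n * real N" using that by (simp add: field_simps)
    then have "int j = n * int N" by (metis of_int_eq_iff of_int_mult of_int_of_nat_eq)
    then show False using that by (metis dvd_triv_right int_dvd_int_iff nat_dvd_not_less)
  qed
  \<comment> \<open>At the points t / w^k, \<open>H\<close> inverts 1 - w^k * (a / t), the factors
    of \<open>mult_inverse_average\<close>. Being a mean, \<open>F N\<close> inherits a Lipschitz
    constant independent of N.\<close>
  define F where "F N t = scalar (1 / of_nat N) * (\<Sum>k<N. H (of_real t / w N ^ k))" for N and t :: real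
  have FA: "F N t \<in> A" for N t unfolding F_def by (intro closed_intros HA)
  define x where "x N t = (scalar (1 / of_real t) * a) ^ N" for N and t :: real
  have xA: "x N t \<in> A" for N t unfolding x_def by (intro closed_intros a)
  have w0: "w N \<noteq> 0" for N by (simp add: w_def)
  have F_inv: "(1 - x N t) * F N t - 1 \<in> M" if "0 < N" "0 < t" for N t
    unfolding x_def F_def
  proof (rule mult_inverse_average[OF wN[OF that(1)] wj that(1)])
    fix k
    let ?z = "of_real t / w N ^ k"
    have "scalar (w N ^ k) * (scalar (1 / of_real t) * a) = scalar (1 / ?z) * a"
      by (simp flip: scalar_mult mult.assoc)
    moreover have "(1 - scalar (1 / ?z) * a) * H ?z = (a - scalar ?z) * r ?z"
    proof -
      have "scalar (1 / ?z) * scalar ?z = (1::'a)"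
        using w0 that by (subst scalar_mult[symmetric]) (simp add: scalar_1)
      then have "scalar (1 / ?z) * (scalar ?z * X) = X" for X :: 'a by (simp flip: mult.assoc)
      then have "a * (scalar (1 / ?z) * (scalar ?z * r ?z)) = a * r ?z" by simp
      then show ?thesis unfolding H_def by (simp add: algebra_simps del: times_divide_eq_left times_divide_eq_right)
    qed
    ultimately show "(1 - scalar (w N ^ k) * (scalar (1 / of_real t) * a)) * H ?z - 1 \<in> M"
      using r(2) by simp
  qed (auto intro: closed_intros a HA)
  have F_lip: "qnorm (F N t - F N s) \<le> L * \<bar>t - s\<bar>" if "0 < N" "0 < s" "s \<le> T" "0 < t" "t \<le> T" for N t s
  proof -
    have wn: "norm (w N ^ k) = 1" for k by (simp add: w_def norm_power)
    have "F N t - F N s = scalar (1 / of_nat N) * (\<Sum>k<N. H (of_real t / w N ^ k) - H (of_real s / w N ^ k))"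
      by (simp add: F_def sum_subtractf right_diff_distrib)
    then have "qnorm (F N t - F N s) \<le> norm (1 / of_nat N :: complex) * qnorm (\<Sum>k<N. H (of_real t / w N ^ k) - H (of_real s / w N ^ k))"
      by (simp only:) (intro qnorm_scalar closed_intros HA)
    also have "\<dots> \<le> norm (1 / of_nat N :: complex) * (\<Sum>k<N. L * \<bar>t - s\<bar>)"
    proof (intro mult_left_mono order_trans[OF qnorm_sum] sum_mono)
      fix k
      have "qnorm (H (of_real t / w N ^ k) - H (of_real s / w N ^ k)) \<le> L * norm (of_real t / w N ^ k - of_real s / w N ^ k)"
        using that wn by (intro H_lip) (auto simp: norm_divide)
      also have "norm (of_real t / w N ^ k - of_real s / w N ^ k) = \<bar>t - s\<bar>"
        using wn by (simp flip: diff_divide_distrib of_real_diff add: norm_divide)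
      finally show "qnorm (H (of_real t / w N ^ k) - H (of_real s / w N ^ k)) \<le> L * \<bar>t - s\<bar>" .
    qed (auto intro: closed_intros HA)
    also have "\<dots> = L * \<bar>t - s\<bar>" using that by (simp add: norm_divide)
    finally show ?thesis .
  qed
  \<comment> \<open>Between rho + d and rho - d the function \<open>F\<close> may move by 1/12 = 1/3
    - 1/4; the other two terms keep rho - d positive and rho + d at most \<open>T\<close>.\<close>
  define d where "d = min (1 / (24 * L)) (min (rho / 2) 1)"
  have d: "0 < d" "L * (2 * d) \<le> 1 / 12" "d < rho" "d \<le> 1"
  proof -
    show "0 < d" using L rho t0 by (auto simp: d_def)
    show "d < rho" using rho t0 by (auto simp: d_def min_def)
    have "d \<le> 1 / (24 * L)" by (simp add: d_def)
    then show "L * (2 * d) \<le> 1 / 12" using L by (simp add: field_simps)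
  qed (simp add: d_def)
  obtain t where "t \<in> P" "t < rho + d"
    using cInf_lessD[of P "rho + d"] P_ne d by (auto simp: rho_def)
  with P_up[of t "rho + d"] have "rho + d \<in> P" by simp
  then obtain N where N: "0 < N" "qnorm (a ^ N) < (rho + d) ^ N" by (auto simp: P_def)
  have t1: "0 < rho + d" "0 < rho - d" using d rho t0 by auto
  have px: "qnorm (x N t) \<le> qnorm (a ^ N) / t ^ N" if "0 < t" for N and t :: real
    using qnorm_scalar[of "a ^ N" "(1 / of_real t) ^ N"] a that
    by (simp add: x_def power_mult_distrib power_closed norm_power norm_divide power_divide flip: scalar_power)
  have x1: "qnorm (x N (rho + d)) < 1"
    using px[OF t1(1), of N] N t1 by (simp add: divide_less_eq_1 order_le_less_trans)
  \<comment> \<open>Raising to a power k brings the norm below 1/8; it corresponds to the exponent n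
    = N * k, which is then used at both radii.\<close>
  have "(\<lambda>k. qnorm (x N (rho + d)) ^ k) \<longlonglongrightarrow> 0"
    using x1 qnorm_nonneg[OF xA] by (intro LIMSEQ_realpow_zero)
  then have "\<forall>\<^sub>F k in sequentially. qnorm (x N (rho + d)) ^ k < 1/8" by (rule order_tendstoD) simp
  then obtain k0 where "\<And>k. k0 \<le> k \<Longrightarrow> qnorm (x N (rho + d)) ^ k < 1/8"
    unfolding eventually_sequentially by blast
  from this[OF le_SucI[OF order_refl]] obtain k where k: "0 < k" "qnorm (x N (rho + d)) ^ k < 1/8" by (metis zero_less_Suc)
  define n where "n = N * k"
  have n: "0 < n" using N k by (simp add: n_def)
  have "x n (rho + d) = x N (rho + d) ^ k" by (simp add: x_def n_def power_mult)
  then have "qnorm (x n (rho + d)) \<le> 1/8" using qnorm_power[OF xA, of N "rho + d" k] k by simp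
  then have "qnorm (F n (rho + d) - 1) \<le> 1/4"
    by (rule inverse_close_to_one[OF xA FA F_inv[OF n t1(1)]])
  moreover have "qnorm (F n (rho - d) - F n (rho + d)) \<le> 1/12"
    using F_lip[OF n t1(1) _ t1(2)] d by (force simp: T_def)
  moreover have "qnorm (F n (rho - d) - 1) \<le> qnorm (F n (rho - d) - F n (rho + d)) + qnorm (F n (rho + d) - 1)"
    using qnorm_add[of "F n (rho - d) - F n (rho + d)" "F n (rho + d) - 1"] FA by (auto intro: closed_intros)
  ultimately have "qnorm (F n (rho - d) - 1) \<le> 1/3" by simp
  then have x2: "qnorm (x n (rho - d)) < 1"
    by (rule inverse_close_to_one[OF xA FA F_inv[OF n t1(2)]])
  have "(scalar (of_real (rho - d)) * (scalar (1 / of_real (rho - d)) * a)) ^ n = a ^ n"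
    using t1 by (simp flip: mult.assoc scalar_mult add: scalar_1 del: of_real_diff)
  then have "a ^ n = scalar (of_real (rho - d) ^ n) * x n (rho - d)"
    unfolding x_def power_mult_distrib[of "scalar (of_real (rho - d))"] scalar_power by (rule sym)
  then have "qnorm (a ^ n) \<le> (rho - d) ^ n * qnorm (x n (rho - d))"
    using qnorm_scalar[OF xA, of "of_real (rho - d) ^ n" n "rho - d"] t1
    by (simp only: norm_power norm_of_real)
  also have "\<dots> < (rho - d) ^ n * 1" using x2 t1 by (intro mult_strict_left_mono) auto
  finally have "rho - d \<in> P" using n t1 by (auto simp: P_def)
  then have "rho \<le> rho - d" unfolding rho_def using bdd by (intro cInf_lower)
  with d show False by simp
qed

lemma spectrum_unique: "a \<in> A \<Longrightarrow> a - scalar z \<in> M \<Longrightarrow> a - scalar w \<in> M \<Longrightarrow> z = w"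
proof (rule ccontr)
  assume *: "a - scalar z \<in> M" "a - scalar w \<in> M" "z \<noteq> w"
  have "scalar (w - z) * 1 \<in> M"
    using ideal_diff[OF *(1,2)] by (simp add: scalar_diff)
  then show False using ideal_scaled[of "w - z" 1] one_notin * by auto
qed

definition evaluation :: "'a \<Rightarrow> complex" where
  "evaluation a = (THE z. a - scalar z \<in> M)"

lemma evaluation_eqI: "a \<in> A \<Longrightarrow> a - scalar z \<in> M \<Longrightarrow> evaluation a = z"
  unfolding evaluation_def using spectrum_unique by blast

lemma evaluation_mod: "a \<in> A \<Longrightarrow> a - scalar (evaluation a) \<in> M"
  using spectrum_nonempty evaluation_eqI by metis

end

section \<open>Homomorphisms vanishing on a proper ideal\<close>

context bounded_algebra
begin

text \<open>In contrast to \<open>character_space\<close>, values outside \<open>A\<close> are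
  arbitrary, so a character of a larger algebra is itself a homomorphism of \<open>A\<close> without
  being cut down.\<close>

definition hom :: "('a \<Rightarrow> complex) \<Rightarrow> bool" where
  "hom h \<longleftrightarrow> h 1 = 1 \<and> (\<forall>x\<in>A. \<forall>y\<in>A. h (x + y) = h x + h y \<and> h (x * y) = h x * h y) \<and>
     (\<forall>c. \<forall>x\<in>A. h (c *\<^sub>C x) = c * h x)"

theorem hom_vanishing_on_ideal:
  assumes "is_ideal I" "1 \<notin> I"
  shows "\<exists>h. hom h \<and> (\<forall>x\<in>I. h x = 0)"
proof -
  from maximal_ideal_exists[OF assms] obtain M where M: "maximal_ideal M" "I \<subseteq> M" by blast
  interpret maximal_ideal A bd M by unfold_locales fact
  have 1: "evaluation 1 = 1" by (rule evaluation_eqI) (auto simp: scalar_1)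
  have add: "evaluation (x + y) = evaluation x + evaluation y" if "x \<in> A" "y \<in> A" for x y
  proof (rule evaluation_eqI)
    show "x + y - scalar (evaluation x + evaluation y) \<in> M"
      by (rule ideal_rearrange[OF ideal_add[OF evaluation_mod[OF that(1)] evaluation_mod[OF that(2)]]])
        (simp add: scalar_add algebra_simps)
  qed (use that in \<open>auto intro: closed_intros\<close>)
  have mult: "evaluation (x * y) = evaluation x * evaluation y" if "x \<in> A" "y \<in> A" for x y
  proof (rule evaluation_eqI)
    show "x * y - scalar (evaluation x * evaluation y) \<in> M"
      by (rule ideal_rearrange[OF ideal_add[OF ideal_mult[OF that(1) evaluation_mod[OF that(2)]]
            ideal_mult[OF scalar_closed[of "evaluation y"] evaluation_mod[OF that(1)]]]])
        (simp add: scalar_mult algebra_simps)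
  qed (use that in \<open>auto intro: closed_intros\<close>)
  have sc: "evaluation (c *\<^sub>C x) = c * evaluation x" if "x \<in> A" for c x
  proof -
    have "evaluation (scalar c) = c" by (rule evaluation_eqI) auto
    then show ?thesis using mult[of "scalar c" x] that by (simp add: mult_scaleC_left)
  qed
  have "evaluation x = 0" if "x \<in> I" for x
    using that M(2) ideal_sub by (intro evaluation_eqI) (auto simp: scalar_0)
  with 1 add mult sc show ?thesis by (auto simp: hom_def)
qed

end

section \<open>The algebra of bounded analytic functions\<close>

interpretation circle: prob_space circle_measure
  by (rule prob_space_circle_measure)

lemma borel_measurable_circle_continuous:
  "continuous_on (sphere 0 1) f \<Longrightarrow> f \<in> borel_measurable circle_measure" for f :: "complex \<Rightarrow> 'a::topological_space"
  unfolding measurable_cong_sets[OF sets_circle_measure refl]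
  by (rule borel_measurable_continuous_on_restrict)

lemma AE_circleI: "(\<And>z. norm z = 1 \<Longrightarrow> P z) \<Longrightarrow> AE z in circle_measure. P z"
  by (rule AE_I2) (simp add: space_circle_measure)

lemma AE_circle_unit: "AE z in circle_measure. norm z = 1"
  by (rule AE_circleI)

lemma ess_bounded_measurable: "ess_bounded f \<Longrightarrow> f \<in> borel_measurable circle_measure"
  by (simp add: ess_bounded_def)

lemma ess_bounded_integrable: "ess_bounded f \<Longrightarrow> integrable circle_measure f"
  unfolding ess_bounded_def by (auto intro: circle.integrable_const_bound)

lemma ess_boundedI:
  "f \<in> borel_measurable circle_measure \<Longrightarrow> AE z in circle_measure. norm (f z) \<le> B \<Longrightarrow> ess_bounded f"
  by (auto simp: ess_bounded_def)

lemma ess_bounded_poly: "ess_bounded (poly p)" for p :: "complex poly"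
  by (intro ess_bounded_continuous continuous_intros)

lemma ess_bounded_monomial: "ess_bounded (\<lambda>z. z ^ n)"
  by (intro ess_bounded_continuous continuous_intros)

lemma ess_bounded_sum: "(\<And>i. i \<in> S \<Longrightarrow> ess_bounded (f i)) \<Longrightarrow> ess_bounded (\<lambda>z. \<Sum>i\<in>S. f i z)"
  by (induction S rule: infinite_finite_induct) (auto intro: ess_bounded_add ess_bounded_const)

lemma ess_bounded_cnj: "ess_bounded f \<Longrightarrow> ess_bounded (\<lambda>z. cnj (f z))"
  using borel_measurable_continuous_on[OF continuous_on_cnj[OF continuous_on_id], of f circle_measure]
  by (auto simp: ess_bounded_def)

section \<open>Density of trigonometric polynomials on the circle\<close>

lemma unit_mult_cnj: "norm z = 1 \<Longrightarrow> z * cnj z = 1"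
  by (simp add: complex_norm_square[symmetric])

text \<open>Trigonometric polynomials are kept in the form q(z) * cnj z ^ n, all negative
  frequencies in one factor. Adding two of them means passing to a common power, by z * cnj z =
  1.\<close>

lemma trig_polynomial_add:
  fixes z :: complex
  assumes z: "norm z = 1"
  shows "poly (q * monom 1 m + r * monom 1 n) z * cnj z ^ (n + m) = poly q z * cnj z ^ n + poly r z * cnj z ^ m"
proof -
  have "poly (q * monom 1 m + r * monom 1 n) z * cnj z ^ (n + m) =
      poly q z * cnj z ^ n * (z * cnj z) ^ m + poly r z * cnj z ^ m * (z * cnj z) ^ n"
    unfolding power_mult_distrib by (simp add: poly_monom power_add algebra_simps)
  then show ?thesis by (simp only: unit_mult_cnj[OF z] power_one mult_1_right)
qed

lemma trig_polynomial_approx_real: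
  fixes f :: "complex \<Rightarrow> real"
  assumes "continuous_on (sphere 0 1) f" "0 < e"
  shows "\<exists>g. (\<exists>q n. \<forall>z. norm z = 1 \<longrightarrow> of_real (g z) = poly q z * cnj z ^ n) \<and>
           (\<forall>z. norm z = 1 \<longrightarrow> \<bar>f z - g z\<bar> < e)"
proof -
  define P where "P g \<longleftrightarrow> continuous_on (sphere 0 1) g \<and>
      (\<exists>q n. \<forall>z. norm z = 1 \<longrightarrow> of_real (g z) = poly q z * cnj z ^ n)" for g :: "complex \<Rightarrow> real"
  have cancel: "z ^ k * (cnj z ^ k * w) = w" if "norm z = 1" for z w :: complex and k
    using unit_mult_cnj[OF that] by (simp flip: mult.assoc power_mult_distrib)
  have "\<exists>g. P g \<and> (\<forall>z\<in>sphere 0 1. \<bar>f z - g z\<bar> < e)"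
  proof (rule Stone_Weierstrass_HOL[OF _ _ _ _ _ _ assms])
    show "P (\<lambda>z. c)" for c
      unfolding P_def by (intro conjI exI[of _ "[:of_real c:]"] exI[of _ 0] continuous_intros) auto
    show "continuous_on (sphere 0 1) g" if "P g" for g using that by (simp add: P_def)
    fix g h assume "P g \<and> P h"
    then obtain q n r m where
      g: "continuous_on (sphere 0 1) g" "\<And>z. norm z = 1 \<Longrightarrow> of_real (g z) = poly q z * cnj z ^ n" and
      h: "continuous_on (sphere 0 1) h" "\<And>z. norm z = 1 \<Longrightarrow> of_real (h z) = poly r z * cnj z ^ m"
      by (auto simp: P_def)
    have "of_real (g z + h z) = poly (q * monom 1 m + r * monom 1 n) z * cnj z ^ (n + m)" if z: "norm z = 1" for z
      by (simp only: of_real_add g(2)[OF z] h(2)[OF z] trig_polynomial_add[OF z])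
    then show "P (\<lambda>z. g z + h z)"
      unfolding P_def using continuous_on_add[OF g(1) h(1)] by blast
    show "P (\<lambda>z. g z * h z)"
      unfolding P_def using g h
      by (auto intro!: continuous_intros exI[of _ "q * r"] exI[of _ "n + m"]
          simp: power_add algebra_simps)
  next
    fix z w :: complex assume zw: "z \<in> sphere 0 1 \<and> w \<in> sphere 0 1 \<and> z \<noteq> w"
    have "P Re"
      unfolding P_def
    proof (intro conjI exI allI impI)
      fix z :: complex assume "norm z = 1"
      then have "poly [:1/2, 0, 1/2:] z * cnj z ^ 1 = (cnj z + z) / 2"
        using cancel[of z 1 z] by (simp add: algebra_simps)
      then show "of_real (Re z) = poly [:1/2, 0, 1/2:] z * cnj z ^ 1"
        by (simp add: complex_eq_iff)
    qed (intro continuous_intros)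
    moreover have "P Im"
      unfolding P_def
    proof (intro conjI exI allI impI)
      fix z :: complex assume "norm z = 1"
      then have "poly [:\<i>/2, 0, -\<i>/2:] z * cnj z ^ 1 = (cnj z - z) * \<i> / 2"
        using cancel[of z 1 z] by (simp add: algebra_simps)
      then show "of_real (Im z) = poly [:\<i>/2, 0, -\<i>/2:] z * cnj z ^ 1"
        by (simp add: complex_eq_iff)
    qed (intro continuous_intros)
    ultimately show "\<exists>f. P f \<and> f z \<noteq> f w"
      using zw complex_eqI by blast
  qed simp
  then obtain g where "P g" "\<And>z. norm z = 1 \<Longrightarrow> \<bar>f z - g z\<bar> < e" by (metis mem_sphere_0)
  then show ?thesis unfolding P_def by blast
qed

lemma trig_polynomial_approx:
  fixes f :: "complex \<Rightarrow> complex"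
  assumes f: "continuous_on (sphere 0 1) f" and e: "0 < e"
  shows "\<exists>q n. \<forall>z. norm z = 1 \<longrightarrow> norm (f z - poly q z * cnj z ^ n) < e"
proof -
  obtain g q n where g: "\<And>z. norm z = 1 \<Longrightarrow> of_real (g z) = poly q z * cnj z ^ n"
      "\<And>z. norm z = 1 \<Longrightarrow> \<bar>Re (f z) - g z\<bar> < e/2"
    using trig_polynomial_approx_real[OF continuous_on_Re[OF f], of "e/2"] e by auto
  obtain h r m where h: "\<And>z. norm z = 1 \<Longrightarrow> of_real (h z) = poly r z * cnj z ^ m"
      "\<And>z. norm z = 1 \<Longrightarrow> \<bar>Im (f z) - h z\<bar> < e/2"
    using trig_polynomial_approx_real[OF continuous_on_Im[OF f], of "e/2"] e by auto
  show ?thesis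
  proof (intro exI allI impI)
    fix z :: complex assume z: "norm z = 1"
    have "poly (q * monom 1 m + smult \<i> r * monom 1 n) z * cnj z ^ (n + m) = of_real (g z) + \<i> * of_real (h z)"
      unfolding trig_polynomial_add[OF z] by (simp add: z g h)
    then have "norm (f z - poly (q * monom 1 m + smult \<i> r * monom 1 n) z * cnj z ^ (n + m)) =
        norm (Complex (Re (f z) - g z) (Im (f z) - h z))"
      by (simp only:) (rule arg_cong[where f = norm], simp add: complex_eq_iff)
    also have "\<dots> \<le> \<bar>Re (f z) - g z\<bar> + \<bar>Im (f z) - h z\<bar>"
      by (rule order_trans[OF cmod_le]) simp
    also have "\<dots> < e" using g(2)[OF z] h(2)[OF z] by simp
    finally show "norm (f z - poly (q * monom 1 m + smult \<i> r * monom 1 n) z * cnj z ^ (n + m)) < e" .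
  qed
qed

text \<open>Continuity across the jump of \<open>Arg2pi\<close> comes from homotopy theory: a closed
  loop is homotopic to itself, the library turns this into a homotopy of circle maps, and its ends
  are continuous.\<close>

lemma continuous_on_circle_loop:
  fixes C :: "real \<Rightarrow> complex"
  assumes "continuous_on UNIV C" "C 0 = 0" "C (2 * pi) = 0"
  shows "continuous_on (sphere 0 1) (\<lambda>z. C (Arg2pi z))"
proof -
  define p where "p s = C (2 * pi * s)" for s
  have "path p"
    unfolding path_def p_def by (intro continuous_on_compose2[OF assms(1)] continuous_intros) auto
  moreover have "pathfinish p = pathstart p"
    using assms by (simp add: pathfinish_def pathstart_def p_def)
  ultimately have "homotopic_loops UNIV p p" by (simp add: homotopic_loops_refl)
  then have "continuous_on (sphere 0 1) (p \<circ> (\<lambda>z. Arg2pi z / (2 * pi)))"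
    using homotopic_loops_imp_homotopic_circlemaps homotopic_with_imp_continuous by blast
  then show ?thesis by (simp add: o_def p_def)
qed

lemma Arg2pi_cis: "0 \<le> t \<Longrightarrow> t < 2 * pi \<Longrightarrow> Arg2pi (cis t) = t"
  by (rule Arg2pi_unique[of 1]) (auto simp: cis_conv_exp)

text \<open>Pulled back along \<open>cis\<close>, a measurable function is an almost everywhere
  limit of continuous ones. Projecting these to the ball of radius \<open>B\<close> gives dominated
  convergence, and a cut-off at both ends of the period lets them descend to the circle.\<close>

lemma continuous_approx_L2:
  fixes g :: "complex \<Rightarrow> complex"
  assumes g: "g \<in> borel_measurable circle_measure" and B: "\<And>z. norm (g z) \<le> B" and e: "0 < e"
  shows "\<exists>D. continuous_on (sphere 0 1) D \<and> (\<integral>z. (norm (g z - D z))\<^sup>2 \<partial>circle_measure) < e"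
proof -
  have B0: "0 \<le> B" using B[of 0] norm_ge_zero order_trans by blast
  have cis: "cis \<in> measurable borel (restrict_space borel (sphere 0 1))"
    using measurable_cis_circle by (simp cong: measurable_cong_sets)
  have g': "g \<in> borel_measurable (restrict_space borel (sphere 0 1))"
    using g by (simp cong: measurable_cong_sets add: sets_circle_measure)
  have gc[measurable]: "(\<lambda>t. g (cis t)) \<in> borel_measurable borel"
    using measurable_compose[OF cis g'] by simp
  have "(\<lambda>t. g (cis t)) measurable_on UNIV"
    by (intro lebesgue_measurable_imp_measurable_on measurable_completion) auto
  then obtain N c where N: "negligible N" and c: "\<And>n. continuous_on UNIV (c n)"
      and lim: "\<And>t. t \<notin> N \<Longrightarrow> (\<lambda>n. c n t) \<longlonglongrightarrow> g (cis t)"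
    unfolding measurable_on_def by auto
  define clip where "clip = closest_point (cball 0 B :: complex set)"
  have clip_cont: "continuous_on UNIV clip"
    unfolding clip_def using B0 by (intro continuous_on_closest_point) auto
  have clip_le: "norm (clip w) \<le> B" for w
    using closest_point_in_set[of "cball 0 B :: complex set" w] B0 by (auto simp: clip_def)
  have clip_id: "clip w = w" if "norm w \<le> B" for w
    using that by (simp add: clip_def closest_point_self)
  \<comment> \<open>The cut-off vanishes at 0 and 2 pi, as \<open>continuous_on_circle_loop\<close>
    demands, and is eventually 1 at each point in between.\<close>
  define k where "k n t = max 0 (min 1 (min (real n * t) (real n * (2 * pi - t))))" for n t
  have k_lim: "(\<lambda>n. k n t) \<longlonglongrightarrow> 1" if "0 < t" "t < 2 * pi" for t
  proof (rule tendsto_eventually)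
    have "\<forall>\<^sub>F n in sequentially. real n > 1 / t" "\<forall>\<^sub>F n in sequentially. real n > 1 / (2 * pi - t)"
      using filterlim_real_sequentially by (auto simp: filterlim_at_top_dense)
    then show "\<forall>\<^sub>F n in sequentially. k n t = 1"
    proof eventually_elim
      case (elim n)
      have "1 < real n * t" "1 < real n * (2 * pi - t)"
        using elim that by (simp_all add: pos_divide_less_eq)
      then show ?case by (simp add: k_def)
    qed
  qed
  define C where "C n t = of_real (k n t) * clip (c n t)" for n t
  have C_cont: "continuous_on UNIV (C n)" for n
    unfolding C_def k_def
    by (intro continuous_intros continuous_on_compose2[OF clip_cont] continuous_on_compose2[OF c]) auto
  have C_le: "norm (C n t) \<le> B" for n t
  proof -
    have "norm (C n t) = k n t * norm (clip (c n t))" by (simp add: C_def norm_mult k_def)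
    also have "\<dots> \<le> 1 * B" by (intro mult_mono clip_le) (auto simp: k_def)
    finally show ?thesis by simp
  qed
  have C_lim: "(\<lambda>n. C n t) \<longlonglongrightarrow> g (cis t)" if "t \<notin> N" "0 < t" "t < 2 * pi" for t
  proof -
    have "(\<lambda>n. clip (c n t)) \<longlonglongrightarrow> clip (g (cis t))"
      by (rule continuous_on_tendsto_compose[OF clip_cont lim[OF that(1)]]) simp_all
    then have "(\<lambda>n. C n t) \<longlonglongrightarrow> of_real 1 * clip (g (cis t))"
      unfolding C_def by (intro tendsto_intros k_lim that)
    then show ?thesis by (simp add: clip_id B)
  qed
  define D where "D n z = C n (Arg2pi z)" for n z
  have D_cont: "continuous_on (sphere 0 1) (D n)" for n
    unfolding D_def using C_cont by (intro continuous_on_circle_loop) (auto simp: C_def k_def)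
  note [measurable] = g borel_measurable_circle_continuous[OF D_cont]
    borel_measurable_continuous_onI[OF C_cont]
  define J where "J n = (\<integral>z. (norm (g z - D n z))\<^sup>2 \<partial>circle_measure)" for n
  let ?I = "\<lambda>n. \<integral>t. indicator {0..<2 * pi} t *\<^sub>R complex_of_real ((norm (g (cis t) - C n t))\<^sup>2) \<partial>lborel"
  have J: "complex_of_real (J n) = (1 / (2 * pi)) *\<^sub>R ?I n" for n
  proof -
    have "complex_of_real (J n) = (\<integral>z. complex_of_real ((norm (g z - D n z))\<^sup>2) \<partial>circle_measure)"
      unfolding J_def by (rule integral_complex_of_real[symmetric])
    also have "\<dots> = (1 / (2 * pi)) *\<^sub>R (LBINT t:{0..<2 * pi}. complex_of_real ((norm (g (cis t) - D n (cis t)))\<^sup>2))"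
      by (rule integral_circle_measure) measurable
    also have "(LBINT t:{0..<2 * pi}. complex_of_real ((norm (g (cis t) - D n (cis t)))\<^sup>2)) = ?I n"
      unfolding set_lebesgue_integral_def
      by (intro Bochner_Integration.integral_cong) (auto simp: D_def Arg2pi_cis indicator_def)
    finally show ?thesis .
  qed
  have "?I \<longlonglongrightarrow> (\<integral>t. 0 \<partial>(lborel :: real measure))"
  proof (rule integral_dominated_convergence[where w = "\<lambda>t. indicator {0..2 * pi} t * (2 * B)\<^sup>2"])
    show "integrable lborel (\<lambda>t. indicator {0..2 * pi} t * (2 * B)\<^sup>2 :: real)"
      by (intro integrable_mult_left integrable_real_indicator) auto
    have "AE t in lebesgue. t \<notin> N" using N by (simp add: negligible_iff_null_sets AE_not_in)
    then have N': "AE t in lborel. t \<notin> N" by (simp add: AE_completion_iff)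
    show "AE t in lborel. (\<lambda>n. indicator {0..<2 * pi} t *\<^sub>R complex_of_real ((norm (g (cis t) - C n t))\<^sup>2)) \<longlonglongrightarrow> 0"
      using N' AE_lborel_singleton[of "0::real"]
    proof eventually_elim
      case (elim t)
      show ?case
      proof (cases "t \<in> {0..<2 * pi}")
        case True
        then have "(\<lambda>n. (norm (g (cis t) - C n t))\<^sup>2) \<longlonglongrightarrow> (norm (g (cis t) - g (cis t)))\<^sup>2"
          using elim by (intro tendsto_intros C_lim) auto
        then have "(\<lambda>n. complex_of_real ((norm (g (cis t) - C n t))\<^sup>2)) \<longlonglongrightarrow> of_real 0"
          by (intro tendsto_of_real) simp
        with True show ?thesis by simp
      qed simp
    qed
    show "AE t in lborel. norm (indicator {0..<2 * pi} t *\<^sub>R complex_of_real ((norm (g (cis t) - C n t))\<^sup>2))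
        \<le> indicator {0..2 * pi} t * (2 * B)\<^sup>2" for n
    proof (rule AE_I2)
      fix t
      have "norm (g (cis t) - C n t) \<le> 2 * B"
        using norm_triangle_ineq4[of "g (cis t)" "C n t"] B[of "cis t"] C_le[of n t] by simp
      then have "(norm (g (cis t) - C n t))\<^sup>2 \<le> (2 * B)\<^sup>2" by (intro power_mono) auto
      then show "norm (indicator {0..<2 * pi} t *\<^sub>R complex_of_real ((norm (g (cis t) - C n t))\<^sup>2))
        \<le> indicator {0..2 * pi} t * (2 * B)\<^sup>2"
        by (simp add: indicator_def norm_power del: power_mult_distrib)
    qed
  qed measurable
  then have "(\<lambda>n. (1 / (2 * pi)) *\<^sub>R ?I n) \<longlonglongrightarrow> (1 / (2 * pi)) *\<^sub>R 0"
    by (intro tendsto_intros) simp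
  then have "(\<lambda>n. complex_of_real (J n)) \<longlonglongrightarrow> of_real 0" unfolding J by simp
  then have "J \<longlonglongrightarrow> 0" by (simp only: tendsto_of_real_iff)
  then have "\<forall>\<^sub>F n in sequentially. J n < e" using e by (rule order_tendstoD)
  then obtain n where "J n < e" by (auto simp: eventually_sequentially)
  with D_cont show ?thesis by (auto simp: J_def)
qed

lemma trig_polynomial_approx_L2:
  assumes g: "ess_bounded g" and e: "0 < e"
  shows "\<exists>q n. (\<integral>z. (norm (g z - poly q z * cnj z ^ n))\<^sup>2 \<partial>circle_measure) < e"
proof -
  from g obtain B where B: "AE z in circle_measure. norm (g z) \<le> B" and gm[measurable]: "g \<in> borel_measurable circle_measure"
    by (auto simp: ess_bounded_def)
  \<comment> \<open>A change on a null set makes the bound hold everywhere, as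
    \<open>continuous_approx_L2\<close> requires.\<close>
  define h where "h z = (if norm (g z) \<le> max B 0 then g z else 0)" for z
  have hm[measurable]: "h \<in> borel_measurable circle_measure" unfolding h_def by measurable
  have hB: "norm (h z) \<le> max B 0" for z by (simp add: h_def)
  have hg: "AE z in circle_measure. h z = g z" using B by eventually_elim (auto simp: h_def)
  obtain D where D: "continuous_on (sphere 0 1) D" "(\<integral>z. (norm (h z - D z))\<^sup>2 \<partial>circle_measure) < e/4"
    using continuous_approx_L2[OF hm hB, of "e/4"] e by auto
  \<comment> \<open>By (x + y)^2 <= 2 * x^2 + 2 * y^2 each of the two squared errors may cost
    e/4.\<close>
  obtain q n where q: "\<And>z. norm z = 1 \<Longrightarrow> norm (D z - poly q z * cnj z ^ n) < sqrt (e/4)"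
    using trig_polynomial_approx[OF D(1), of "sqrt (e/4)"] e by auto
  let ?p = "\<lambda>z. poly q z * cnj z ^ n"
  have Dq: "AE z in circle_measure. norm (D z - ?p z) < sqrt (e/4)"
    by (rule AE_circleI) (rule q)
  have eb: "ess_bounded D" "ess_bounded h" "ess_bounded ?p"
    using D(1) ess_boundedI[OF hm AE_I2[OF hB]]
    by (auto intro!: ess_bounded_continuous[of D] ess_bounded_continuous[of ?p] continuous_intros)
  have int: "integrable circle_measure (\<lambda>z. (norm (f z))\<^sup>2)" if "ess_bounded f" for f :: "complex \<Rightarrow> complex"
  proof -
    have "integrable circle_measure (\<lambda>z. norm (f z * f z))"
      using that by (intro integrable_norm ess_bounded_integrable ess_bounded_mult)
    then show ?thesis by (simp add: norm_mult power2_eq_square)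
  qed
  have "(\<integral>z. (norm (g z - ?p z))\<^sup>2 \<partial>circle_measure) \<le> (\<integral>z. 2 * (norm (h z - D z))\<^sup>2 + e/2 \<partial>circle_measure)"
  proof (rule integral_mono_AE)
    show "AE z in circle_measure. (norm (g z - ?p z))\<^sup>2 \<le> 2 * (norm (h z - D z))\<^sup>2 + e/2"
      using hg Dq
    proof eventually_elim
      case (elim z)
      have "(norm (D z - ?p z))\<^sup>2 \<le> (sqrt (e/4))\<^sup>2" using elim by (intro power_mono) auto
      then have 1: "(norm (D z - ?p z))\<^sup>2 \<le> e/4" using e by simp
      have "(norm (g z - ?p z))\<^sup>2 \<le> (norm (h z - D z) + norm (D z - ?p z))\<^sup>2"
        using norm_triangle_ineq[of "h z - D z" "D z - ?p z"] elim by (intro power_mono) auto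
      also have "\<dots> \<le> 2 * (norm (h z - D z))\<^sup>2 + 2 * (norm (D z - ?p z))\<^sup>2"
        using sum_squares_bound[of "norm (h z - D z)" "norm (D z - ?p z)"] by (simp add: power2_sum)
      finally show ?case using 1 by simp
    qed
    show "integrable circle_measure (\<lambda>z. (norm (g z - ?p z))\<^sup>2)"
      by (intro int ess_bounded_diff g eb)
    show "integrable circle_measure (\<lambda>z. 2 * (norm (h z - D z))\<^sup>2 + e/2)"
      by (intro Bochner_Integration.integrable_add integrable_mult_right int ess_bounded_diff eb) simp
  qed
  also have "\<dots> = 2 * (\<integral>z. (norm (h z - D z))\<^sup>2 \<partial>circle_measure) + e/2"
    by (subst Bochner_Integration.integral_add)
      (auto intro!: integrable_mult_right int ess_bounded_diff eb simp: circle.prob_space)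
  also have "\<dots> < e" using D by simp
  finally show ?thesis by blast
qed

text \<open>The factor \<open>z\<close> inside \<open>cnj\<close> keeps the antianalytic part free
  of a constant term, which makes it orthogonal to H^inf. The induction cancels one \<open>z\<close>
  against one \<open>cnj z\<close> per step.\<close>

lemma trig_polynomial_split:
  fixes q :: "complex poly"
  shows "\<exists>a b. \<forall>z. norm z = 1 \<longrightarrow> poly q z * cnj z ^ n = poly a z + cnj (z * poly b z)"
proof (induction q arbitrary: n)
  case 0
  show ?case by (rule exI[of _ 0], rule exI[of _ 0]) simp
next
  case (pCons c q)
  show ?case
  proof (cases n)
    case 0
    show ?thesis by (rule exI[of _ "pCons c q"], rule exI[of _ 0]) (simp add: 0)
  next
    case (Suc m)
    obtain a b where ab: "\<And>z. norm z = 1 \<Longrightarrow> poly q z * cnj z ^ m = poly a z + cnj (z * poly b z)"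
      using pCons.IH[of m] by blast
    show ?thesis
    proof (intro exI allI impI)
      fix z :: complex assume z: "norm z = 1"
      have "poly (pCons c q) z * cnj z ^ n = c * cnj z ^ Suc m + (z * cnj z) * (poly q z * cnj z ^ m)"
        by (simp add: Suc algebra_simps)
      also have "\<dots> = poly a z + cnj (z * poly (b + monom (cnj c) m) z)"
        unfolding unit_mult_cnj[OF z] ab[OF z] by (simp add: algebra_simps poly_monom)
      finally show "poly (pCons c q) z * cnj z ^ n = poly a z + cnj (z * poly (b + monom (cnj c) m) z)" .
    qed
  qed
qed

section \<open>Functions representing elements of H^inf\<close>

definition hardy :: "(complex \<Rightarrow> complex) \<Rightarrow> bool" where
  "hardy f \<longleftrightarrow> ess_bounded f \<and> (\<forall>n>0. (\<integral>z. f z * z ^ n \<partial>circle_measure) = 0)"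

lemma hardy_ess_bounded: "hardy f \<Longrightarrow> ess_bounded f"
  and hardy_integral: "hardy f \<Longrightarrow> 0 < n \<Longrightarrow> (\<integral>z. f z * z ^ n \<partial>circle_measure) = 0"
  by (auto simp: hardy_def)

lemma integral_monomial:
  assumes "0 < n" shows "(\<integral>z. z ^ n \<partial>circle_measure) = 0"
proof -
  have "(\<integral>z. z ^ n \<partial>circle_measure) = (1 / (2 * pi)) *\<^sub>R (LBINT t:{0..<2 * pi}. cis t ^ n)"
    by (intro integral_circle_measure ess_bounded_measurable ess_bounded_monomial)
  also have "(LBINT t:{0..<2 * pi}. cis t ^ n) = (\<integral>t. indicator {0..2 * pi} t *\<^sub>R cis (real n * t) \<partial>lborel)"
    unfolding set_lebesgue_integral_def
  proof (rule integral_cong_AE)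
    show "AE t in lborel. indicator {0..<2 * pi} t *\<^sub>R cis t ^ n = indicator {0..2 * pi} t *\<^sub>R cis (real n * t)"
      using AE_lborel_singleton[of "2 * pi"]
      by eventually_elim (auto simp: indicator_def Complex.DeMoivre)
    have "continuous_on UNIV (\<lambda>t. cis (real n * t))" "continuous_on UNIV (\<lambda>t. cis t ^ n)"
      by (intro continuous_intros)+
    note [measurable] = this[THEN borel_measurable_continuous_onI]
    show "(\<lambda>t. indicator {0..<2 * pi} t *\<^sub>R cis t ^ n) \<in> borel_measurable lborel"
      "(\<lambda>t. indicator {0..2 * pi} t *\<^sub>R cis (real n * t)) \<in> borel_measurable lborel" by measurable
  qed
  also have "\<dots> = cis (real n * (2 * pi)) / (\<i> * real n) - cis (real n * 0) / (\<i> * real n)"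
  proof (rule integral_FTC_atLeastAtMost)
    fix t
    show "((\<lambda>t. cis (real n * t) / (\<i> * real n)) has_vector_derivative cis (real n * t)) (at t within {0..2 * pi})"
    proof -
      have "((\<lambda>z. exp (\<i> * (real n * z)) / (\<i> * real n)) has_field_derivative exp (\<i> * (real n * of_real t))) (at (of_real t))"
        using assms by (auto intro!: derivative_eq_intros simp: field_simps)
      from has_vector_derivative_real_field[OF this] show ?thesis
        unfolding cis_conv_exp by (simp add: mult.assoc)
    qed
  qed (auto intro!: continuous_intros)
  also have "cis (real n * (2 * pi)) = 1"
    using cis_multiple_2pi[of "real n"] by (simp add: mult.commute)
  finally show ?thesis by simp
qed

lemma hardy_const: "hardy (\<lambda>_. c)"
  using integral_monomial by (simp add: hardy_def ess_bounded_const)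

lemma hardy_id: "hardy (\<lambda>z. z)"
  using integral_monomial[of "Suc _"] ess_bounded_monomial[of 1] by (simp add: hardy_def)

lemma hardy_add: assumes "hardy f" "hardy g" shows "hardy (\<lambda>z. f z + g z)"
  unfolding hardy_def
proof (intro conjI allI impI)
  fix n :: nat assume n: "0 < n"
  have "(\<integral>z. (f z + g z) * z ^ n \<partial>circle_measure) = (\<integral>z. f z * z ^ n \<partial>circle_measure) + (\<integral>z. g z * z ^ n \<partial>circle_measure)"
    unfolding distrib_right
    by (intro Bochner_Integration.integral_add ess_bounded_integrable ess_bounded_mult ess_bounded_monomial
        hardy_ess_bounded assms)
  then show "(\<integral>z. (f z + g z) * z ^ n \<partial>circle_measure) = 0"
    using assms n by (simp add: hardy_integral)
qed (intro ess_bounded_add hardy_ess_bounded assms)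

lemma hardy_cmult: assumes "hardy f" shows "hardy (\<lambda>z. c * f z)"
  using assms by (auto simp: hardy_def ess_bounded_cmult mult.assoc)

lemma hardy_sum: "(\<And>i. i \<in> S \<Longrightarrow> hardy (f i)) \<Longrightarrow> hardy (\<lambda>z. \<Sum>i\<in>S. f i z)"
  by (induction S rule: infinite_finite_induct) (auto intro: hardy_add hardy_const)

lemma hardy_integral_poly:
  assumes "hardy f" "0 < n"
  shows "(\<integral>z. f z * poly a z * z ^ n \<partial>circle_measure) = 0"
proof -
  have "(\<integral>z. f z * poly a z * z ^ n \<partial>circle_measure) =
      (\<integral>z. (\<Sum>i\<le>degree a. coeff a i * (f z * z ^ (i + n))) \<partial>circle_measure)"
    by (intro Bochner_Integration.integral_cong)
      (auto simp: poly_altdef sum_distrib_left sum_distrib_right power_add algebra_simps)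
  also have "\<dots> = (\<Sum>i\<le>degree a. coeff a i * (\<integral>z. f z * z ^ (i + n) \<partial>circle_measure))"
    by (subst Bochner_Integration.integral_sum)
      (auto intro!: ess_bounded_integrable ess_bounded_cmult ess_bounded_mult[OF hardy_ess_bounded[OF assms(1)]]
        ess_bounded_monomial)
  also have "\<dots> = 0" using assms by (simp add: hardy_integral)
  finally show ?thesis .
qed

text \<open>Orthogonality of the analytic and the antianalytic part: dropping the latter from a
  trigonometric polynomial does not increase its \<open>L\<^sup>2\<close>-distance to a function in \<open>H\<^sup>\<infinity>\<close>.\<close>

lemma hardy_poly_approx_L2:
  assumes g: "hardy g" and e: "0 < e"
  shows "\<exists>a. (\<integral>z. (norm (g z - poly a z))\<^sup>2 \<partial>circle_measure) < e"
proof -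
  obtain q n where q: "(\<integral>z. (norm (g z - poly q z * cnj z ^ n))\<^sup>2 \<partial>circle_measure) < e"
    using trig_polynomial_approx_L2[OF hardy_ess_bounded[OF g] e] by blast
  obtain a b where ab: "\<And>z. norm z = 1 \<Longrightarrow> poly q z * cnj z ^ n = poly a z + cnj (z * poly b z)"
    using trig_polynomial_split by blast
  define u where "u z = g z - poly a z" for z
  define v where "v z = z * poly b z" for z
  have "hardy (\<lambda>z. 1 * poly a z)"
    unfolding hardy_def using hardy_integral_poly[OF hardy_const[of 1]] ess_bounded_poly by simp
  then have u: "hardy u" unfolding u_def using hardy_add[OF g hardy_cmult[of "poly a" "-1"]] by simp
  have v: "ess_bounded v" unfolding v_def by (intro ess_bounded_continuous continuous_intros)
  have sq: "complex_of_real ((norm w)\<^sup>2) = w * cnj w" for w by (rule complex_norm_square)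
  have int: "integrable circle_measure (\<lambda>z. u z * cnj (u z))" "integrable circle_measure (\<lambda>z. v z * cnj (v z))"
    "integrable circle_measure (\<lambda>z. u z * v z)" "integrable circle_measure (\<lambda>z. cnj (u z) * cnj (v z))"
    by (intro ess_bounded_integrable ess_bounded_mult ess_bounded_cnj hardy_ess_bounded[OF u] v)+
  have "(\<integral>z. u z * v z \<partial>circle_measure) = 0"
    using hardy_integral_poly[OF u, of 1 b] by (simp add: v_def algebra_simps)
  then have uv: "(\<integral>z. cnj (u z) * cnj (v z) \<partial>circle_measure) = 0"
    using Bochner_Integration.integral_cnj[of circle_measure "\<lambda>z. u z * v z"] by simp
  have "complex_of_real (\<integral>z. (norm (g z - poly q z * cnj z ^ n))\<^sup>2 \<partial>circle_measure) =
      (\<integral>z. complex_of_real ((norm (g z - poly q z * cnj z ^ n))\<^sup>2) \<partial>circle_measure)"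
    by (rule integral_complex_of_real[symmetric])
  \<comment> \<open>On the circle the difference is u - cnj v; of its squared modulus only the mixed
    terms u * v and their conjugates have to vanish in mean.\<close>
  also have "\<dots> = (\<integral>z. u z * cnj (u z) + v z * cnj (v z) - u z * v z - cnj (u z) * cnj (v z) \<partial>circle_measure)"
  proof (intro Bochner_Integration.integral_cong refl)
    fix z assume "z \<in> space circle_measure"
    then have "norm z = 1" by (simp add: space_circle_measure)
    then show "complex_of_real ((norm (g z - poly q z * cnj z ^ n))\<^sup>2) =
        u z * cnj (u z) + v z * cnj (v z) - u z * v z - cnj (u z) * cnj (v z)"
      unfolding sq by (simp add: ab u_def v_def algebra_simps)
  qed
  also have "\<dots> = (\<integral>z. u z * cnj (u z) \<partial>circle_measure) + (\<integral>z. v z * cnj (v z) \<partial>circle_measure)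
      - (\<integral>z. u z * v z \<partial>circle_measure) - (\<integral>z. cnj (u z) * cnj (v z) \<partial>circle_measure)"
    by (simp add: Bochner_Integration.integral_diff Bochner_Integration.integral_add int
        Bochner_Integration.integrable_diff Bochner_Integration.integrable_add)
  also have "\<dots> = complex_of_real ((\<integral>z. (norm (u z))\<^sup>2 \<partial>circle_measure) + (\<integral>z. (norm (v z))\<^sup>2 \<partial>circle_measure))"
    using uv \<open>(\<integral>z. u z * v z \<partial>circle_measure) = 0\<close>
    by (simp add: sq[symmetric] del: of_real_power)
  finally have "(\<integral>z. (norm (g z - poly q z * cnj z ^ n))\<^sup>2 \<partial>circle_measure) =
      (\<integral>z. (norm (u z))\<^sup>2 \<partial>circle_measure) + (\<integral>z. (norm (v z))\<^sup>2 \<partial>circle_measure)"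
    by (simp only: of_real_eq_iff)
  moreover have "0 \<le> (\<integral>z. (norm (v z))\<^sup>2 \<partial>circle_measure)" by simp
  ultimately have "(\<integral>z. (norm (u z))\<^sup>2 \<partial>circle_measure) < e" using q by linarith
  then show ?thesis unfolding u_def by blast
qed

text \<open>With a polynomial in place of \<open>g\<close> the moment is 0, so only the L2 error of
  a polynomial approximation of \<open>g\<close> remains, against the bounded factor
  \<open>f\<close>.\<close>

lemma hardy_mult: assumes f: "hardy f" and g: "hardy g" shows "hardy (\<lambda>z. f z * g z)"
  unfolding hardy_def
proof (intro conjI allI impI)
  fix n :: nat assume n: "0 < n"
  note eb = hardy_ess_bounded[OF f] hardy_ess_bounded[OF g]
  from eb obtain K where K: "AE z in circle_measure. norm (f z) \<le> K" by (auto simp: ess_bounded_def)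
  let ?I = "\<integral>z. f z * g z * z ^ n \<partial>circle_measure"
  have "norm ?I \<le> \<bar>K\<bar> * e" if e: "0 < e" for e
  proof -
    obtain a where a: "(\<integral>z. (norm (g z - poly a z))\<^sup>2 \<partial>circle_measure) < e\<^sup>2"
      using hardy_poly_approx_L2[OF g, of "e\<^sup>2"] e by auto
    define u where "u z = g z - poly a z" for z
    have u: "ess_bounded u" unfolding u_def by (intro ess_bounded_diff eb ess_bounded_poly)
    have int: "integrable circle_measure (\<lambda>z. (norm (u z))\<^sup>2)"
      using integrable_norm[OF ess_bounded_integrable[OF ess_bounded_mult[OF u u]]]
      by (simp add: norm_mult power2_eq_square)
    have "?I = (\<integral>z. f z * u z * z ^ n + f z * poly a z * z ^ n \<partial>circle_measure)"
      by (intro Bochner_Integration.integral_cong) (auto simp: u_def algebra_simps)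
    also have "\<dots> = (\<integral>z. f z * u z * z ^ n \<partial>circle_measure) + (\<integral>z. f z * poly a z * z ^ n \<partial>circle_measure)"
      by (intro Bochner_Integration.integral_add ess_bounded_integrable ess_bounded_mult ess_bounded_monomial
          ess_bounded_poly eb u)
    also have "\<dots> = (\<integral>z. f z * u z * z ^ n \<partial>circle_measure)"
      using hardy_integral_poly[OF f n] by simp
    finally have "norm ?I \<le> (\<integral>z. norm (f z * u z * z ^ n) \<partial>circle_measure)"
      using integral_norm_bound[of circle_measure "\<lambda>z. f z * u z * z ^ n"] by simp
    \<comment> \<open>The inequality |u| <= (e + |u|^2 / e) / 2 plays the role of Cauchy-Schwarz: as
      |u|^2 integrates to less than e^2, the mean of |u| is at most e.\<close>
    also have "\<dots> \<le> (\<integral>z. \<bar>K\<bar> * ((e + (norm (u z))\<^sup>2 / e) / 2) \<partial>circle_measure)"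
    proof (rule integral_mono_AE)
      show "AE z in circle_measure. norm (f z * u z * z ^ n) \<le> \<bar>K\<bar> * ((e + (norm (u z))\<^sup>2 / e) / 2)"
        using K AE_circle_unit
      proof eventually_elim
        case (elim z)
        have "2 * (norm (u z) * e) \<le> e\<^sup>2 + (norm (u z))\<^sup>2"
          using sum_squares_bound[of "norm (u z)" e] by simp
        then have "norm (u z) \<le> (e + (norm (u z))\<^sup>2 / e) / 2"
          using e by (simp add: field_simps power2_eq_square)
        then have "norm (f z) * norm (u z) \<le> \<bar>K\<bar> * ((e + (norm (u z))\<^sup>2 / e) / 2)"
          using elim by (intro mult_mono) auto
        then show ?case using elim by (simp add: norm_mult norm_power)
      qed
      show "integrable circle_measure (\<lambda>z. norm (f z * u z * z ^ n))"
        by (intro integrable_norm ess_bounded_integrable ess_bounded_mult ess_bounded_monomial eb u)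
      show "integrable circle_measure (\<lambda>z. \<bar>K\<bar> * ((e + (norm (u z))\<^sup>2 / e) / 2))"
        by (intro integrable_mult_right Bochner_Integration.integrable_add integrable_divide int) simp
    qed
    also have "\<dots> = \<bar>K\<bar> * ((e + (\<integral>z. (norm (u z))\<^sup>2 \<partial>circle_measure) / e) / 2)"
      using int by (simp add: circle.prob_space)
    also have "\<dots> \<le> \<bar>K\<bar> * ((e + e\<^sup>2 / e) / 2)"
      using a e by (intro mult_left_mono divide_right_mono add_left_mono) (auto simp: u_def)
    also have "\<dots> = \<bar>K\<bar> * e" using e by (simp add: power2_eq_square)
    finally show ?thesis .
  qed
  then have "norm ?I \<le> \<bar>K\<bar> * 0"
    by (intro tendsto_lowerbound[of "\<lambda>e. \<bar>K\<bar> * e" _ "at_right 0"])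
      (auto intro!: tendsto_eq_intros eventually_at_right_less[THEN eventually_mono])
  then show "?I = 0" by simp
qed (intro ess_bounded_mult hardy_ess_bounded assms)

text \<open>Dominated convergence of each moment. All infinite constructions in H^inf, the Neumann
  series as well as the series over scales, pass through this closure property.\<close>

lemma hardy_limit:
  assumes f: "\<And>n. hardy (f n)" and g: "g \<in> borel_measurable circle_measure"
    and lim: "AE z in circle_measure. (\<lambda>n. f n z) \<longlonglongrightarrow> g z"
    and B: "AE z in circle_measure. \<forall>n. norm (f n z) \<le> B"
  shows "hardy g"
proof -
  have "AE z in circle_measure. norm (g z) \<le> B"
    using lim B by eventually_elim (blast intro: Lim_bounded tendsto_norm)
  with g have gb: "ess_bounded g" by (rule ess_boundedI)
  have "(\<integral>z. g z * z ^ n \<partial>circle_measure) = 0" if n: "0 < n" for n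
  proof -
    have "(\<lambda>k. \<integral>z. f k z * z ^ n \<partial>circle_measure) \<longlonglongrightarrow> (\<integral>z. g z * z ^ n \<partial>circle_measure)"
    proof (rule integral_dominated_convergence[where w = "\<lambda>_. B"])
      show "AE z in circle_measure. (\<lambda>k. f k z * z ^ n) \<longlonglongrightarrow> g z * z ^ n"
        using lim by eventually_elim (intro tendsto_intros)
      show "AE z in circle_measure. norm (f k z * z ^ n) \<le> B" for k
        using B AE_circle_unit by eventually_elim (simp add: norm_mult norm_power)
    qed (auto intro!: ess_bounded_measurable ess_bounded_mult ess_bounded_monomial gb hardy_ess_bounded[OF f])
    moreover have "(\<integral>z. f k z * z ^ n \<partial>circle_measure) = 0" for k using f n by (rule hardy_integral)
    ultimately show ?thesis by (simp add: LIMSEQ_const_iff)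
  qed
  with gb show ?thesis by (simp add: hardy_def)
qed

lemma hardy_power: "hardy f \<Longrightarrow> hardy (\<lambda>z. f z ^ n)"
  by (induction n) (auto intro: hardy_const hardy_mult)

lemma hardy_neumann:
  assumes h: "hardy h" and q: "AE z in circle_measure. norm (h z) \<le> q" "q < 1"
  shows "hardy (\<lambda>z. 1 / (1 - h z))"
proof (rule hardy_limit[where f = "\<lambda>n z. \<Sum>i<n. h z ^ i" and B = "1 / (1 - q)"])
  note [measurable] = ess_bounded_measurable[OF hardy_ess_bounded[OF h]]
  show "(\<lambda>z. 1 / (1 - h z)) \<in> borel_measurable circle_measure" by measurable
  show "AE z in circle_measure. (\<lambda>n. \<Sum>i<n. h z ^ i) \<longlonglongrightarrow> 1 / (1 - h z)"
    using q(1)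
  proof eventually_elim
    case (elim z)
    with q(2) have "(\<lambda>i. h z ^ i) sums (1 / (1 - h z))" by (intro geometric_sums) simp
    then show ?case by (simp add: sums_def)
  qed
  show "AE z in circle_measure. \<forall>n. norm (\<Sum>i<n. h z ^ i) \<le> 1 / (1 - q)"
    using q(1)
  proof eventually_elim
    case (elim z)
    have q0: "0 \<le> q" using elim norm_ge_zero order_trans by blast
    show ?case
    proof
      fix n
      have "norm (\<Sum>i<n. h z ^ i) \<le> (\<Sum>i<n. q ^ i)"
        using elim by (intro sum_norm_le) (auto simp: norm_power intro: power_mono)
      also have "\<dots> \<le> (\<Sum>i. q ^ i)"
        using q0 q(2) by (intro sum_le_suminf) (auto intro: summable_geometric)
      also have "\<dots> = 1 / (1 - q)" using q0 q(2) by (intro suminf_geometric) simp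
      finally show "norm (\<Sum>i<n. h z ^ i) \<le> 1 / (1 - q)" .
    qed
  qed
qed (intro hardy_sum hardy_power h)

section \<open>Characters of the algebras of boundary functions\<close>

abbreviation cls :: "(complex \<Rightarrow> complex) \<Rightarrow> linfty" where
  "cls \<equiv> abs_linfty"

lemma ess_eq_refl: "ess_bounded f \<Longrightarrow> ess_eq f f"
  by (simp add: ess_eq_def)

lemma cls_eq_iff:
  assumes "ess_bounded f" "ess_bounded g"
  shows "cls f = cls g \<longleftrightarrow> (AE z in circle_measure. f z = g z)"
proof -
  have "cls f = cls g \<longleftrightarrow> ess_eq f g"
    using Quotient3_rel[OF Quotient3_linfty, of f g] ess_eq_refl[OF assms(1)] ess_eq_refl[OF assms(2)]
    by blast
  then show ?thesis using assms by (simp add: ess_eq_def)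
qed

lemma cls_cases: obtains f where "ess_bounded f" "x = cls f"
proof -
  have "ess_eq (rep_linfty x) (rep_linfty x)" "cls (rep_linfty x) = x"
    by (rule Quotient3_rep_reflp[OF Quotient3_linfty], rule Quotient3_abs_rep[OF Quotient3_linfty])
  then show ?thesis using that[of "rep_linfty x"] by (simp add: ess_eq_def)
qed

lemma cls_add: "ess_bounded f \<Longrightarrow> ess_bounded g \<Longrightarrow> cls f + cls g = cls (\<lambda>z. f z + g z)"
  by (rule plus_linfty.abs_eq) (rule ess_eq_refl, assumption)+

lemma cls_diff: "ess_bounded f \<Longrightarrow> ess_bounded g \<Longrightarrow> cls f - cls g = cls (\<lambda>z. f z - g z)"
  by (rule minus_linfty.abs_eq) (rule ess_eq_refl, assumption)+

lemma cls_mult: "ess_bounded f \<Longrightarrow> ess_bounded g \<Longrightarrow> cls f * cls g = cls (\<lambda>z. f z * g z)"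
  by (rule times_linfty.abs_eq) (rule ess_eq_refl, assumption)+

lemma cls_scaleC: "ess_bounded f \<Longrightarrow> c *\<^sub>C cls f = cls (\<lambda>z. c * f z)"
  by (rule scaleC_linfty.abs_eq) (rule ess_eq_refl)

lemma cls_one: "1 = cls (\<lambda>_. 1)" and cls_zero: "0 = cls (\<lambda>_. 0)"
  by (simp_all add: one_linfty_def zero_linfty_def)

lemma cls_scalar: "scalar c = cls (\<lambda>_. c)"
  unfolding cls_one by (subst cls_scaleC) (simp_all add: ess_bounded_const)

text \<open>The moment against \<open>z ^ n\<close> in \<open>hardy\<close> is the Fourier
  coefficient at index \<open>- n\<close>.\<close>

lemma cls_in_hinfty: assumes "ess_bounded f" shows "cls f \<in> hinfty \<longleftrightarrow> hardy f"
proof -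
  have fc: "fourier_coeff (cls f) n = (\<integral>z. f z * z powi (- n) \<partial>circle_measure)" for n
    using fourier_coeff.abs_eq[OF ess_eq_refl[OF assms]] by simp
  show ?thesis
  proof
    assume *: "cls f \<in> hinfty"
    show "hardy f" unfolding hardy_def
    proof (intro conjI allI impI assms)
      fix n :: nat assume "0 < n"
      with * have "fourier_coeff (cls f) (- int n) = 0" by (simp add: hinfty_def)
      then show "(\<integral>z. f z * z ^ n \<partial>circle_measure) = 0" unfolding fc by simp
    qed
  next
    assume f: "hardy f"
    have "fourier_coeff (cls f) n = 0" if "n < 0" for n
      unfolding fc using hardy_integral[OF f, of "nat (- n)"] that by (simp add: power_int_def)
    then show "cls f \<in> hinfty" by (simp add: hinfty_def)
  qed
qed

lemma hinfty_cases: assumes "x \<in> hinfty" obtains f where "hardy f" "x = cls f"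
  using cls_cases[of x] cls_in_hinfty assms by metis

lemma hardy_cls: "hardy f \<Longrightarrow> cls f \<in> hinfty"
  by (simp add: cls_in_hinfty hardy_ess_bounded)

lemma cont_circle_iff: "x \<in> cont_circle \<longleftrightarrow> (\<exists>c. continuous_on (sphere 0 1) c \<and> x = cls c)"
proof -
  obtain f where f: "ess_bounded f" "x = cls f" by (rule cls_cases)
  have "has_continuous_rep (cls f) \<longleftrightarrow> (\<exists>c. continuous_on (sphere 0 1) c \<and> (AE z in circle_measure. f z = c z))"
    by (rule has_continuous_rep.abs_eq[OF ess_eq_refl[OF f(1)]])
  then show ?thesis
    unfolding cont_circle_def f(2) using cls_eq_iff[OF f(1) ess_bounded_continuous] by auto
qed

lift_definition bounded_by :: "linfty \<Rightarrow> real \<Rightarrow> bool"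
  is "\<lambda>f B. AE z in circle_measure. norm (f z) \<le> B"
  by (auto simp: ess_eq_def fun_eq_iff elim: eventually_elim2)

lemma cls_bounded_by: "ess_bounded f \<Longrightarrow> bounded_by (cls f) B \<longleftrightarrow> (AE z in circle_measure. norm (f z) \<le> B)"
  by (simp add: bounded_by.abs_eq ess_eq_refl)

lemma bounded_by_nonneg: assumes "bounded_by x B" shows "0 \<le> B"
proof -
  obtain f where f: "ess_bounded f" "x = cls f" by (rule cls_cases)
  with assms have "AE z in circle_measure. norm (f z) \<le> B" by (simp add: cls_bounded_by)
  then have "AE z in circle_measure. 0 \<le> B"
    by eventually_elim (rule order_trans[OF norm_ge_zero])
  then show ?thesis by simp
qed

interpretation H: bounded_algebra hinfty bounded_by
proof
  show "1 \<in> hinfty" unfolding cls_one by (intro hardy_cls hardy_const)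
  show "x + y \<in> hinfty" if "x \<in> hinfty" "y \<in> hinfty" for x y
    using that by (elim hinfty_cases) (auto simp: cls_add hardy_ess_bounded intro!: hardy_cls hardy_add)
  show "x * y \<in> hinfty" if "x \<in> hinfty" "y \<in> hinfty" for x y
    using that by (elim hinfty_cases) (auto simp: cls_mult hardy_ess_bounded intro!: hardy_cls hardy_mult)
  show "c *\<^sub>C x \<in> hinfty" if "x \<in> hinfty" for c x
    using that by (elim hinfty_cases) (auto simp: cls_scaleC hardy_ess_bounded intro!: hardy_cls hardy_cmult)
  show "bounded_by x B \<Longrightarrow> 0 \<le> B" for x B by (rule bounded_by_nonneg)
  show "\<exists>B. bounded_by x B" for x
    by (rule cls_cases[of x]) (auto simp: cls_bounded_by, auto simp: ess_bounded_def)
  fix x y B C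
  obtain f where f: "ess_bounded f" "x = cls f" by (rule cls_cases)
  obtain g where g: "ess_bounded g" "y = cls g" by (rule cls_cases)
  show "bounded_by (x + y) (B + C)" if "bounded_by x B" "bounded_by y C"
  proof -
    from that f g have "AE z in circle_measure. norm (f z) \<le> B" "AE z in circle_measure. norm (g z) \<le> C"
      by (simp_all add: cls_bounded_by)
    then have "AE z in circle_measure. norm (f z + g z) \<le> B + C"
      by eventually_elim (rule norm_triangle_mono)
    then show ?thesis using f g by (simp add: cls_add cls_bounded_by ess_bounded_add)
  qed
  show "bounded_by (x * y) (B * C)" if "bounded_by x B" "bounded_by y C"
  proof -
    from that f g have "AE z in circle_measure. norm (f z) \<le> B" "AE z in circle_measure. norm (g z) \<le> C"
      by (simp_all add: cls_bounded_by)
    then have "AE z in circle_measure. norm (f z * g z) \<le> B * C"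
      by eventually_elim
        (auto simp: norm_mult intro!: mult_mono intro: bounded_by_nonneg[OF that(1)])
    then show ?thesis using f g by (simp add: cls_mult cls_bounded_by ess_bounded_mult)
  qed
  show "bounded_by (c *\<^sub>C x) (norm c * B)" if "bounded_by x B" for c
  proof -
    from that f have "AE z in circle_measure. norm (f z) \<le> B" by (simp add: cls_bounded_by)
    then have "AE z in circle_measure. norm (c * f z) \<le> norm c * B"
      by eventually_elim (auto simp: norm_mult intro: mult_left_mono)
    then show ?thesis using f by (simp add: cls_scaleC cls_bounded_by ess_bounded_cmult)
  qed
  show "bounded_by 1 1" unfolding cls_one by (simp add: cls_bounded_by ess_bounded_const)
next
  fix x B assume x: "x \<in> hinfty" "bounded_by x B" "B < 1"
  from x(1) obtain h where h: "hardy h" "x = cls h" by (rule hinfty_cases)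
  then have B: "AE z in circle_measure. norm (h z) \<le> B" using x(2) by (simp add: cls_bounded_by hardy_ess_bounded)
  have k: "hardy (\<lambda>z. 1 / (1 - h z))" by (rule hardy_neumann[OF h(1) B x(3)])
  have "(1 - x) * cls (\<lambda>z. 1 / (1 - h z)) = cls (\<lambda>z. (1 - h z) * (1 / (1 - h z)))"
    unfolding h(2) cls_one using h(1) k
    by (simp add: cls_diff cls_mult hardy_ess_bounded ess_bounded_const ess_bounded_diff)
  also have "\<dots> = 1"
    unfolding cls_one
  proof (subst cls_eq_iff)
    show "AE z in circle_measure. (1 - h z) * (1 / (1 - h z)) = 1"
      using B by eventually_elim (use x(3) in auto)
  qed (intro ess_bounded_mult ess_bounded_diff ess_bounded_const hardy_ess_bounded h k)+
  finally show "\<exists>y\<in>hinfty. (1 - x) * y = 1" using hardy_cls[OF k] by blast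
qed

section \<open>Homomorphisms of H^inf and their localisation at a boundary point\<close>

abbreviation coordinate :: linfty where
  "coordinate \<equiv> cls (\<lambda>z. z)"

lemma H_hom_simps:
  assumes "H.hom h"
  shows "h 1 = 1" "x \<in> hinfty \<Longrightarrow> y \<in> hinfty \<Longrightarrow> h (x + y) = h x + h y"
    "x \<in> hinfty \<Longrightarrow> y \<in> hinfty \<Longrightarrow> h (x * y) = h x * h y"
    "x \<in> hinfty \<Longrightarrow> h (c *\<^sub>C x) = c * h x"
  using assms by (auto simp: H.hom_def)

lemma H_hom_scalar: "H.hom h \<Longrightarrow> h (scalar c) = c"
  using H_hom_simps(1)[of h] H_hom_simps(4)[of h 1 c] by simp

lemma H_hom_diff: assumes "H.hom h" "x \<in> hinfty" "y \<in> hinfty" shows "h (x - y) = h x - h y"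
  using H_hom_simps(2)[OF assms(1), of "x - y" y] H.diff_closed[OF assms(2,3)] assms by simp

lemma H_hom_power: "H.hom h \<Longrightarrow> x \<in> hinfty \<Longrightarrow> h (x ^ n) = h x ^ n"
  by (induction n) (auto simp: H_hom_simps H.power_closed)

lemma H_hom_sum: assumes "H.hom h" "\<And>i. i \<in> S \<Longrightarrow> x i \<in> hinfty" shows "h (\<Sum>i\<in>S. x i) = (\<Sum>i\<in>S. h (x i))"
proof -
  have "h 0 = 0" using H_hom_scalar[OF assms(1), of 0] by (simp add: scalar_0)
  then show ?thesis using assms(2)
    by (induction S rule: infinite_finite_induct) (auto simp: H_hom_simps[OF assms(1)] H.sum_closed)
qed

text \<open>If |h x| exceeded B, then y = x / h x would have norm below 1, so 1 - y would be
  invertible although \<open>h\<close> maps it to 0.\<close>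

lemma H_hom_contractive:
  assumes h: "H.hom h" and x: "x \<in> hinfty" "bounded_by x B"
  shows "norm (h x) \<le> B"
proof (rule ccontr)
  assume neg: "\<not> norm (h x) \<le> B"
  have B: "0 \<le> B" using x(2) by (rule bounded_by_nonneg)
  define y where "y = (1 / h x) *\<^sub>C x"
  have "bounded_by y (norm (1 / h x) * B)" unfolding y_def by (rule H.bd_scaleC[OF x(2)])
  moreover have "norm (1 / h x) * B < 1" using neg B by (simp add: norm_divide divide_less_eq)
  moreover have y: "y \<in> hinfty" unfolding y_def by (rule H.scaleC_closed[OF x(1)])
  ultimately obtain u where u: "u \<in> hinfty" "(1 - y) * u = 1" using H.neumann by blast
  have "h x \<noteq> 0" using neg B by auto
  then have "h y = 1" unfolding y_def using H_hom_simps(4)[OF h x(1)] by simp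
  then have "h ((1 - y) * u) = 0"
    using y u(1) H.diff_closed[OF H.one_closed y]
    by (simp add: H_hom_simps[OF h] H_hom_diff[OF h])
  then show False using u(2) H_hom_simps(1)[OF h] by simp
qed

text \<open>The powers of the peak function \<open>(1 + cnj l * z) / 2\<close> localise at \<open>l\<close> without leaving \<open>H\<^sup>\<infinity>\<close>.\<close>

lemma H_hom_local_bound:
  assumes h: "H.hom h" "h coordinate = l" "norm l = 1"
    and f: "hardy f" and r: "0 < r" and M: "0 \<le> M"
    and bound: "AE z in circle_measure. norm (z - l) < r \<longrightarrow> norm (f z) \<le> M"
  shows "norm (h (cls f)) \<le> M"
proof -
  define u where "u z = 1/2 + (cnj l / 2) * z" for z
  have u: "hardy u" unfolding u_def by (intro hardy_add hardy_const hardy_cmult hardy_id)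
  have "cls u = scalar (1/2) + (cnj l / 2) *\<^sub>C coordinate"
    unfolding u_def cls_scalar
    by (simp only: cls_scaleC cls_add hardy_ess_bounded[OF hardy_id] ess_bounded_const ess_bounded_cmult)
  then have hu: "h (cls u) = 1"
    using h unit_mult_cnj[OF h(3)]
    by (simp add: H_hom_simps H_hom_scalar H.scaleC_closed hardy_cls hardy_id mult.commute)
  from f obtain K where K: "AE z in circle_measure. norm (f z) \<le> K" by (auto simp: hardy_def ess_bounded_def)
  \<comment> \<open>The parallelogram law for z and l: \<open>u\<close> has modulus 1 at l and falls
    off with the distance from it.\<close>
  have u2: "(norm (u z))\<^sup>2 = 1 - (norm (z - l))\<^sup>2 / 4" if "norm z = 1" for z
  proof -
    have "4 * (norm (u z))\<^sup>2 = (norm (1 + cnj l * z))\<^sup>2"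
    proof -
      have "1 + cnj l * z = 2 * u z" by (simp add: u_def)
      then show ?thesis by (simp add: norm_mult power_mult_distrib)
    qed
    also have "1 + cnj l * z = cnj l * (l + z)" using unit_mult_cnj[OF h(3)] by (simp add: algebra_simps)
    also have "norm (cnj l * (l + z)) = norm (z + l)" using h(3) by (simp add: norm_mult add.commute)
    also have "(norm (z + l))\<^sup>2 + (norm (z - l))\<^sup>2 = 2 * (norm z)\<^sup>2 + 2 * (norm l)\<^sup>2"
      unfolding cmod_power2 by (simp add: power2_eq_square algebra_simps)
    then have "(norm (z + l))\<^sup>2 = 4 - (norm (z - l))\<^sup>2" using that h(3) by simp
    finally show ?thesis by simp
  qed
  define r' where "r' = min r 1"
  have r': "0 < r'" "r' \<le> r" "r' \<le> 1" using r by (auto simp: r'_def)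
  define q where "q = sqrt (1 - r'\<^sup>2 / 4)"
  have "r'\<^sup>2 \<le> 1" using r' by (simp add: power_le_one)
  then have q: "0 \<le> q" "q < 1" using r' by (auto simp: q_def)
  \<comment> \<open>As \<open>h\<close> maps \<open>u\<close> to 1, multiplying \<open>f\<close> by
    \<open>u ^ n\<close> leaves its value unchanged, while outside the disc of radius
    \<open>r\<close> the product is at most |K| * q^n.\<close>
  have bd: "norm (h (cls f)) \<le> M + \<bar>K\<bar> * q ^ n" for n
  proof -
    have "AE z in circle_measure. norm (f z * u z ^ n) \<le> M + \<bar>K\<bar> * q ^ n"
      using bound K AE_circle_unit
    proof eventually_elim
      case (elim z)
      have nn: "0 \<le> \<bar>K\<bar> * q ^ n" using q by simp
      show ?case
      proof (cases "norm (z - l) < r")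
        case True
        have "(norm (u z))\<^sup>2 \<le> 1" using u2[OF elim(3)] by simp
        then have "norm (u z) ^ n \<le> 1" by (intro power_le_one) (auto simp: power_le_one_iff abs_square_le_1)
        then have "norm (f z) * norm (u z) ^ n \<le> M * 1" using elim(1) True M by (intro mult_mono) auto
        with nn show ?thesis by (simp add: norm_mult norm_power)
      next
        case False
        then have "r'\<^sup>2 \<le> (norm (z - l))\<^sup>2" using r' by (intro power_mono) auto
        then have "norm (u z) \<le> q"
          unfolding q_def using u2[OF elim(3)] by (intro real_le_rsqrt) simp
        then have "norm (f z) * norm (u z) ^ n \<le> \<bar>K\<bar> * q ^ n" using elim(2) by (intro mult_mono power_mono) auto
        with M show ?thesis by (simp add: norm_mult norm_power)
      qed
    qed
    moreover have fu: "hardy (\<lambda>z. f z * u z ^ n)" by (intro hardy_mult hardy_power f u)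
    ultimately have "norm (h (cls (\<lambda>z. f z * u z ^ n))) \<le> M + \<bar>K\<bar> * q ^ n"
      by (intro H_hom_contractive[OF h(1)] hardy_cls) (simp_all add: cls_bounded_by hardy_ess_bounded)
    also have "cls (\<lambda>z. f z * u z ^ n) = cls f * cls u ^ n"
    proof (induction n)
      case (Suc n)
      have "cls f * cls u ^ Suc n = cls (\<lambda>z. f z * u z ^ n) * cls u"
        unfolding Suc by (simp add: algebra_simps)
      also have "\<dots> = cls (\<lambda>z. f z * u z ^ Suc n)"
        using hardy_ess_bounded[OF u] hardy_ess_bounded[OF hardy_mult[OF f hardy_power[OF u]]]
        by (simp add: cls_mult algebra_simps)
      finally show ?case by simp
    qed simp
    also have "h (cls f * cls u ^ n) = h (cls f)"
      using h(1) hu f u by (simp add: H_hom_simps(3) H_hom_power hardy_cls H.power_closed)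
    finally show ?thesis .
  qed
  have "(\<lambda>n. M + \<bar>K\<bar> * q ^ n) \<longlonglongrightarrow> M + \<bar>K\<bar> * 0"
    using q by (intro tendsto_intros LIMSEQ_realpow_zero)
  then have "(\<lambda>n. M + \<bar>K\<bar> * q ^ n) \<longlonglongrightarrow> M" by simp
  then show ?thesis by (rule tendsto_lowerbound) (simp_all add: bd)
qed

text \<open>The local bound applied to f - w. It is how the fibre over \<open>l\<close> is made to
  see continuous functions as constants.\<close>

lemma H_hom_ess_limit:
  assumes h: "H.hom h" "h coordinate = l" "norm l = 1" and f: "hardy f"
    and lim: "\<And>e. 0 < e \<Longrightarrow> \<exists>r>0. AE z in circle_measure. norm (z - l) < r \<longrightarrow> norm (f z - w) \<le> e"
  shows "h (cls f) = w"
proof -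
  have fw: "hardy (\<lambda>z. f z + - w)" by (intro hardy_add f hardy_const)
  have "norm (h (cls (\<lambda>z. f z + - w))) \<le> 0 + e" if e: "0 < e" for e
  proof -
    obtain r where "0 < r" "AE z in circle_measure. norm (z - l) < r \<longrightarrow> norm (f z - w) \<le> e"
      using lim[OF e] by blast
    then show ?thesis using H_hom_local_bound[OF h fw, of r e] e by simp
  qed
  then have "norm (h (cls (\<lambda>z. f z + - w))) \<le> 0" by (rule field_le_epsilon)
  moreover have "cls (\<lambda>z. f z + - w) = cls f - scalar w"
    using f by (simp add: cls_scalar cls_diff hardy_ess_bounded ess_bounded_const)
  ultimately show ?thesis
    using h(1) f by (simp add: H_hom_diff H_hom_scalar hardy_cls)
qed

section \<open>Characters of H^inf + C\<close>

abbreviation (input) "HC \<equiv> hinfty_plus_C"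

lemma HC_cases:
  assumes "x \<in> HC" obtains f c where "hardy f" "continuous_on (sphere 0 1) c" "x = cls f + cls c"
  using assms unfolding hinfty_plus_C_def cont_circle_iff mem_Collect_eq by (metis hinfty_cases)

lemma HC_I: "hardy f \<Longrightarrow> continuous_on (sphere 0 1) c \<Longrightarrow> cls f + cls c \<in> HC"
  unfolding hinfty_plus_C_def cont_circle_iff mem_Collect_eq by (blast intro: hardy_cls)

lemma continuous_in_HC: "continuous_on (sphere 0 1) c \<Longrightarrow> cls c \<in> HC"
  using HC_I[OF hardy_const[of 0], of c] by (simp flip: cls_zero)

lemma hinfty_in_HC: "x \<in> hinfty \<Longrightarrow> x \<in> HC"
  using HC_I[OF _ continuous_on_const[of _ 0]] by (elim hinfty_cases) (simp flip: cls_zero)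

lemma HC_add: assumes "x \<in> HC" "y \<in> HC" shows "x + y \<in> HC"
proof -
  obtain f c where x: "hardy f" "continuous_on (sphere 0 1) c" "x = cls f + cls c"
    using assms(1) by (rule HC_cases)
  obtain g d where y: "hardy g" "continuous_on (sphere 0 1) d" "y = cls g + cls d"
    using assms(2) by (rule HC_cases)
  have "x + y = (cls f + cls g) + (cls c + cls d)" by (simp add: x y algebra_simps)
  also have "\<dots> = cls (\<lambda>z. f z + g z) + cls (\<lambda>z. c z + d z)"
    using x y by (simp add: cls_add hardy_ess_bounded ess_bounded_continuous)
  also have "\<dots> \<in> HC" using x y by (intro HC_I hardy_add continuous_intros)
  finally show ?thesis .
qed

lemma HC_scaleC: assumes "x \<in> HC" shows "s *\<^sub>C x \<in> HC"
proof -
  obtain f c where x: "hardy f" "continuous_on (sphere 0 1) c" "x = cls f + cls c"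
    using assms by (rule HC_cases)
  have "s *\<^sub>C x = cls (\<lambda>z. s * f z) + cls (\<lambda>z. s * c z)"
    using x by (simp add: scaleC_add_right cls_scaleC hardy_ess_bounded ess_bounded_continuous)
  also have "\<dots> \<in> HC" using x by (intro HC_I hardy_cmult continuous_intros)
  finally show ?thesis .
qed

lemma HC_scalar: "scalar s \<in> HC"
  using hinfty_in_HC[OF H.scalar_closed] .

lemma HC_diff: assumes "x \<in> HC" "y \<in> HC" shows "x - y \<in> HC"
proof -
  have "x - y = x + (-1) *\<^sub>C y" by (subst scaleC_conv_mult) (simp add: scalar_minus scalar_1)
  also have "\<dots> \<in> HC" using assms by (intro HC_add HC_scaleC)
  finally show ?thesis .
qed

lemma characterD:
  assumes "\<phi> \<in> character_space A"
  shows "x \<in> A \<Longrightarrow> y \<in> A \<Longrightarrow> \<phi> (x + y) = \<phi> x + \<phi> y" "x \<in> A \<Longrightarrow> \<phi> (s *\<^sub>C x) = s * \<phi> x"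
    "x \<in> A \<Longrightarrow> y \<in> A \<Longrightarrow> \<phi> (x * y) = \<phi> x * \<phi> y" "x \<notin> A \<Longrightarrow> \<phi> x = undefined"
  using assms by (auto simp: character_space_def extensional_def)

lemma character_one:
  assumes "\<phi> \<in> character_space A" "1 \<in> A" shows "\<phi> 1 = 1"
proof -
  obtain f where "f \<in> A" "\<phi> f \<noteq> 0" using assms(1) by (auto simp: character_space_def)
  with characterD(3)[OF assms(1) \<open>f \<in> A\<close> assms(2)] show ?thesis by simp
qed

text \<open>A character of \<open>H\<^sup>\<infinity> + C\<close> in the sense of the definition forces \<open>H\<^sup>\<infinity> + C\<close> to be closed under
  products, because the value at an element outside is the fixed number \<open>undefined\<close>. Hence Sarason's
  theorem is not needed.\<close>

lemma HC_mult:
  assumes phi: "\<phi> \<in> character_space HC" and f: "f \<in> HC" and g: "g \<in> HC"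
  shows "f * g \<in> HC"
proof (rule ccontr)
  assume neg: "f * g \<notin> HC"
  have "(\<phi> f + s) * (\<phi> g + t) = undefined" for s t
  proof -
    let ?r = "t *\<^sub>C f + s *\<^sub>C g + scalar (s * t)"
    have split: "(f + scalar s) * (g + scalar t) = f * g + ?r"
      by (simp add: scaleC_conv_mult[of _ f] scaleC_conv_mult[of _ g] scalar_mult algebra_simps)
    have "f * g = (f * g + ?r) - ?r" by simp
    moreover have "?r \<in> HC" using f g by (intro HC_add HC_scaleC HC_scalar)
    ultimately have "f * g + ?r \<notin> HC" using neg HC_diff by metis
    then have "\<phi> ((f + scalar s) * (g + scalar t)) = undefined"
      unfolding split by (rule characterD(4)[OF phi])
    moreover have "\<phi> (scalar c) = c" for c
      using characterD(2)[OF phi hinfty_in_HC[OF H.one_closed], of c]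
        character_one[OF phi hinfty_in_HC[OF H.one_closed]] by simp
    ultimately show ?thesis
      using f g by (simp add: characterD(1,3)[OF phi] HC_add HC_scalar)
  qed
  from this[of "- \<phi> f" 0] this[of "1 - \<phi> f" "1 - \<phi> g"] show False by simp
qed

lemma character_hom: assumes "\<phi> \<in> character_space HC" shows "H.hom \<phi>"
  unfolding H.hom_def
  by (simp add: characterD[OF assms] character_one[OF assms] hinfty_in_HC)

text \<open>The character kills F = |c - w|^2 + |z - l|^2, which is continuous. Without a zero on
  the circle \<open>F\<close> would be invertible in C; at a zero, z = l and c z = w hold at
  once.\<close>

lemma character_continuous:
  assumes phi: "\<phi> \<in> character_space HC" and c: "continuous_on (sphere 0 1) c"
  shows "\<phi> (cls c) = c (\<phi> coordinate)" and "norm (\<phi> coordinate) = 1"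
proof -
  define l where "l = \<phi> coordinate"
  define w where "w = \<phi> (cls c)"
  define F where "F z = (c z - w) * cnj (c z - w) + (z - l) * cnj (z - l)" for z
  have cw: "continuous_on (sphere 0 1) (\<lambda>z. c z - w)" "continuous_on (sphere 0 1) (\<lambda>z. cnj (c z - w))"
    "continuous_on (sphere 0 1) (\<lambda>z. z - l)" "continuous_on (sphere 0 1) (\<lambda>z. cnj (z - l))"
    by (intro continuous_intros c)+
  have F: "continuous_on (sphere 0 1) F" unfolding F_def by (intro continuous_intros c)
  note eb = cw[THEN ess_bounded_continuous] and HC = cw[THEN continuous_in_HC]
  have zero: "\<phi> (cls (\<lambda>z. d z - v)) = 0" if "continuous_on (sphere 0 1) d" "v = \<phi> (cls d)" for d v
  proof -
    have "cls (\<lambda>z. d z - v) = cls d + (-v) *\<^sub>C 1"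
      using that by (simp add: cls_add cls_one cls_scaleC ess_bounded_const ess_bounded_continuous)
    then show ?thesis
      using characterD(1,2)[OF phi] character_one[OF phi] that continuous_in_HC hinfty_in_HC[OF H.one_closed] HC_scalar
      by simp
  qed
  have "cls F = cls (\<lambda>z. c z - w) * cls (\<lambda>z. cnj (c z - w)) + cls (\<lambda>z. z - l) * cls (\<lambda>z. cnj (z - l))"
    unfolding F_def using eb by (simp only: cls_mult cls_add ess_bounded_mult)
  then have "\<phi> (cls F) = 0"
    using zero[OF c w_def] zero[OF continuous_on_id l_def] HC
    by (simp add: characterD(1,3)[OF phi] HC_mult[OF phi])
  have "\<exists>z. norm z = 1 \<and> F z = 0"
  proof (rule ccontr)
    assume "\<not> ?thesis"
    then have nz: "\<And>z. norm z = 1 \<Longrightarrow> F z \<noteq> 0" by blast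
    then have G: "continuous_on (sphere 0 1) (\<lambda>z. 1 / F z)"
      by (intro continuous_intros F) auto
    have "cls F * cls (\<lambda>z. 1 / F z) = cls (\<lambda>z. F z * (1 / F z))"
      using F G by (intro cls_mult ess_bounded_continuous)
    also have "\<dots> = 1"
      unfolding cls_one
    proof (subst cls_eq_iff)
      show "AE z in circle_measure. F z * (1 / F z) = 1" using nz by (intro AE_circleI) simp
    qed (intro ess_bounded_mult ess_bounded_const ess_bounded_continuous F G)+
    finally have "\<phi> (cls F) * \<phi> (cls (\<lambda>z. 1 / F z)) = \<phi> 1"
      using F G by (simp add: characterD(3)[OF phi, symmetric] continuous_in_HC)
    with \<open>\<phi> (cls F) = 0\<close> show False
      using character_one[OF phi hinfty_in_HC[OF H.one_closed]] by simp
  qed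
  then obtain z where z: "norm z = 1" "F z = 0" by blast
  then have "complex_of_real ((norm (c z - w))\<^sup>2 + (norm (z - l))\<^sup>2) = 0"
    unfolding F_def of_real_add complex_norm_square by simp
  then have "(norm (c z - w))\<^sup>2 + (norm (z - l))\<^sup>2 = 0" by (simp only: of_real_eq_0_iff)
  then have "norm (c z - w) = 0 \<and> norm (z - l) = 0" by (simp only: sum_power2_eq_zero_iff)
  then have "c z = w" "z = l" unfolding norm_eq_zero right_minus_eq by blast+
  with z show "\<phi> (cls c) = c (\<phi> coordinate)" "norm (\<phi> coordinate) = 1" by (auto simp: w_def l_def)
qed

text \<open>Near \<open>l\<close> a continuous summand is almost its value at \<open>l\<close>, so
  \<open>H_hom_ess_limit\<close> yields both independence of the decomposition and multiplicativity.
  The given character \<open>\<phi>\<close> supplies closure under products through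
  \<open>HC_mult\<close>.\<close>

lemma hom_extension:
  assumes phi: "\<phi> \<in> character_space HC"
    and h: "H.hom h" "h coordinate = l" "norm l = 1"
  shows "\<exists>\<psi>\<in>character_space HC. \<forall>f c. hardy f \<longrightarrow> continuous_on (sphere 0 1) c \<longrightarrow>
    \<psi> (cls f + cls c) = h (cls f) + c l"
proof -
  \<comment> \<open>A decomposition f + c is not unique, as H^inf and C intersect, hence the choice;
    the value off \<open>HC\<close> makes the function extensional.\<close>
  define \<psi> where "\<psi> x = (if x \<in> HC then
      (SOME v. \<exists>f c. hardy f \<and> continuous_on (sphere 0 1) c \<and> x = cls f + cls c \<and> v = h (cls f) + c l)
      else undefined)" for x
  have small: "\<exists>r>0. AE z in circle_measure. norm (z - l) < r \<longrightarrow> norm (c z - c l) \<le> e"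
    if c: "continuous_on (sphere 0 1) c" and e: "0 < e" for c :: "complex \<Rightarrow> complex" and e
  proof -
    obtain r where r: "0 < r" "\<And>z. norm z = 1 \<Longrightarrow> norm (z - l) < r \<Longrightarrow> norm (c z - c l) < e"
      using c h(3) e unfolding continuous_on_iff dist_norm by (metis mem_sphere_0)
    show ?thesis
      using r(1) by (intro exI[of _ r] conjI AE_circleI impI less_imp_le r(2))
  qed
  have unique: "h (cls f) + c l = h (cls g) + d l"
    if fg: "hardy f" "hardy g" and cd: "continuous_on (sphere 0 1) c" "continuous_on (sphere 0 1) d"
      and eq: "cls f + cls c = cls g + cls d" for f g c d
  proof -
    have "AE z in circle_measure. f z + c z = g z + d z"
      using eq fg cd by (simp add: cls_add cls_eq_iff hardy_ess_bounded ess_bounded_continuous ess_bounded_add)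
    have "h (cls (\<lambda>z. f z + (-1) * g z)) = d l - c l"
    proof (rule H_hom_ess_limit[OF h])
      show "hardy (\<lambda>z. f z + (-1) * g z)" by (intro hardy_add hardy_cmult fg)
      fix e :: real assume "0 < e"
      then obtain r where r: "0 < r" "AE z in circle_measure. norm (z - l) < r \<longrightarrow> norm ((d z - c z) - (d l - c l)) \<le> e"
        using small[of "\<lambda>z. d z - c z" e] cd by (auto intro: continuous_intros)
      from r(2) \<open>AE z in circle_measure. f z + c z = g z + d z\<close>
      have "AE z in circle_measure. norm (z - l) < r \<longrightarrow> norm (f z + (-1) * g z - (d l - c l)) \<le> e"
      proof eventually_elim
        case (elim z)
        have "f z + (-1) * g z = d z - c z" using elim(2) by (simp add: algebra_simps)
        with elim(1) show ?case by simp
      qed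
      with r(1) show "\<exists>r>0. AE z in circle_measure. norm (z - l) < r \<longrightarrow> norm (f z + (-1) * g z - (d l - c l)) \<le> e"
        by blast
    qed
    moreover have "cls (\<lambda>z. f z + (-1) * g z) = cls f - cls g"
      using fg by (simp add: cls_diff hardy_ess_bounded)
    ultimately have "h (cls f - cls g) = d l - c l" by (simp only:)
    then show ?thesis using fg by (simp add: H_hom_diff[OF h(1)] hardy_cls algebra_simps)
  qed
  have psi: "\<psi> (cls f + cls c) = h (cls f) + c l" if "hardy f" "continuous_on (sphere 0 1) c" for f c
  proof -
    let ?P = "\<lambda>v. \<exists>f' c'. hardy f' \<and> continuous_on (sphere 0 1) c' \<and> cls f + cls c = cls f' + cls c' \<and> v = h (cls f') + c' l"
    have "?P (h (cls f) + c l)" using that by blast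
    then have "(SOME v. ?P v) = h (cls f) + c l"
    proof (rule someI2[where Q = "\<lambda>v. v = h (cls f) + c l"])
      fix v assume "?P v"
      then obtain f' c' where "hardy f'" "continuous_on (sphere 0 1) c'"
        "cls f + cls c = cls f' + cls c'" "v = h (cls f') + c' l" by blast
      with unique[OF that(1) _ that(2)] show "v = h (cls f) + c l" by simp
    qed
    then show ?thesis using HC_I[OF that] by (simp add: \<psi>_def)
  qed
  have "\<psi> \<in> character_space HC"
    unfolding character_space_def
  proof (intro CollectI conjI ballI allI)
    show "\<psi> \<in> extensional HC" by (simp add: \<psi>_def extensional_def)
    show "\<exists>f\<in>HC. \<psi> f \<noteq> 0"
      using psi[OF hardy_const[of 1] continuous_on_const[of _ 0]] HC_I[OF hardy_const[of 1] continuous_on_const[of _ 0]] H_hom_simps(1)[OF h(1)]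
      by (intro bexI[of _ "cls (\<lambda>_. 1) + cls (\<lambda>_. 0)"]) (auto simp flip: cls_one)
    fix x assume x: "x \<in> HC"
    then obtain f c where fc: "hardy f" "continuous_on (sphere 0 1) c" "x = cls f + cls c" by (rule HC_cases)
    note eb = hardy_ess_bounded[OF fc(1)] ess_bounded_continuous[OF fc(2)]
    show "\<psi> (s *\<^sub>C x) = s * \<psi> x" for s
    proof -
      have "s *\<^sub>C x = cls (\<lambda>z. s * f z) + cls (\<lambda>z. s * c z)"
        unfolding fc(3) scaleC_add_right using eb by (simp add: cls_scaleC)
      then have "\<psi> (s *\<^sub>C x) = h (cls (\<lambda>z. s * f z)) + s * c l"
        using fc by (simp add: psi hardy_cmult continuous_on_mult_left)
      also have "h (cls (\<lambda>z. s * f z)) = s * h (cls f)"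
        using fc(1) eb by (simp add: H_hom_simps(4)[OF h(1)] hardy_cls flip: cls_scaleC)
      finally show ?thesis using psi[OF fc(1,2)] by (simp add: fc(3) distrib_left)
    qed
    fix y assume y: "y \<in> HC"
    then obtain g d where gd: "hardy g" "continuous_on (sphere 0 1) d" "y = cls g + cls d" by (rule HC_cases)
    note eb' = hardy_ess_bounded[OF gd(1)] ess_bounded_continuous[OF gd(2)]
    show "\<psi> (x + y) = \<psi> x + \<psi> y"
    proof -
      have "x + y = (cls f + cls g) + (cls c + cls d)" by (simp add: fc gd algebra_simps)
      also have "\<dots> = cls (\<lambda>z. f z + g z) + cls (\<lambda>z. c z + d z)" using eb eb' by (simp add: cls_add)
      finally have "\<psi> (x + y) = h (cls (\<lambda>z. f z + g z)) + (c l + d l)"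
        using fc gd by (simp add: psi hardy_add continuous_on_add)
      also have "h (cls (\<lambda>z. f z + g z)) = h (cls f) + h (cls g)"
        using fc(1) gd(1) eb eb' by (simp add: H_hom_simps(2)[OF h(1)] hardy_cls flip: cls_add)
      finally show ?thesis using psi[OF fc(1,2)] psi[OF gd(1,2)] by (simp add: fc(3) gd(3))
    qed
    show "\<psi> (x * y) = \<psi> x * \<psi> y"
    proof -
      have "x * y \<in> HC" by (rule HC_mult[OF phi x y])
      then obtain k e where ke: "hardy k" "continuous_on (sphere 0 1) e" "x * y = cls k + cls e" by (rule HC_cases)
      note eb'' = hardy_ess_bounded[OF ke(1)] ess_bounded_continuous[OF ke(2)]
      have ae: "AE z in circle_measure. (f z + c z) * (g z + d z) = k z + e z"
        using ke(3) eb eb' eb'' unfolding fc(3) gd(3)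
        by (simp only: cls_add cls_mult cls_eq_iff ess_bounded_add ess_bounded_mult)
      \<comment> \<open>From (f + c) * (g + d) = k + e one gets u = (c - c l) * g + (d - d l) * f +
        (c * d - e). This tends to \<open>?v\<close> at \<open>l\<close> although \<open>f\<close>
        and \<open>g\<close> have no limits there.\<close>
      let ?u = "\<lambda>z. k z + (-1) * (f z * g z) + (- c l) * g z + (- d l) * f z"
      let ?v = "c l * d l - e l"
      have u: "hardy ?u" by (intro hardy_add hardy_cmult hardy_mult fc gd ke)
      obtain K where K: "AE z in circle_measure. norm (f z) \<le> K" using eb(1) by (auto simp: ess_bounded_def)
      obtain K' where K': "AE z in circle_measure. norm (g z) \<le> K'" using eb'(1) by (auto simp: ess_bounded_def)
      have lim: "h (cls ?u) = ?v"
      proof (rule H_hom_ess_limit[OF h u])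
        fix eps :: real assume eps: "0 < eps"
        define t where "t = eps / (2 * (1 + \<bar>K\<bar> + \<bar>K'\<bar>))"
        have t: "0 < t" "(\<bar>K\<bar> + \<bar>K'\<bar>) * t \<le> eps / 2"
          using eps by (auto simp: t_def field_simps intro: add_pos_nonneg)
        obtain r1 where r1: "0 < r1" "AE z in circle_measure. norm (z - l) < r1 \<longrightarrow> norm (c z - c l) \<le> t"
          using small[OF fc(2) t(1)] by blast
        obtain r2 where r2: "0 < r2" "AE z in circle_measure. norm (z - l) < r2 \<longrightarrow> norm (d z - d l) \<le> t"
          using small[OF gd(2) t(1)] by blast
        have "continuous_on (sphere 0 1) (\<lambda>z. c z * d z - e z)" by (intro continuous_intros fc gd ke)
        from small[OF this, of "eps/2"] obtain r3 where r3: "0 < r3"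
          "AE z in circle_measure. norm (z - l) < r3 \<longrightarrow> norm (c z * d z - e z - ?v) \<le> eps/2"
          using eps by auto
        have "AE z in circle_measure. norm (z - l) < min r1 (min r2 r3) \<longrightarrow> norm (?u z - ?v) \<le> eps"
          using r1(2) r2(2) r3(2) ae K K'
        proof eventually_elim
          case (elim z)
          show ?case
          proof
            assume "norm (z - l) < min r1 (min r2 r3)"
            then have b: "norm (c z - c l) \<le> t" "norm (d z - d l) \<le> t" "norm (c z * d z - e z - ?v) \<le> eps/2"
              using elim by auto
            have "?u z - ?v = (c z - c l) * g z + (d z - d l) * f z + (c z * d z - e z - ?v)"
              using elim(4) by (simp add: algebra_simps)
            then have "norm (?u z - ?v) \<le> norm ((c z - c l) * g z) + norm ((d z - d l) * f z) + norm (c z * d z - e z - ?v)"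
              by (simp only:) (rule norm_triangle_le, intro add_mono norm_triangle_ineq order_refl)
            also have "\<dots> \<le> t * \<bar>K'\<bar> + t * \<bar>K\<bar> + eps / 2"
              unfolding norm_mult using b elim(5,6) t by (intro add_mono mult_mono) auto
            also have "\<dots> \<le> eps" using t(2) by (simp add: algebra_simps)
            finally show "norm (?u z - ?v) \<le> eps" .
          qed
        qed
        then show "\<exists>r>0. AE z in circle_measure. norm (z - l) < r \<longrightarrow> norm (?u z - ?v) \<le> eps"
          using r1 r2 r3 by (intro exI[of _ "min r1 (min r2 r3)"]) auto
      qed
      have "cls ?u = cls k + (-1) *\<^sub>C (cls f * cls g) + (- c l) *\<^sub>C cls g + (- d l) *\<^sub>C cls f"
        using eb eb' eb'' by (simp only: cls_mult cls_scaleC cls_add ess_bounded_mult ess_bounded_cmult ess_bounded_add)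
      then have "h (cls ?u) = h (cls k) - h (cls f) * h (cls g) - c l * h (cls g) - d l * h (cls f)"
        using fc(1) gd(1) ke(1)
        by (simp only: H_hom_simps[OF h(1)] hardy_cls H.add_closed H.mult_closed H.scaleC_closed)
           (simp add: algebra_simps)
      from trans[OF this[symmetric] lim] have "h (cls k) + e l = (h (cls f) + c l) * (h (cls g) + d l)"
        by (simp add: algebra_simps)
      then show ?thesis using psi[OF ke(1,2)] psi[OF fc(1,2)] psi[OF gd(1,2)] ke(3) fc(3) gd(3) by simp
    qed
  qed
  with psi show ?thesis by blast
qed

section \<open>t-analytic sets and the Gelfand topology\<close>

lemma t_analytic_set_zero_divisors:
  assumes E: "t_analytic_set A E" and fg: "f \<in> A" "g \<in> A" and zero: "\<And>\<phi>. \<phi> \<in> E \<Longrightarrow> \<phi> f * \<phi> g = 0"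
  shows "(\<forall>\<phi>\<in>E. \<phi> f = 0) \<or> (\<forall>\<phi>\<in>E. \<phi> g = 0)"
proof (rule disjCI)
  assume "\<not> (\<forall>\<phi>\<in>E. \<phi> g = 0)"
  then obtain \<phi> where \<phi>: "\<phi> \<in> E" "\<phi> g \<noteq> 0" by blast
  \<comment> \<open>This set is relatively open in \<open>E\<close>, non-empty, and \<open>f\<close>
    vanishes on it.\<close>
  define U where "U = {\<psi> \<in> E. \<psi> g \<noteq> 0}"
  have sub: "E \<subseteq> character_space A" using E by (simp add: t_analytic_set_def)
  have "openin (gelfand_topology A) {\<psi> \<in> topspace (gelfand_topology A). gelfand_transform g \<psi> \<in> - {0}}"
    by (rule openin_continuous_map_preimage[OF continuous_map_gelfand_transform[OF fg(2)]]) auto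
  then have "openin (subtopology (gelfand_topology A) E) (E \<inter> {\<psi> \<in> character_space A. \<psi> g \<noteq> 0})"
    by (simp add: openin_subtopology_Int2 gelfand_transform_def)
  also have "E \<inter> {\<psi> \<in> character_space A. \<psi> g \<noteq> 0} = U" using sub by (auto simp: U_def)
  finally have "openin (subtopology (gelfand_topology A) E) U" .
  moreover have "U \<noteq> {}" using \<phi> by (auto simp: U_def)
  moreover have "\<forall>\<psi>\<in>U. gelfand_transform f \<psi> = 0"
    using zero by (auto simp: U_def gelfand_transform_def)
  ultimately have "\<forall>\<phi>\<in>E. gelfand_transform f \<phi> = 0"
    using E fg(1) unfolding t_analytic_set_def by blast
  then show "\<forall>\<phi>\<in>E. \<phi> f = 0" by (simp add: gelfand_transform_def)
qed

text \<open>A basic open box constrains only finitely many coordinates. Asking for exact agreement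
  there, instead of closeness, turns the neighbourhood condition into a vanishing condition.\<close>

lemma gelfand_open_basic:
  assumes E: "openin (gelfand_topology A) E" and \<phi>: "\<phi> \<in> E"
  shows "\<exists>F. finite F \<and> F \<subseteq> A \<and> (\<forall>\<psi>\<in>character_space A. (\<forall>f\<in>F. \<psi> f = \<phi> f) \<longrightarrow> \<psi> \<in> E)"
proof -
  obtain T where T: "openin (product_topology (\<lambda>_. euclidean) A) T" "E = T \<inter> character_space A"
    using E unfolding gelfand_topology_def openin_subtopology by blast
  with \<phi> have "\<phi> \<in> T" by blast
  with T(1) obtain U where U: "finite {i \<in> A. U i \<noteq> UNIV}" "\<phi> \<in> Pi\<^sub>E A U" "Pi\<^sub>E A U \<subseteq> T"
    unfolding openin_product_topology_alt by auto
  have "\<psi> \<in> E" if "\<psi> \<in> character_space A" "\<forall>f\<in>{i \<in> A. U i \<noteq> UNIV}. \<psi> f = \<phi> f" for \<psi>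
  proof -
    have "\<psi> i \<in> U i" if "i \<in> A" for i
      using \<open>\<forall>f\<in>_. \<psi> f = \<phi> f\<close> PiE_mem[OF U(2) that] that by (cases "U i = UNIV") auto
    moreover have "\<psi> \<in> extensional A" using that(1) by (simp add: character_space_def)
    ultimately have "\<psi> \<in> Pi\<^sub>E A U" by (simp add: PiE_iff)
    with U(3) T(2) that(1) show ?thesis by blast
  qed
  with U(1) show ?thesis by (intro exI[of _ "{i \<in> A. U i \<noteq> UNIV}"]) auto
qed

text \<open>Two tents whose radius is half the distance of the points have product 0, yet neither
  vanishes at its own centre.\<close>

lemma t_analytic_set_in_fibre:
  assumes E: "t_analytic_set HC E" and \<phi>: "\<phi> \<in> E" and \<psi>: "\<psi> \<in> E"
  shows "\<phi> coordinate = \<psi> coordinate"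
proof (rule ccontr)
  assume neq: "\<phi> coordinate \<noteq> \<psi> coordinate"
  define r where "r = norm (\<phi> coordinate - \<psi> coordinate) / 2"
  have r: "0 < r" using neq by (simp add: r_def)
  define c where "c l z = complex_of_real (max 0 (r - norm (z - l)))" for l z :: complex
  have c: "continuous_on (sphere 0 1) (c l)" for l unfolding c_def by (intro continuous_intros)
  have char: "\<phi> \<in> character_space HC" if "\<phi> \<in> E" for \<phi> using E that by (auto simp: t_analytic_set_def)
  have "c (\<phi> coordinate) z * c (\<psi> coordinate) z = 0" for z
    using norm_triangle_ineq4[of "z - \<psi> coordinate" "z - \<phi> coordinate"]
    by (auto simp: c_def r_def max_def)
  then have "w (cls (c (\<phi> coordinate))) * w (cls (c (\<psi> coordinate))) = 0" if "w \<in> E" for w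
    using character_continuous(1)[OF char[OF that] c] by simp
  then have "(\<forall>w\<in>E. w (cls (c (\<phi> coordinate))) = 0) \<or> (\<forall>w\<in>E. w (cls (c (\<psi> coordinate))) = 0)"
    by (intro t_analytic_set_zero_divisors[OF E] continuous_in_HC c)
  then have "\<phi> (cls (c (\<phi> coordinate))) = 0 \<or> \<psi> (cls (c (\<psi> coordinate))) = 0" using \<phi> \<psi> by blast
  moreover have "\<phi> (cls (c (\<phi> coordinate))) = of_real r" "\<psi> (cls (c (\<psi> coordinate))) = of_real r"
    using character_continuous(1)[OF char[OF \<phi>] c] character_continuous(1)[OF char[OF \<psi>] c] r
    by (simp_all add: c_def)
  ultimately show False using r by simp
qed

section \<open>Localisation on scales\<close>

text \<open>On the right half plane a soft switch: close to 1 for |s| far below 1 / c, close to 0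
  far above. Products with 1 - kernel select a range of |s|.\<close>

definition kernel :: "real \<Rightarrow> complex \<Rightarrow> complex" where
  "kernel c s = 1 / (1 + of_real c * s)"

definition bump :: "nat \<Rightarrow> complex \<Rightarrow> complex" where
  "bump j s = kernel (4 ^ j) s * (1 - kernel (4 ^ j) s)"

text \<open>Close to 1 on the window from 4^-(j+m) to 4^(m-j) for |s|, away from its ends;
  \<open>m\<close> is the half-width of the window around scale \<open>j\<close>.\<close>

definition plateau :: "nat \<Rightarrow> nat \<Rightarrow> complex \<Rightarrow> complex" where
  "plateau j m s = kernel (4 ^ j / 4 ^ m) s * (1 - kernel (4 ^ j * 4 ^ m) s)"

text \<open>With x^2 = 4^j * |s| this is min x (1/x), half the decay rate of \<open>bump\<close>, so
  that its square dominates the bump and its sum over \<open>j\<close> still converges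
  geometrically.\<close>

definition weight :: "nat \<Rightarrow> complex \<Rightarrow> real" where
  "weight j s = min (2 ^ j * sqrt (norm s)) (1 / (2 ^ j * sqrt (norm s)))"

section \<open>Size estimates for the scale functions\<close>

context
  fixes c :: real and s :: complex
  assumes c: "0 < c" and s: "0 \<le> Re s"
begin

lemma kernel_denominator: "1 \<le> norm (1 + of_real c * s)" "c * norm s \<le> norm (1 + of_real c * s)"
proof -
  have "(norm (1 + of_real c * s))\<^sup>2 = 1 + 2 * c * Re s + (c * norm s)\<^sup>2"
    unfolding power_mult_distrib cmod_power2 by (simp add: power2_eq_square algebra_simps)
  then have "1 + (c * norm s)\<^sup>2 \<le> (norm (1 + of_real c * s))\<^sup>2" using c s by simp
  then have "1\<^sup>2 \<le> (norm (1 + of_real c * s))\<^sup>2" "(c * norm s)\<^sup>2 \<le> (norm (1 + of_real c * s))\<^sup>2"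
    using zero_le_power2[of "c * norm s"] unfolding one_power2 by linarith+
  then show "1 \<le> norm (1 + of_real c * s)" "c * norm s \<le> norm (1 + of_real c * s)"
    by (auto intro: power2_le_imp_le)
qed

lemma one_minus_kernel: "1 - kernel c s = of_real c * s * kernel c s"
proof -
  have "1 + of_real c * s \<noteq> 0" using kernel_denominator(1) by auto
  then show ?thesis by (simp add: kernel_def field_simps)
qed

lemma norm_kernel:
  "norm (kernel c s) \<le> 1" "c * norm s * norm (kernel c s) \<le> 1"
  "norm (1 - kernel c s) \<le> 1" "norm (1 - kernel c s) \<le> c * norm s"
proof -
  show 1: "norm (kernel c s) \<le> 1" "c * norm s * norm (kernel c s) \<le> 1"
    using kernel_denominator by (auto simp: kernel_def norm_divide divide_le_eq)
  have "norm (1 - kernel c s) = c * norm s * norm (kernel c s)"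
    using c by (simp add: one_minus_kernel norm_mult)
  moreover have "c * norm s * norm (kernel c s) \<le> c * norm s * 1"
    using c 1 by (intro mult_left_mono) auto
  ultimately show "norm (1 - kernel c s) \<le> 1" "norm (1 - kernel c s) \<le> c * norm s"
    using 1(2) by simp_all
qed

end

text \<open>Trades decay like y^2 for decay like y, the rate in which plateaus and weights are
  compared.\<close>

lemma le_square_or_one: "0 \<le> y \<Longrightarrow> x \<le> 1 \<Longrightarrow> x \<le> y\<^sup>2 \<Longrightarrow> x \<le> (y::real)"
  using mult_left_le[of y y] by (cases "y \<le> 1") (simp_all add: power2_eq_square)

lemma sqrt_norm_power: "4 ^ j * norm s = (2 ^ j * sqrt (norm s))\<^sup>2"
proof -
  have "(4::real) ^ j = (2 ^ j)\<^sup>2" by (simp add: power2_eq_square flip: power_mult_distrib)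
  then show ?thesis by (simp add: power_mult_distrib)
qed

lemma weight_nonneg: "0 \<le> weight j s"
  and weight_le: "weight j s \<le> 2 ^ j * sqrt (norm s)" "weight j s \<le> 1 / (2 ^ j * sqrt (norm s))"
  and weight_zero: "weight j 0 = 0"
  by (auto simp: weight_def)

lemma weight_le_1: "weight j s \<le> 1"
  unfolding weight_def by (cases "2 ^ j * sqrt (norm s) \<le> 1") (auto simp: min_le_iff_disj divide_le_eq)

lemma norm_bump:
  assumes s: "0 \<le> Re s" shows "norm (bump j s) \<le> (weight j s)\<^sup>2"
proof (cases "s = 0")
  case False
  define x where "x = 2 ^ j * sqrt (norm s)"
  have x: "0 < x" "4 ^ j * norm s = x\<^sup>2" using False by (auto simp: x_def sqrt_norm_power)
  note k = norm_kernel[of "4 ^ j", OF _ s, simplified, unfolded x(2)]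
  have "norm (bump j s) \<le> 1 * x\<^sup>2" "norm (bump j s) \<le> norm (kernel (4 ^ j) s) * 1"
    unfolding bump_def norm_mult using k by (intro mult_mono; simp)+
  moreover have "norm (kernel (4 ^ j) s) \<le> (1 / x)\<^sup>2"
    using k(2) x by (simp add: power_divide field_simps)
  ultimately have "norm (bump j s) \<le> x\<^sup>2" "norm (bump j s) \<le> (1 / x)\<^sup>2" by simp_all
  then show ?thesis by (simp add: weight_def x_def min_def)
qed (simp add: bump_def kernel_def weight_def)

text \<open>With \<open>w = 4 ^ j * s\<close> one has \<open>bump j s = w / (1 + w) ^ 2\<close>, the reciprocal of
  \<open>2 + w + 1 / w\<close>, whose real part is at least \<open>2\<close> on the right half plane.\<close>

lemma Re_bump:
  assumes s: "0 \<le> Re s"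
  shows "0 \<le> Re (bump j s)" and "1 \<le> 4 ^ j * norm s \<Longrightarrow> 4 ^ j * norm s \<le> 4 \<Longrightarrow> 1 / 20 \<le> Re (bump j s)"
proof -
  define w where "w = of_real (4 ^ j) * s"
  define k where "k = kernel (4 ^ j) s"
  have d: "1 \<le> norm (1 + w)" unfolding w_def by (rule kernel_denominator(1)) (use s in auto)
  then have nz: "1 + w \<noteq> 0" by auto
  have a: "0 \<le> Re w" using s by (simp add: w_def)
  have wn: "norm w = 4 ^ j * norm s" by (simp add: w_def norm_mult norm_power)
  have "bump j s = w * k\<^sup>2"
    unfolding bump_def k_def using one_minus_kernel[of "4 ^ j" s] s by (simp add: w_def power2_eq_square)
  also have "k = cnj (1 + w) / of_real ((norm (1 + w))\<^sup>2)"
  proof -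
    have "cnj (1 + w) \<noteq> 0" using nz by (simp only: complex_cnj_zero_iff not_False_eq_True)
    then have "cnj (1 + w) / ((1 + w) * cnj (1 + w)) = 1 / (1 + w)"
      by (rule nonzero_divide_mult_cancel_right)
    then show ?thesis unfolding complex_norm_square by (simp only: k_def kernel_def w_def)
  qed
  finally have eq: "bump j s = w * (cnj (1 + w))\<^sup>2 / of_real ((norm (1 + w)) ^ 4)"
    by (simp add: power_divide flip: power_mult)
  have "w * (cnj (1 + w))\<^sup>2 = w + 2 * (w * cnj w) + (w * cnj w) * cnj w"
    by (simp add: power2_eq_square algebra_simps)
  also have "\<dots> = w + of_real (2 * (norm w)\<^sup>2) + of_real ((norm w)\<^sup>2) * cnj w"
    by (simp only: of_real_mult of_real_numeral complex_norm_square)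
  finally have "Re (w * (cnj (1 + w))\<^sup>2) = Re w + 2 * (norm w)\<^sup>2 + (norm w)\<^sup>2 * Re w"
    by simp
  then have ge: "2 * (norm w)\<^sup>2 \<le> Re (w * (cnj (1 + w))\<^sup>2)" using a by simp
  have Re: "Re (bump j s) = Re (w * (cnj (1 + w))\<^sup>2) / (norm (1 + w)) ^ 4"
    unfolding eq by (rule Re_divide_of_real)
  have "0 \<le> Re (w * (cnj (1 + w))\<^sup>2)" using ge zero_le_power2[of "norm w"] by linarith
  then show "0 \<le> Re (bump j s)" unfolding Re by (rule divide_nonneg_nonneg) simp
  assume "1 \<le> 4 ^ j * norm s" "4 ^ j * norm s \<le> 4"
  then have n: "1 \<le> norm w" "norm w \<le> 4" by (simp_all add: wn)
  \<comment> \<open>The inequality is (4 - n) * (4 * n - 1) >= 0 for n = norm w. Squared it gives |1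
    + w|^4 <= (625/16) * |w|^2 <= 40 * |w|^2, whence 1/20.\<close>
  have "4 * (1 + norm w)\<^sup>2 \<le> 25 * norm w"
    using mult_nonneg_nonneg[of "4 - norm w" "4 * norm w - 1"] n by (simp add: power2_eq_square algebra_simps)
  then have "(4 * (1 + norm w)\<^sup>2)\<^sup>2 \<le> (25 * norm w)\<^sup>2" by (intro power_mono) auto
  then have 4: "16 * (1 + norm w) ^ 4 \<le> 625 * (norm w)\<^sup>2"
    by (simp add: power_mult_distrib flip: power_mult)
  have "(norm (1 + w)) ^ 4 \<le> (1 + norm w) ^ 4"
    using norm_triangle_ineq[of 1 w] by (intro power_mono) auto
  with 4 ge zero_le_power2[of "norm w"] have "(norm (1 + w)) ^ 4 \<le> 20 * Re (w * (cnj (1 + w))\<^sup>2)"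
    by linarith
  then show "1 / 20 \<le> Re (bump j s)"
  proof -
    have "0 < (norm (1 + w)) ^ 4" using d by (intro zero_less_power) linarith
    with \<open>_ \<le> 20 * _\<close> show ?thesis unfolding Re by (subst pos_le_divide_eq) auto
  qed
qed

lemma weight_shift: "weight (Suc j) s = weight j (4 * s)"
  by (simp add: weight_def norm_mult real_sqrt_mult mult_ac)

text \<open>The majorant is made for induction along s -> 4 * s: \<open>weight 0 s\<close> plus its
  value at 4 * s is at most its value at s. With t = sqrt |s| this is an equality of the bounds for
  t >= 1 and t < 1/2; between, it is (2 * t - 1) * (1 - t) >= 0.\<close>

lemma sum_weight_le: "(\<Sum>j<n. weight j s) \<le> (if 1 \<le> norm s then 2 / sqrt (norm s) else 4 - sqrt (norm s))"
proof (induction n arbitrary: s)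
  case 0
  have "sqrt (norm s) \<le> 4" if "\<not> 1 \<le> norm s"
  proof -
    have "sqrt (norm s) \<le> 1" using that by simp
    then show ?thesis by linarith
  qed
  then show ?case by simp
next
  case (Suc n)
  define t where "t = sqrt (norm s)"
  have t: "0 \<le> t" "norm s = t\<^sup>2" "sqrt (norm (4 * s)) = 2 * t" by (auto simp: t_def norm_mult real_sqrt_mult)
  have i: "1 \<le> norm s \<longleftrightarrow> 1 \<le> t" "1 \<le> norm (4 * s) \<longleftrightarrow> 1 \<le> 2 * t"
    using real_sqrt_ge_1_iff[of "norm s"] real_sqrt_ge_1_iff[of "norm (4 * s)"]
    unfolding t(3) t_def[symmetric] by blast+
  have "(\<Sum>j<Suc n. weight j s) = weight 0 s + (\<Sum>j<n. weight j (4 * s))"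
    by (simp only: sum.lessThan_Suc_shift weight_shift)
  also have "\<dots> \<le> weight 0 s + (if 1 \<le> norm (4 * s) then 2 / (2 * t) else 4 - 2 * t)"
    using Suc[of "4 * s"] unfolding t(3) by simp
  also have "\<dots> \<le> (if 1 \<le> t then 2 / t else 4 - t)"
  proof -
    consider "1 \<le> t" | "1/2 \<le> t" "t < 1" | "t < 1/2" by linarith
    then show ?thesis
    proof cases
      case 1
      have "weight 0 s \<le> 1 / t" using weight_le(2)[of 0 s] by (simp add: t_def)
      with 1 i show ?thesis by simp
    next
      case 2
      have "weight 0 s \<le> t" using weight_le(1)[of 0 s] by (simp add: t_def)
      moreover have "1 / t \<le> 4 - 2 * t"
      proof -
        have "0 \<le> (2 * t - 1) * (1 - t)" using 2 by (intro mult_nonneg_nonneg) auto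
        then have "1 \<le> t * (4 - 2 * t)" using 2 by (simp add: algebra_simps)
        then show ?thesis using 2 by (simp add: field_simps)
      qed
      ultimately show ?thesis using 2 i by simp
    next
      case 3
      have "weight 0 s \<le> t" using weight_le(1)[of 0 s] by (simp add: t_def)
      with 3 i show ?thesis by simp
    qed
  qed
  finally show ?case by (simp only: i t_def[symmetric])
qed

lemma sum_weight_le_4: "(\<Sum>j<n. weight (J + j) s) \<le> 4"
proof -
  have "(\<Sum>j<n. weight (J + j) s) \<le> (\<Sum>j<J + n. weight j s)"
    by (induction n) (auto simp: sum_nonneg weight_nonneg)
  also have "\<dots> \<le> 4"
  proof -
    have "2 / sqrt (norm s) \<le> 4" if "1 \<le> norm s"
    proof -
      have "1 \<le> sqrt (norm s)" using that by simp
      then show ?thesis using frac_le[of 2 2 1 "sqrt (norm s)"] by linarith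
    qed
    then show ?thesis using sum_weight_le[of s "J + n"] real_sqrt_ge_zero[OF norm_ge_zero[of s]]
      by (smt (verit))
  qed
  finally show ?thesis .
qed

text \<open>Here \<open>x\<close> measures the position of s relative to scale \<open>j\<close>. In
  the last bound 1 - plateau is at most x / 2^m + 1 / (2^m * x), and the weight, below both x and 1
  / x, cancels the growth of either term.\<close>

lemma plateau_bounds:
  fixes j :: nat
  assumes s: "0 \<le> Re s" "s \<noteq> 0"
  defines "x \<equiv> 2 ^ j * sqrt (norm s)"
  shows "norm (plateau j m s) \<le> 1" "norm (plateau j m s) \<le> 2 ^ m * x" "norm (plateau j m s) \<le> 2 ^ m / x"
    "weight j s * norm (1 - plateau j m s) \<le> 2 * (1/2) ^ m"
proof -
  let ?k = "kernel (4 ^ j / 4 ^ m) s" and ?l = "kernel (4 ^ j * 4 ^ m) s"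
  have x: "0 < x" "4 ^ j * norm s = x\<^sup>2" using s by (auto simp: x_def sqrt_norm_power)
  have four: "(4::real) ^ m = (2 ^ m)\<^sup>2" by (simp add: power2_eq_square flip: power_mult_distrib)
  have c: "4 ^ j / 4 ^ m * norm s = (x / 2 ^ m)\<^sup>2" "4 ^ j * 4 ^ m * norm s = (2 ^ m * x)\<^sup>2"
    unfolding power_divide power_mult_distrib x(2)[symmetric] four by simp_all
  have pos: "0 < (4 ^ j / 4 ^ m :: real)" "0 < (4 ^ j * 4 ^ m :: real)" by simp_all
  note k = norm_kernel[OF pos(1) s(1), unfolded c(1)]
  note l = norm_kernel[OF pos(2) s(1), unfolded c(2)]
  have inverse_square: "a \<le> (1 / y)\<^sup>2" if "y\<^sup>2 * a \<le> 1" "0 < y" for a y :: real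
    using that by (simp add: power_divide pos_le_divide_eq mult.commute)
  have k': "norm ?k \<le> (2 ^ m / x)\<^sup>2" using inverse_square[OF k(2)] x by simp
  have l': "norm ?l \<le> (1 / (2 ^ m * x))\<^sup>2" using inverse_square[OF l(2)] x by simp
  have kl: "norm (plateau j m s) \<le> norm ?k" "norm (plateau j m s) \<le> norm (1 - ?l)"
    unfolding plateau_def norm_mult using k(1) l(3) by (simp_all add: mult_left_le mult_left_le_one_le)
  show "norm (plateau j m s) \<le> 1" using kl k by simp
  show "norm (plateau j m s) \<le> 2 ^ m * x"
    using x(1) by (intro le_square_or_one[OF _ order_trans[OF kl(2) l(3)] order_trans[OF kl(2) l(4)]]) simp
  show "norm (plateau j m s) \<le> 2 ^ m / x"
    using x(1) by (intro le_square_or_one[OF _ order_trans[OF kl(1) k(1)] order_trans[OF kl(1) k']]) simp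
  have 1: "norm (1 - ?k) \<le> x / 2 ^ m" using x(1) by (intro le_square_or_one[OF _ k(3,4)]) simp
  have 2: "norm ?l \<le> 1 / (2 ^ m * x)" using x(1) by (intro le_square_or_one[OF _ l(1) l']) simp
  have "norm (1 - plateau j m s) = norm ((1 - ?k) + ?k * ?l)"
    by (simp add: plateau_def algebra_simps)
  also have "\<dots> \<le> norm (1 - ?k) + norm (?k * ?l)" by (rule norm_triangle_ineq)
  also have "norm (?k * ?l) \<le> norm ?l" using k(1) by (simp add: norm_mult mult_left_le_one_le)
  finally have "norm (1 - plateau j m s) \<le> norm (1 - ?k) + norm ?l" by simp
  then have "weight j s * norm (1 - plateau j m s) \<le> weight j s * norm (1 - ?k) + weight j s * norm ?l"
    unfolding distrib_left[symmetric] by (intro mult_left_mono weight_nonneg)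
  also have "\<dots> \<le> (1 / x) * (x / 2 ^ m) + x * (1 / (2 ^ m * x))"
    using weight_le[of j s] 1 2 x weight_nonneg by (intro add_mono mult_mono) (auto simp: x_def)
  also have "\<dots> = 2 * (1/2) ^ m" using x by (simp add: power_divide)
  finally show "weight j s * norm (1 - plateau j m s) \<le> 2 * (1/2) ^ m" .
qed

lemma norm_plateau_le: 
  assumes s: "0 \<le> Re s" shows "norm (plateau j m s) \<le> 4 ^ (j + m) * norm s"
proof -
  have "norm (plateau j m s) \<le> 1 * (4 ^ j * 4 ^ m * norm s)"
    unfolding plateau_def norm_mult using norm_kernel[OF _ s] by (intro mult_mono) auto
  then show ?thesis by (simp add: power_add)
qed

lemma plateau_zero: "plateau j m 0 = 0"
  by (simp add: plateau_def kernel_def)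

section \<open>Plateaus along sparse sequences of scales\<close>

locale sparse_scales =
  fixes js :: "nat \<Rightarrow> nat"
  assumes gap: "l < m \<Longrightarrow> js l + 2 * l + 2 * m \<le> js m"
begin

text \<open>Half of the exponent 2 * l + 2 * m pays for the widths 2^l and 2^m in
  \<open>plateau_bounds\<close>; the other half remains as the gain 2^-(l+m) in
  \<open>plateau_interaction\<close>.\<close>

lemma scale_ratio:
  assumes "l < m" "0 < t"
  shows "2 ^ js l * t / (2 ^ js m * t) \<le> (1/2 :: real) ^ (2 * l + 2 * m)"
proof -
  have "(2::real) ^ (js l + 2 * l + 2 * m) \<le> 2 ^ js m" using gap[OF assms(1)] by (intro power_increasing) auto
  then have "2 ^ js l * 2 ^ (2 * l + 2 * m) \<le> (2::real) ^ js m" by (simp add: power_add mult_ac)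
  then show ?thesis using assms by (simp add: power_one_over field_simps)
qed

lemma half_power: "2 ^ l * (1/2 :: real) ^ l = 1"
  by (simp flip: power_mult_distrib)

lemma half_power_bounds:
  "2 ^ l * 2 ^ m * (1/2 :: real) ^ (2 * l + 2 * m) = (1/2) ^ (l + m)"
  "2 ^ l * (1/2 :: real) ^ (2 * l + 2 * m) \<le> (1/2) ^ (l + m)"
proof -
  have "2 ^ l * 2 ^ m * (1/2 :: real) ^ (2 * l + 2 * m) = (2 ^ l * (1/2) ^ l) * (2 ^ m * (1/2) ^ m) * (1/2) ^ (l + m)"
    unfolding mult_2 power_add by (simp only: mult_ac)
  then show "2 ^ l * 2 ^ m * (1/2 :: real) ^ (2 * l + 2 * m) = (1/2) ^ (l + m)"
    by (simp only: half_power mult_1_left)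
  moreover have "2 ^ l * (1/2 :: real) ^ (2 * l + 2 * m) * 1 \<le> 2 ^ l * (1/2 :: real) ^ (2 * l + 2 * m) * 2 ^ m"
    by (intro mult_left_mono) auto
  ultimately show "2 ^ l * (1/2 :: real) ^ (2 * l + 2 * m) \<le> (1/2) ^ (l + m)" by (simp add: mult_ac)
qed

lemma plateau_interaction:
  assumes s: "0 \<le> Re s" and lm: "l \<noteq> m"
  shows "norm (plateau (js l) l s) * norm (plateau (js m) m s) \<le> (1/2) ^ (l + m)"
    and "weight (js m) s * norm (plateau (js l) l s) \<le> (1/2) ^ (l + m)"
proof -
  show "norm (plateau (js l) l s) * norm (plateau (js m) m s) \<le> (1/2) ^ (l + m)"
  proof (cases "s = 0")
    case False
    let ?x = "\<lambda>l. 2 ^ js l * sqrt (norm s)"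
    have main: "norm (plateau (js l) l s) * norm (plateau (js m) m s) \<le> (1/2) ^ (l + m)" if "l < m" for l m
    proof -
      have "norm (plateau (js l) l s) * norm (plateau (js m) m s) \<le> (2 ^ l * ?x l) * (2 ^ m / ?x m)"
        using plateau_bounds[OF s False] by (intro mult_mono) auto
      also have "\<dots> = 2 ^ l * 2 ^ m * (?x l / ?x m)" by simp
      also have "\<dots> \<le> 2 ^ l * 2 ^ m * (1/2) ^ (2 * l + 2 * m)"
        using scale_ratio[OF that, of "sqrt (norm s)"] False by (intro mult_left_mono) auto
      finally show ?thesis unfolding half_power_bounds .
    qed
    show ?thesis using main[of l m] main[of m l] lm by (cases "l < m") (auto simp: mult.commute add.commute)
  qed (simp add: plateau_zero)
  show "weight (js m) s * norm (plateau (js l) l s) \<le> (1/2) ^ (l + m)"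
  proof (cases "s = 0")
    case False
    let ?x = "\<lambda>l. 2 ^ js l * sqrt (norm s)"
    have "weight (js m) s * norm (plateau (js l) l s) \<le> 2 ^ l * (1/2) ^ (2 * l + 2 * m)"
    proof (cases "l < m")
      case True
      have "weight (js m) s * norm (plateau (js l) l s) \<le> (1 / ?x m) * (2 ^ l * ?x l)"
        using plateau_bounds[OF s False] weight_le by (intro mult_mono) auto
      also have "\<dots> = 2 ^ l * (?x l / ?x m)" by simp
      also have "\<dots> \<le> 2 ^ l * (1/2) ^ (2 * l + 2 * m)"
        using scale_ratio[OF True, of "sqrt (norm s)"] False by (intro mult_left_mono) auto
      finally show ?thesis .
    next
      case neg: False
      then have "m < l" using lm by simp
      have "weight (js m) s * norm (plateau (js l) l s) \<le> ?x m * (2 ^ l / ?x l)"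
        using plateau_bounds[OF s False] weight_le by (intro mult_mono) auto
      also have "\<dots> = 2 ^ l * (?x m / ?x l)" by simp
      also have "\<dots> \<le> 2 ^ l * (1/2) ^ (2 * m + 2 * l)"
        using scale_ratio[OF \<open>m < l\<close>, of "sqrt (norm s)"] False by (intro mult_left_mono) auto
      finally show ?thesis by (simp add: add.commute)
    qed
    also have "\<dots> \<le> (1/2) ^ (l + m)" by (rule half_power_bounds)
    finally show ?thesis .
  qed (simp add: plateau_zero)
qed

text \<open>Two different plateaus have product at most 2^-(l+m), so once the m-th exceeds 2^-m
  every other one is at most 2^-l.\<close>

lemma at_most_one_active:
  assumes s: "0 \<le> Re s"
  shows "\<exists>m. \<forall>l. l \<noteq> m \<longrightarrow> norm (plateau (js l) l s) \<le> (1/2) ^ l"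
proof (cases "\<exists>m. (1/2) ^ m < norm (plateau (js m) m s)")
  case True
  then obtain m where m: "(1/2) ^ m < norm (plateau (js m) m s)" by blast
  have "norm (plateau (js l) l s) \<le> (1/2) ^ l" if "l \<noteq> m" for l
  proof -
    have "norm (plateau (js l) l s) * (1/2) ^ m \<le> norm (plateau (js l) l s) * norm (plateau (js m) m s)"
      using m by (intro mult_left_mono) auto
    also have "\<dots> \<le> (1/2) ^ (l + m)" by (rule plateau_interaction[OF s that])
    finally show ?thesis by (simp add: power_add)
  qed
  then show ?thesis by blast
qed (auto simp: not_less)

end

lemma sum_half_tail_le: "(\<Sum>l<n. if l < N then 0 else (1/2 :: real) ^ l) \<le> 2 * (1/2) ^ N"
proof -
  have "(\<Sum>l<n. if l < N then 0 else (1/2 :: real) ^ l) \<le> (if n \<le> N then 0 else 2 * (1/2) ^ N - 2 * (1/2) ^ n)"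
  proof (induction n)
    case (Suc n)
    then show ?case by (cases n N rule: linorder_cases) auto
  qed simp
  also have "\<dots> \<le> 2 * (1/2) ^ N" by simp
  finally show ?thesis .
qed

lemma sum_initial_le: "0 \<le> e \<Longrightarrow> (\<Sum>l<n. if l < N then e else 0) \<le> real N * (e :: real)"
proof -
  assume "0 \<le> e"
  have "(\<Sum>l<n. if l < N then e else 0) = (\<Sum>l\<in>{..<n} \<inter> {..<N}. e)"
    by (simp only: sum.inter_restrict[OF finite_lessThan] lessThan_iff)
  also have "\<dots> \<le> (\<Sum>l<N. e)" using \<open>0 \<le> e\<close> by (intro sum_mono2) auto
  finally show ?thesis by simp
qed

lemma norm_suminf_le:
  fixes f :: "nat \<Rightarrow> complex"
  assumes B: "\<And>n. (\<Sum>j<n. norm (f j)) \<le> B"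
  shows "summable f" and "norm (\<Sum>j. f j) \<le> B"
proof -
  have "summable (\<lambda>j. norm (f j))" by (rule summableI_nonneg_bounded[OF _ B]) simp
  then show f: "summable f" by (rule summable_norm_cancel)
  have "norm (\<Sum>j<n. f j) \<le> B" for n using norm_sum B order_trans by blast
  then show "norm (\<Sum>j. f j) \<le> B"
    using tendsto_norm[OF summable_LIMSEQ[OF f]] by (intro Lim_bounded) auto
qed

context sparse_scales
begin

definition plateau_sum :: "nat set \<Rightarrow> complex \<Rightarrow> complex" where
  "plateau_sum S s = (\<Sum>m. if m \<in> S then plateau (js m) m s else 0)"

text \<open>The first \<open>N\<close> terms are small if s is close to 0, the others are dominated
  by a geometric tail.\<close>

lemma plateau_partial_sum_le:
  assumes s: "0 \<le> Re s" and e: "0 \<le> e" "\<And>m. m < N \<Longrightarrow> norm (plateau (js m) m s) \<le> e"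
    and active: "\<And>l. l \<in> S \<Longrightarrow> norm (plateau (js l) l s) \<le> (1/2) ^ l"
  shows "(\<Sum>l<n. norm (if l \<in> S then plateau (js l) l s else 0)) \<le> N * e + 2 * (1/2) ^ N"
proof -
  have "(\<Sum>l<n. norm (if l \<in> S then plateau (js l) l s else 0)) \<le>
      (\<Sum>l<n. (if l < N then e else 0) + (if l < N then 0 else (1/2) ^ l))"
    using e active by (intro sum_mono) auto
  also have "\<dots> \<le> N * e + 2 * (1/2) ^ N"
    unfolding sum.distrib by (intro add_mono sum_initial_le sum_half_tail_le e)
  finally show ?thesis .
qed

lemma plateau_partial_sum_le_3:
  assumes s: "0 \<le> Re s"
  shows "(\<Sum>l<n. norm (if l \<in> S then plateau (js l) l s else 0)) \<le> 3"
proof -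
  obtain m where m: "\<And>l. l \<noteq> m \<Longrightarrow> norm (plateau (js l) l s) \<le> (1/2) ^ l"
    using at_most_one_active[OF s] by blast
  have pm: "norm (plateau (js m) m s) \<le> 1"
    using plateau_bounds(1)[OF s] by (cases "s = 0") (auto simp: plateau_zero)
  have "(\<Sum>l<n. norm (if l \<in> S then plateau (js l) l s else 0)) \<le>
      (\<Sum>l<n. norm (if l \<in> S - {m} then plateau (js l) l s else 0) + (if l = m then 1 else 0))"
    using pm by (intro sum_mono) auto
  also have "\<dots> \<le> (0 * 0 + 2 * (1/2) ^ 0) + 1"
    unfolding sum.distrib using plateau_partial_sum_le[OF s, of 0 0 "S - {m}" n] m
    by (intro add_mono) (auto simp: sum.delta)
  finally show ?thesis by simp
qed

lemma norm_plateau_sum_le_3: "0 \<le> Re s \<Longrightarrow> norm (plateau_sum S s) \<le> 3"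
  unfolding plateau_sum_def by (intro norm_suminf_le plateau_partial_sum_le_3)

lemma plateau_sum_near_scale:
  assumes s: "0 \<le> Re s" and m: "m \<in> S"
  shows "weight (js m) s * norm (1 - plateau_sum S s) \<le> 4 * (1/2) ^ m"
proof -
  define f where "f l = (if l \<in> S - {m} then plateau (js l) l s else 0)" for l
  define w where "w = weight (js m) s"
  have w: "0 \<le> w" by (simp add: w_def weight_nonneg)
  have f: "summable f" unfolding f_def by (rule norm_suminf_le(1)[OF plateau_partial_sum_le_3[OF s]])
  have "(\<lambda>l. f l + (if l = m then plateau (js m) m s else 0)) sums ((\<Sum>l. f l) + plateau (js m) m s)"
    by (intro sums_add summable_sums f sums_single[of m "\<lambda>_. plateau (js m) m s"])
  also have "(\<lambda>l. f l + (if l = m then plateau (js m) m s else 0)) = (\<lambda>l. if l \<in> S then plateau (js l) l s else 0)"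
    using m by (auto simp: f_def)
  finally have eq: "plateau_sum S s = (\<Sum>l. f l) + plateau (js m) m s"
    unfolding plateau_sum_def by (rule sums_unique[symmetric])
  have "(\<Sum>l<n. norm (of_real w * f l)) \<le> 2 * (1/2) ^ m" for n
  proof -
    \<comment> \<open>The test \<open>l < 0\<close> never holds; it gives the geometric series the
      shape of \<open>sum_half_tail_le\<close> with N = 0.\<close>
    have "(\<Sum>l<n. norm (of_real w * f l)) \<le> (\<Sum>l<n. (if l < 0 then 0 else (1/2) ^ l) * (1/2) ^ m)"
      using plateau_interaction(2)[OF s, of _ m] w
      by (intro sum_mono) (auto simp: f_def norm_mult w_def power_add)
    also have "\<dots> \<le> 2 * (1/2) ^ 0 * (1/2) ^ m"
      unfolding sum_distrib_right[symmetric] by (intro mult_right_mono sum_half_tail_le) simp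
    finally show ?thesis by simp
  qed
  from norm_suminf_le(2)[OF this] have "norm (of_real w * (\<Sum>l. f l)) \<le> 2 * (1/2) ^ m"
    using suminf_mult[OF f] by simp
  moreover have "w * norm (1 - plateau (js m) m s) \<le> 2 * (1/2) ^ m"
    unfolding w_def using plateau_bounds(4)[OF s] by (cases "s = 0") (auto simp: weight_zero)
  moreover have "norm (1 - plateau_sum S s) \<le> norm (1 - plateau (js m) m s) + norm (\<Sum>l. f l)"
    using norm_triangle_ineq4[of "1 - plateau (js m) m s" "\<Sum>l. f l"] by (simp add: eq algebra_simps)
  then have "w * norm (1 - plateau_sum S s) \<le> w * norm (1 - plateau (js m) m s) + w * norm (\<Sum>l. f l)"
    unfolding distrib_left[symmetric] using w by (rule mult_left_mono)
  ultimately show ?thesis using w by (simp add: w_def norm_mult)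
qed

lemma js_mono: "l \<le> m \<Longrightarrow> js l \<le> js m"
  using gap[of l m] by (cases "l = m") auto

text \<open>At each point at most one index is active, and one of two disjoint sets misses it: the
  corresponding sum is small and the other is at most 3.\<close>

lemma plateau_sums_product_small:
  assumes disj: "S \<inter> T = {}" and e: "0 < (e::real)"
  shows "\<exists>r>0. \<forall>s. 0 \<le> Re s \<longrightarrow> norm s < r \<longrightarrow> norm (plateau_sum S s * plateau_sum T s) \<le> e"
proof -
  \<comment> \<open>The sum without the active index is at most N * d + 2 * 2^-N, which is e/6 +
    e/6.\<close>
  obtain N where N: "(1/2 :: real) ^ N < e / 12" using real_arch_pow_inv[of "e/12" "1/2"] e by auto
  define d where "d = e / (6 * (real N + 1))"
  have d: "0 < d" "N * d \<le> e / 6" using e by (auto simp: d_def field_simps)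
  define r where "r = d / 4 ^ (js N + N)"
  have r: "0 < r" using d by (simp add: r_def)
  have "norm (plateau_sum S s * plateau_sum T s) \<le> e" if s: "0 \<le> Re s" "norm s < r" for s
  proof -
    have small: "norm (plateau (js m) m s) \<le> d" if "m < N" for m
    proof -
      have "norm (plateau (js m) m s) \<le> 4 ^ (js m + m) * norm s" by (rule norm_plateau_le[OF s(1)])
      also have "\<dots> \<le> 4 ^ (js N + N) * r"
        using that s(2) js_mono[of m N] by (intro mult_mono power_increasing) auto
      also have "\<dots> = d" by (simp add: r_def)
      finally show ?thesis .
    qed
    obtain m where m: "\<And>l. l \<noteq> m \<Longrightarrow> norm (plateau (js l) l s) \<le> (1/2) ^ l"
      using at_most_one_active[OF s(1)] by blast
    have le: "norm (plateau_sum X s) \<le> e / 3" if "m \<notin> X" for X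
    proof -
      have active: "norm (plateau (js l) l s) \<le> (1/2) ^ l" if "l \<in> X" for l
        using m[of l] that \<open>m \<notin> X\<close> by blast
      have "norm (plateau_sum X s) \<le> N * d + 2 * (1/2) ^ N"
        unfolding plateau_sum_def
        by (rule norm_suminf_le(2)[OF plateau_partial_sum_le[OF s(1) less_imp_le[OF d(1)] small active]])
      with d N show ?thesis by simp
    qed
    have "norm (plateau_sum S s) * norm (plateau_sum T s) \<le> (e / 3) * 3 \<or>
        norm (plateau_sum S s) * norm (plateau_sum T s) \<le> 3 * (e / 3)"
    proof (cases "m \<in> S")
      case True
      then have "m \<notin> T" using disj by auto
      then show ?thesis using e by (intro disjI2 mult_mono le norm_plateau_sum_le_3 s) auto
    next
      case False
      then show ?thesis using e by (intro disjI1 mult_mono le norm_plateau_sum_le_3 s) auto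
    qed
    then show ?thesis by (auto simp: norm_mult)
  qed
  with r show ?thesis by blast
qed

end

lemma AE_circle_neq: "AE z in circle_measure. z \<noteq> l"
proof -
  have "{z \<in> space (restrict_space borel (sphere 0 1)). z \<noteq> l} \<in> sets (restrict_space borel (sphere 0 1))"
    by (auto simp: sets_restrict_space space_restrict_space intro!: image_eqI[of _ _ "- {l}"])
  then have "(AE z in circle_measure. z \<noteq> l) \<longleftrightarrow> (AE t in uniform_measure lborel {0..<2 * pi}. cis t \<noteq> l)"
    unfolding circle_measure_def by (intro AE_distr_iff measurable_cis_circle)
  also have "\<dots>"
  proof (rule AE_uniform_measureI)
    show "AE t in lborel. t \<in> {0..<2 * pi} \<longrightarrow> cis t \<noteq> l"
      using AE_lborel_singleton[of "Arg2pi l"] by eventually_elim (auto simp: Arg2pi_cis)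
  qed simp
  finally show ?thesis .
qed

lemma hardy_suminf:
  assumes f: "\<And>j. hardy (f j)" and B: "AE z in circle_measure. \<forall>n. (\<Sum>j<n. norm (f j z)) \<le> B"
  shows "hardy (\<lambda>z. \<Sum>j. f j z)"
proof (rule hardy_limit[where f = "\<lambda>n z. \<Sum>j<n. f j z" and B = B])
  note [measurable] = ess_bounded_measurable[OF hardy_ess_bounded[OF f]]
  show "(\<lambda>z. \<Sum>j. f j z) \<in> borel_measurable circle_measure" by measurable
  show "AE z in circle_measure. (\<lambda>n. \<Sum>j<n. f j z) \<longlonglongrightarrow> (\<Sum>j. f j z)"
    using B by eventually_elim (blast intro: summable_LIMSEQ norm_suminf_le)
  show "AE z in circle_measure. \<forall>n. norm (\<Sum>j<n. f j z) \<le> B"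
    using B by eventually_elim (blast intro: order_trans[OF norm_sum])
qed (intro hardy_sum f)

lemma cls_sum:
  assumes "finite G" "\<And>g. g \<in> G \<Longrightarrow> ess_bounded (x g)"
  shows "(\<Sum>g\<in>G. cls (x g)) = cls (\<lambda>z. \<Sum>g\<in>G. x g z)"
  using assms by (induction G rule: finite_induct) (auto simp: cls_zero cls_add ess_bounded_sum)

section \<open>The corona equation on a single scale at a boundary point\<close>

locale boundary_point =
  fixes l :: complex
  assumes l: "norm l = 1"
begin

abbreviation shift :: "complex \<Rightarrow> complex" where
  "shift z \<equiv> 1 - cnj l * z"

lemma Re_shift: "norm z = 1 \<Longrightarrow> 0 \<le> Re (shift z)"
  using complex_Re_le_cmod[of "cnj l * z"] l by (simp add: norm_mult)

lemma norm_shift: "norm (shift z) = norm (z - l)"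
proof -
  have "shift z = cnj l * (l - z)" using unit_mult_cnj[OF l] by (simp add: algebra_simps)
  then have "norm (shift z) = norm (l - z)" using l by (simp only: norm_mult complex_mod_cnj mult_1_left)
  then show ?thesis by (simp add: norm_minus_commute)
qed

text \<open>Factoring 1 + c out of the denominator 1 + c - c * cnj l * z leaves 1 - q * cnj l * z
  with q = c / (1 + c) < 1, a Neumann series.\<close>

lemma hardy_kernel: assumes c: "0 < c" shows "hardy (\<lambda>z. kernel c (shift z))"
proof -
  define q where "q = c / (1 + c)"
  have q: "0 \<le> q" "q < 1" using c by (auto simp: q_def)
  have "hardy (\<lambda>z. 1 / (1 - (of_real q * cnj l) * z))"
  proof (rule hardy_neumann[OF hardy_cmult[OF hardy_id] _ q(2)])
    show "AE z in circle_measure. norm ((of_real q * cnj l) * z) \<le> q"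
      using q l by (intro AE_circleI) (simp add: norm_mult)
  qed
  then have "hardy (\<lambda>z. of_real (1 / (1 + c)) * (1 / (1 - (of_real q * cnj l) * z)))" by (rule hardy_cmult)
  also have "(\<lambda>z. of_real (1 / (1 + c)) * (1 / (1 - (of_real q * cnj l) * z))) = (\<lambda>z. kernel c (shift z))"
  proof
    fix z
    have "complex_of_real (1 + c) \<noteq> 0" unfolding of_real_eq_0_iff using c by simp
    moreover have "of_real (1 + c) * of_real q = complex_of_real c"
      using c by (simp only: of_real_mult[symmetric]) (simp add: q_def)
    ultimately have "of_real (1 + c) * (1 - (of_real q * cnj l) * z) = 1 + of_real c * shift z"
      by (simp add: algebra_simps)
    then show "of_real (1 / (1 + c)) * (1 / (1 - (of_real q * cnj l) * z)) = kernel c (shift z)"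
      unfolding kernel_def by (simp only: of_real_divide of_real_1 times_divide_times_eq mult_1_left)
  qed
  finally show ?thesis .
qed

lemma hardy_one_minus: "hardy f \<Longrightarrow> hardy (\<lambda>z. 1 - f z)"
  using hardy_add[OF hardy_const[of 1] hardy_cmult[of f "-1"]] by simp

lemma hardy_bump: "hardy (\<lambda>z. bump j (shift z))"
  and hardy_plateau: "hardy (\<lambda>z. plateau j m (shift z))"
  unfolding bump_def plateau_def by (intro hardy_mult hardy_one_minus hardy_kernel; simp)+

text \<open>The corona problem with data \<open>G\<close> is solved on the scale \<open>j\<close>, up to a fixed small error and
  with bound \<open>C\<close>.\<close>

definition solvable :: "(complex \<Rightarrow> complex) set \<Rightarrow> real \<Rightarrow> nat \<Rightarrow> bool" where
  "solvable G C j \<longleftrightarrow> (\<exists>h. (\<forall>g\<in>G. hardy (h g) \<and> (AE z in circle_measure. norm (h g z) \<le> C)) \<and>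
     (AE z in circle_measure. weight j (shift z) * norm ((\<Sum>g\<in>G. g z * h g z) - 1) \<le> 1/250))"

text \<open>Puts every point near \<open>l\<close>, other than \<open>l\<close>, on a scale where
  \<open>Re_bump\<close> gives a real part of at least 1/20.\<close>

lemma exists_scale:
  assumes "0 < t" "4 ^ J * t < (1::real)"
  shows "\<exists>i. 1 \<le> 4 ^ (J + i) * t \<and> 4 ^ (J + i) * t \<le> 4"
proof -
  define P where "P i \<longleftrightarrow> 1 \<le> 4 ^ (J + i) * t" for i
  obtain n where "1 / t < 4 ^ n" using real_arch_pow[of 4 "1/t"] by auto
  then have "1 \<le> 4 ^ n * t" using assms(1) by (simp add: field_simps)
  also have "\<dots> \<le> 4 ^ (J + n) * t" using assms(1) by (intro mult_right_mono power_increasing) auto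
  finally have "P n" by (simp add: P_def)
  then have least: "P (LEAST i. P i)" "\<And>i. i < (LEAST i. P i) \<Longrightarrow> \<not> P i" by (auto intro: LeastI dest: not_less_Least)
  have "\<not> P 0" using assms(2) by (simp add: P_def)
  then obtain i where i: "(LEAST i. P i) = Suc i" using least(1) by (cases "LEAST i. P i") auto
  then have "\<not> P i" "P (Suc i)" using least(2)[of i] least(1) unfolding i by simp_all
  then show ?thesis by (intro exI[of _ "Suc i"]) (auto simp: P_def)
qed

text \<open>Characters respect upper bounds for the modulus only, so a lower bound for the real part is
  expressed as an upper bound for the distance to a large number.\<close>

lemma Re_large_imp_near_320:
  assumes "norm v \<le> 4" "1/20 \<le> Re v" shows "norm (v - 320) \<le> 320 - 1/50"
proof (rule power2_le_imp_le)
  \<comment> \<open>The squared modulus changes by at most 16 - 640/20 = -16 against 320^2, and (320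
    - 1/50)^2 - 320^2 is greater than -12.8.\<close>
  have "(norm v)\<^sup>2 \<le> 4\<^sup>2" using assms by (intro power_mono) auto
  moreover have "(norm (v - 320))\<^sup>2 = (norm v)\<^sup>2 - 640 * Re v + 320\<^sup>2"
    unfolding cmod_power2 by (simp add: power2_eq_square algebra_simps)
  ultimately show "(norm (v - 320))\<^sup>2 \<le> (320 - 1/50)\<^sup>2" using assms by (simp add: power2_eq_square)
qed simp

text \<open>Bounded solutions on all small scales can be patched together with the weights \<open>bump j\<close>.\<close>

lemma not_all_scales_solvable:
  assumes h: "H.hom \<phi>" "\<phi> coordinate = l"
    and G: "finite G" "\<And>g. g \<in> G \<Longrightarrow> hardy g" "\<And>g. g \<in> G \<Longrightarrow> \<phi> (cls g) = 0"
  shows "\<exists>j\<ge>J. \<not> solvable G C j"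
proof (rule ccontr)
  assume "\<not> ?thesis"
  then have "\<forall>j. \<exists>k. (\<forall>g\<in>G. hardy (k g) \<and> (AE z in circle_measure. norm (k g z) \<le> C)) \<and>
     (AE z in circle_measure. weight (J + j) (shift z) * norm ((\<Sum>g\<in>G. g z * k g z) - 1) \<le> 1/250)"
    unfolding solvable_def by (meson le_add1)
  from choice[OF this] obtain k where "\<forall>j. (\<forall>g\<in>G. hardy (k j g) \<and> (AE z in circle_measure. norm (k j g z) \<le> C)) \<and>
     (AE z in circle_measure. weight (J + j) (shift z) * norm ((\<Sum>g\<in>G. g z * k j g z) - 1) \<le> 1/250)"
    by blast
  then have k: "\<And>j g. g \<in> G \<Longrightarrow> hardy (k j g)" "\<And>j g. g \<in> G \<Longrightarrow> AE z in circle_measure. norm (k j g z) \<le> C"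
    "\<And>j. AE z in circle_measure. weight (J + j) (shift z) * norm ((\<Sum>g\<in>G. g z * k j g z) - 1) \<le> 1/250"
    by blast+
  define w where "w j z = weight (J + j) (shift z)" for j z
  define b where "b j z = bump (J + j) (shift z)" for j z
  have w: "0 \<le> w j z" "w j z \<le> 1" "(\<Sum>j<n. w j z) \<le> 4" for j z n
    by (simp_all add: w_def weight_nonneg weight_le_1 sum_weight_le_4)
  have b2: "norm (b j z) \<le> (w j z)\<^sup>2" if "norm z = 1" for j z
    unfolding b_def w_def by (intro norm_bump Re_shift that)
  have b1: "norm (b j z) \<le> w j z" if "norm z = 1" for j z
    using b2[OF that, of j] mult_left_le[of "w j z" "w j z"] w(1,2)[where j = j and z = z] by (simp add: power2_eq_square)
  have b_hardy: "hardy (b j)" for j unfolding b_def by (rule hardy_bump)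
  have b_sum: "(\<Sum>j<n. norm (b j z)) \<le> 4" if "norm z = 1" for n z
    by (rule order_trans[OF sum_mono w(3)]) (rule b1[OF that])
  \<comment> \<open>\<open>F\<close> patches the local solutions with the bumps, so \<open>T\<close>
    should be close to \<open>V\<close>; but \<open>T\<close> is in the ideal generated by
    \<open>G\<close>, which \<open>\<phi>\<close> kills.\<close>
  define V where "V z = (\<Sum>j. b j z)" for z
  define F where "F g z = (\<Sum>j. b j z * k j g z)" for g z
  define T where "T z = (\<Sum>g\<in>G. g z * F g z)" for z
  have V: "hardy V"
    unfolding V_def by (rule hardy_suminf[OF b_hardy, where B = 4]) (intro AE_circleI allI b_sum)
  have kC: "AE z in circle_measure. \<forall>j. norm (k j g z) \<le> C" if "g \<in> G" for g
    using k(2)[OF that] by (simp add: AE_all_countable)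
  have bk_sum: "(\<Sum>j<n. norm (b j z * k j g z)) \<le> 4 * C" if "\<And>j. norm (k j g z) \<le> C" "norm z = 1" for n z g
  proof -
    have C: "0 \<le> C" using that(1)[of 0] norm_ge_zero order_trans by blast
    have "(\<Sum>j<n. norm (b j z * k j g z)) \<le> (\<Sum>j<n. norm (b j z) * C)"
      unfolding norm_mult using that by (intro sum_mono mult_left_mono) auto
    also have "\<dots> \<le> 4 * C"
      unfolding sum_distrib_right[symmetric] using b_sum[OF that(2)] C by (intro mult_right_mono)
    finally show ?thesis .
  qed
  have F: "hardy (F g)" if "g \<in> G" for g
    unfolding F_def
  proof (rule hardy_suminf)
    show "hardy (\<lambda>z. b j z * k j g z)" for j by (intro hardy_mult b_hardy k that)
    show "AE z in circle_measure. \<forall>n. (\<Sum>j<n. norm (b j z * k j g z)) \<le> 4 * C"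
      using kC[OF that] AE_circle_unit by eventually_elim (intro allI bk_sum; blast)
  qed
  have T: "hardy T" unfolding T_def by (intro hardy_sum hardy_mult G F)
  have "cls T = (\<Sum>g\<in>G. cls g * cls (F g))"
    unfolding T_def using G F
    by (subst cls_sum[symmetric]) (auto intro!: sum.cong simp: cls_mult hardy_ess_bounded ess_bounded_mult)
  then have T0: "\<phi> (cls T) = 0"
    using G F by (simp add: H_hom_sum[OF h(1)] H_hom_simps(3)[OF h(1)] hardy_cls H.mult_closed)
  have "AE z in circle_measure. norm (V z - T z) \<le> 4 / 250"
  proof -
    have "AE z in circle_measure. \<forall>j. w j z * norm ((\<Sum>g\<in>G. g z * k j g z) - 1) \<le> 1/250"
      using k(3) by (simp add: AE_all_countable w_def)
    moreover have "AE z in circle_measure. \<forall>g\<in>G. \<forall>j. norm (k j g z) \<le> C"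
      using G(1) kC by (simp add: AE_finite_all)
    ultimately show ?thesis using AE_circle_unit
    proof eventually_elim
      case (elim z)
      have "(\<lambda>j. b j z * k j g z) sums F g z" if "g \<in> G" for g
        unfolding F_def using elim that by (intro summable_sums norm_suminf_le[OF bk_sum]) auto
      then have "(\<lambda>j. \<Sum>g\<in>G. g z * (b j z * k j g z)) sums T z"
        unfolding T_def by (intro sums_sum sums_mult)
      moreover have "(\<lambda>j. b j z) sums V z"
        unfolding V_def using elim by (intro summable_sums norm_suminf_le[OF b_sum]) auto
      ultimately have "(\<lambda>j. b j z - (\<Sum>g\<in>G. g z * (b j z * k j g z))) sums (V z - T z)"
        by (intro sums_diff)
      moreover have "b j z - (\<Sum>g\<in>G. g z * (b j z * k j g z)) = b j z * (1 - (\<Sum>g\<in>G. g z * k j g z))" for j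
        by (simp add: right_diff_distrib sum_distrib_left mult_ac)
      ultimately have sums: "(\<lambda>j. b j z * (1 - (\<Sum>g\<in>G. g z * k j g z))) sums (V z - T z)" by simp
      have "(\<Sum>j<n. norm (b j z * (1 - (\<Sum>g\<in>G. g z * k j g z)))) \<le> 4 / 250" for n
      proof -
        have "norm (b j z * (1 - (\<Sum>g\<in>G. g z * k j g z))) \<le> w j z * (1 / 250)" for j
        proof -
          \<comment> \<open>One factor of the squared weight absorbs the error of the local
            solution, the other is left for summation.\<close>
          have "norm (b j z * (1 - (\<Sum>g\<in>G. g z * k j g z))) \<le> (w j z)\<^sup>2 * norm ((\<Sum>g\<in>G. g z * k j g z) - 1)"
            unfolding norm_mult norm_minus_commute[of 1] using b2[of z j] elim by (intro mult_right_mono) auto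
          also have "\<dots> = w j z * (w j z * norm ((\<Sum>g\<in>G. g z * k j g z) - 1))"
            by (simp add: power2_eq_square)
          also have "\<dots> \<le> w j z * (1 / 250)" using elim w by (intro mult_left_mono) auto
          finally show ?thesis .
        qed
        then have "(\<Sum>j<n. norm (b j z * (1 - (\<Sum>g\<in>G. g z * k j g z)))) \<le> (\<Sum>j<n. w j z * (1 / 250))"
          by (intro sum_mono)
        also have "\<dots> \<le> 4 * (1 / 250)"
          unfolding sum_distrib_right[symmetric] using w(3) by (intro mult_right_mono) auto
        finally show ?thesis by simp
      qed
      from norm_suminf_le(2)[OF this] show ?case using sums_unique[OF sums] by simp
    qed
  qed
  moreover have VT: "hardy (\<lambda>z. V z - T z)" using hardy_add[OF V hardy_cmult[OF T, of "-1"]] by simp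
  ultimately have "norm (\<phi> (cls (\<lambda>z. V z - T z))) \<le> 4 / 250"
    by (intro H_hom_contractive[OF h(1)] hardy_cls) (simp_all add: cls_bounded_by hardy_ess_bounded)
  also have "cls (\<lambda>z. V z - T z) = cls V - cls T"
    using V T by (simp add: cls_diff hardy_ess_bounded)
  also have "\<phi> (cls V - cls T) = \<phi> (cls V)"
    using V T T0 by (simp add: H_hom_diff[OF h(1)] hardy_cls)
  finally have upper: "norm (\<phi> (cls V)) \<le> 4 / 250" .
  \<comment> \<open>Subtracting 320 turns the lower bound for the real part of \<open>V\<close> near
    \<open>l\<close> into an upper bound that survives localisation.\<close>
  have V320: "hardy (\<lambda>z. V z - 320)" using hardy_add[OF V hardy_const[of "-320"]] by simp
  have "norm (\<phi> (cls (\<lambda>z. V z - 320))) \<le> 320 - 1/50"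
  proof (rule H_hom_local_bound[OF h l V320])
    show "0 < 1 / (4::real) ^ J" by simp
    show "AE z in circle_measure. norm (z - l) < 1 / 4 ^ J \<longrightarrow> norm (V z - 320) \<le> 320 - 1/50"
      using AE_circle_neq[of l] AE_circle_unit
    proof eventually_elim
      case (elim z)
      show ?case
      proof
        assume near: "norm (z - l) < 1 / 4 ^ J"
        have "0 < norm (shift z)" "4 ^ J * norm (shift z) < 1"
          unfolding norm_shift using elim near by (auto simp: field_simps)
        then obtain i where i: "1 \<le> 4 ^ (J + i) * norm (shift z)" "4 ^ (J + i) * norm (shift z) \<le> 4"
          using exists_scale by blast
        have "(\<lambda>j. b j z) sums V z"
          unfolding V_def using elim by (intro summable_sums norm_suminf_le[OF b_sum]) auto
        then have "(\<lambda>j. Re (b j z)) sums Re (V z)" by (rule sums_Re)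
        moreover have "0 \<le> Re (b j z)" for j unfolding b_def by (intro Re_bump(1) Re_shift elim)
        ultimately have "Re (b i z) \<le> Re (V z)"
          using sum_le_suminf[of "\<lambda>j. Re (b j z)" "{i}"] by (simp add: sums_iff)
        moreover have "1/20 \<le> Re (b i z)" unfolding b_def by (intro Re_bump(2) Re_shift elim i)
        moreover have "norm (V z) \<le> 4" unfolding V_def by (intro norm_suminf_le b_sum elim)
        ultimately show "norm (V z - 320) \<le> 320 - 1/50" by (intro Re_large_imp_near_320) auto
      qed
    qed
  qed simp
  moreover have "cls (\<lambda>z. V z - 320) = cls V - scalar 320"
    using V by (simp add: cls_scalar cls_diff hardy_ess_bounded ess_bounded_const)
  ultimately have "norm (\<phi> (cls V) - 320) \<le> 320 - 1/50"
    using V by (simp add: H_hom_diff[OF h(1)] H_hom_scalar[OF h(1)] hardy_cls)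
  then have "1/50 \<le> norm (\<phi> (cls V))"
    using norm_triangle_ineq2[of 320 "\<phi> (cls V)"] by (simp add: norm_minus_commute)
  with upper show False by simp
qed

end

text \<open>If the ideal generated by \<open>G\<close> and 1 - a were proper, a homomorphism would
  vanish on it, hence on \<open>G\<close>, and take the value 1 at \<open>a\<close>.\<close>

lemma bezout_hinfty:
  assumes G: "finite G" "\<And>g. g \<in> G \<Longrightarrow> hardy g" and a: "hardy a"
    and none: "\<And>h. H.hom h \<Longrightarrow> (\<And>g. g \<in> G \<Longrightarrow> h (cls g) = 0) \<Longrightarrow> h (cls a) \<noteq> 1"
  shows "\<exists>h k. (\<forall>g\<in>G. hardy (h g)) \<and> hardy k \<and>
    (AE z in circle_measure. (\<Sum>g\<in>G. g z * h g z) + (1 - a z) * k z = 1)"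
proof -
  define I where "I = {(\<Sum>g\<in>G. cls g * x g) + (1 - cls a) * y |x y. (\<forall>g\<in>G. x g \<in> hinfty) \<and> y \<in> hinfty}"
  have aH: "1 - cls a \<in> hinfty" using a by (intro H.diff_closed H.one_closed hardy_cls)
  have IE: "(\<Sum>g\<in>G. cls g * x g) + (1 - cls a) * y \<in> I" if "\<And>g. g \<in> G \<Longrightarrow> x g \<in> hinfty" "y \<in> hinfty" for x y
    using that unfolding I_def by blast
  have ideal: "H.is_ideal I"
    unfolding H.is_ideal_def
  proof (intro conjI ballI)
    show "I \<subseteq> hinfty"
      unfolding I_def using G aH by (auto intro!: H.add_closed H.sum_closed H.mult_closed hardy_cls)
    show "0 \<in> I" using IE[of "\<lambda>_. 0" 0] by simp
    fix u assume "u \<in> I"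
    then obtain x y where u: "u = (\<Sum>g\<in>G. cls g * x g) + (1 - cls a) * y" "\<And>g. g \<in> G \<Longrightarrow> x g \<in> hinfty" "y \<in> hinfty"
      by (auto simp: I_def)
    show "u + v \<in> I" if "v \<in> I" for v
    proof -
      from that obtain x' y' where v: "v = (\<Sum>g\<in>G. cls g * x' g) + (1 - cls a) * y'"
        "\<And>g. g \<in> G \<Longrightarrow> x' g \<in> hinfty" "y' \<in> hinfty"
        by (auto simp: I_def)
      have "u + v = (\<Sum>g\<in>G. cls g * (x g + x' g)) + (1 - cls a) * (y + y')"
        unfolding u v distrib_left sum.distrib by (simp only: add_ac)
      also have "\<dots> \<in> I" using u v by (intro IE H.add_closed)
      finally show ?thesis .
    qed
    show "b * u \<in> I" if "b \<in> hinfty" for b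
    proof -
      have "b * u = (\<Sum>g\<in>G. cls g * (b * x g)) + (1 - cls a) * (b * y)"
        unfolding u distrib_left sum_distrib_left by (simp only: mult_ac)
      also have "\<dots> \<in> I" using u that by (intro IE H.mult_closed)
      finally show ?thesis .
    qed
  qed
  have "1 \<in> I"
  proof (rule ccontr)
    assume "1 \<notin> I"
    then obtain h where h: "H.hom h" "\<And>x. x \<in> I \<Longrightarrow> h x = 0"
      using H.hom_vanishing_on_ideal[OF ideal] by blast
    have "h (cls g) = 0" if g: "g \<in> G" for g
    proof -
      have "(\<Sum>g'\<in>G. cls g' * (if g' = g then 1 else 0)) + (1 - cls a) * 0 = cls g"
        using G(1) g by (simp add: if_distrib cong: if_cong)
      moreover have "(\<Sum>g'\<in>G. cls g' * (if g' = g then 1 else 0)) + (1 - cls a) * 0 \<in> I"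
        by (intro IE) auto
      ultimately show ?thesis using h(2) by simp
    qed
    moreover have "h (1 - cls a) = 0"
      using h(2)[OF IE[of "\<lambda>_. 0" 1]] by simp
    then have "h (cls a) = 1"
      using a by (simp add: H_hom_diff[OF h(1)] H_hom_simps(1)[OF h(1)] hardy_cls)
    ultimately show False using none[OF h(1)] by blast
  qed
  then obtain x y where xy: "1 = (\<Sum>g\<in>G. cls g * x g) + (1 - cls a) * y" "\<forall>g\<in>G. x g \<in> hinfty" "y \<in> hinfty"
    by (auto simp: I_def)
  have "\<forall>g\<in>G. \<exists>f. hardy f \<and> x g = cls f" using xy(2) hinfty_cases by metis
  then obtain h where h: "\<And>g. g \<in> G \<Longrightarrow> hardy (h g)" "\<And>g. g \<in> G \<Longrightarrow> x g = cls (h g)" by metis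
  obtain k where k: "hardy k" "y = cls k" using xy(3) by (rule hinfty_cases)
  note eb = hardy_ess_bounded
  have eb2: "ess_bounded (\<lambda>z. \<Sum>g\<in>G. g z * h g z)" "ess_bounded (\<lambda>z. (1 - a z) * k z)"
    using h(1) G(2) a k(1) by (intro ess_bounded_sum ess_bounded_mult ess_bounded_diff ess_bounded_const eb; simp)+
  have "(\<Sum>g\<in>G. cls g * x g) = (\<Sum>g\<in>G. cls (\<lambda>z. g z * h g z))"
    using h G(2) by (intro sum.cong) (auto simp: cls_mult eb)
  also have "\<dots> = cls (\<lambda>z. \<Sum>g\<in>G. g z * h g z)"
    using h G by (intro cls_sum ess_bounded_mult eb)
  also have "(1 - cls a) * y = cls (\<lambda>z. (1 - a z) * k z)"
    unfolding k(2) cls_one using a k by (simp add: cls_diff cls_mult eb ess_bounded_const ess_bounded_diff)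
  ultimately have "cls (\<lambda>_. 1) = cls (\<lambda>z. \<Sum>g\<in>G. g z * h g z) + cls (\<lambda>z. (1 - a z) * k z)"
    using xy(1) by (simp add: cls_one)
  also have "\<dots> = cls (\<lambda>z. (\<Sum>g\<in>G. g z * h g z) + (1 - a z) * k z)"
    by (intro cls_add eb2)
  finally have "AE z in circle_measure. 1 = (\<Sum>g\<in>G. g z * h g z) + (1 - a z) * k z"
    using cls_eq_iff[OF ess_bounded_const ess_bounded_add[OF eb2]] by blast
  then have "AE z in circle_measure. (\<Sum>g\<in>G. g z * h g z) + (1 - a z) * k z = 1"
    by eventually_elim simp
  with h k show ?thesis by blast
qed

section \<open>Sparse sequences of scales without bounded solutions\<close>

context boundary_point
begin

text \<open>Steps of 4 * m + 4 accumulate to a gap of at least 4 * m before index m, which dominates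
  2 * l + 2 * m for l < m.\<close>

lemma scales_not_solvable:
  assumes "\<And>C J. \<exists>j\<ge>J. \<not> solvable G C j"
  shows "\<exists>js. sparse_scales js \<and> (\<forall>m. \<not> solvable G (real m) (js m))"
proof -
  have "\<exists>js. \<forall>m. \<not> solvable G (real m) (js m) \<and> js m + 4 * m + 4 \<le> js (Suc m)"
    using assms by (intro dependent_nat_choice) blast+
  then obtain js where js: "\<And>m. \<not> solvable G (real m) (js m)" "\<And>m. js m + 4 * m + 4 \<le> js (Suc m)"
    by blast
  have "js l + 4 * m \<le> js m" if "l < m" for l m
    using that
  proof (induction m)
    case (Suc m)
    then show ?case using js(2)[of m] by (cases "l = m") auto
  qed simp
  then have "sparse_scales js" by unfold_locales force
  with js(1) show ?thesis by blast
qed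

lemma hardy_plateau_sum: assumes "sparse_scales js" shows "hardy (\<lambda>z. sparse_scales.plateau_sum js S (shift z))"
proof -
  interpret sparse_scales js by fact
  show ?thesis
    unfolding plateau_sum_def
  proof (rule hardy_suminf[where B = 3])
    show "hardy (\<lambda>z. if m \<in> S then plateau (js m) m (shift z) else 0)" for m
      by (cases "m \<in> S") (simp_all add: hardy_plateau hardy_const)
    show "AE z in circle_measure. \<forall>n. (\<Sum>m<n. norm (if m \<in> S then plateau (js m) m (shift z) else 0)) \<le> 3"
      by (intro AE_circleI allI plateau_partial_sum_le_3 Re_shift)
  qed
qed

lemma hom_plateau_sums_product:
  assumes "sparse_scales js" "S \<inter> T = {}" and h: "H.hom h" "h coordinate = l"
  shows "h (cls (\<lambda>z. sparse_scales.plateau_sum js S (shift z))) *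
    h (cls (\<lambda>z. sparse_scales.plateau_sum js T (shift z))) = 0"
proof -
  interpret sparse_scales js by fact
  note hardy = hardy_plateau_sum[OF assms(1)]
  have "h (cls (\<lambda>z. plateau_sum S (shift z) * plateau_sum T (shift z))) = 0"
  proof (rule H_hom_ess_limit[OF h l hardy_mult[OF hardy hardy]])
    fix e :: real assume "0 < e"
    from plateau_sums_product_small[OF assms(2) this] obtain r where r: "0 < r"
      "\<And>s. 0 \<le> Re s \<Longrightarrow> norm s < r \<Longrightarrow> norm (plateau_sum S s * plateau_sum T s) \<le> e" by blast
    have "AE z in circle_measure. norm (z - l) < r \<longrightarrow> norm (plateau_sum S (shift z) * plateau_sum T (shift z) - 0) \<le> e"
      using r(2) Re_shift norm_shift by (intro AE_circleI) (simp del: minus_mult_right)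
    with r(1) show "\<exists>r>0. AE z in circle_measure. norm (z - l) < r \<longrightarrow>
        norm (plateau_sum S (shift z) * plateau_sum T (shift z) - 0) \<le> e" by blast
  qed
  then show ?thesis
    using hardy by (simp add: hardy_cls hardy_ess_bounded flip: H_hom_simps(3)[OF h(1)] cls_mult)
qed

text \<open>Bezout gives functions with fixed bounds. On the scales in \<open>S\<close> the defect
  (1 - a) * k is damped by 4 * 2^-m, so a late member of the infinite set \<open>S\<close> meets
  both the tolerance and the bound m.\<close>

lemma solvable_on_plateaus:
  assumes "sparse_scales js" and G: "finite G" "\<And>g. g \<in> G \<Longrightarrow> hardy g" and S: "infinite S"
    and none: "\<And>h. H.hom h \<Longrightarrow> (\<And>g. g \<in> G \<Longrightarrow> h (cls g) = 0) \<Longrightarrow>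
      h (cls (\<lambda>z. sparse_scales.plateau_sum js S (shift z))) \<noteq> 1"
  shows "\<exists>m. solvable G (real m) (js m)"
proof -
  interpret sparse_scales js by fact
  have "\<exists>h k. (\<forall>g\<in>G. hardy (h g)) \<and> hardy k \<and>
      (AE z in circle_measure. (\<Sum>g\<in>G. g z * h g z) + (1 - plateau_sum S (shift z)) * k z = 1)"
  proof (rule bezout_hinfty)
    show "h (cls (\<lambda>z. plateau_sum S (shift z))) \<noteq> 1"
      if "H.hom h" "\<And>g. g \<in> G \<Longrightarrow> h (cls g) = 0" for h
      by (rule none[OF that])
  qed (use G hardy_plateau_sum[OF assms(1)] in blast)+
  then obtain h k where hk: "\<And>g. g \<in> G \<Longrightarrow> hardy (h g)" "hardy k"
    "AE z in circle_measure. (\<Sum>g\<in>G. g z * h g z) + (1 - plateau_sum S (shift z)) * k z = 1"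
    by blast
  obtain K where K: "AE z in circle_measure. norm (k z) \<le> K"
    using hk(2) by (auto simp: hardy_def ess_bounded_def)
  have K0: "0 \<le> K"
    using bounded_by_nonneg[of "cls k" K] K hk(2) by (simp add: cls_bounded_by hardy_ess_bounded)
  have "\<forall>g\<in>G. \<exists>C. AE z in circle_measure. norm (h g z) \<le> C"
    using hk(1) by (auto simp: hardy_def ess_bounded_def)
  then obtain C where C: "\<And>g. g \<in> G \<Longrightarrow> AE z in circle_measure. norm (h g z) \<le> C g" by metis
  \<comment> \<open>Here 1000 = 4 * 250: the 4 comes from \<open>plateau_sum_near_scale\<close>, the
    250 from the tolerance in \<open>solvable\<close>.\<close>
  obtain N where N: "(1/2 :: real) ^ N < 1 / (1000 * (K + 1))"
    using real_arch_pow_inv[of "1 / (1000 * (K + 1))" "1/2"] K0 by auto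
  obtain M where M: "(\<Sum>g\<in>G. \<bar>C g\<bar>) \<le> real M" using real_arch_simple by blast
  obtain m where m: "m \<in> S" "max M N \<le> m"
    using S by (meson infinite_nat_iff_unbounded_le)
  have small: "4 * (1/2) ^ m * K \<le> 1/250"
  proof -
    have "(1/2 :: real) ^ m \<le> (1/2) ^ N" using m by (intro power_decreasing) auto
    from this less_imp_le[OF N] have "(1/2 :: real) ^ m \<le> 1 / (1000 * (K + 1))" by (rule order_trans)
    then have "(1/2) ^ m * K \<le> 1 / (1000 * (K + 1)) * K" using K0 by (rule mult_right_mono)
    also have "\<dots> \<le> 1 / 1000" using K0 by (simp add: field_simps)
    finally show ?thesis by simp
  qed
  have "solvable G (real m) (js m)"
    unfolding solvable_def
  proof (intro exI[of _ h] conjI ballI hk(1))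
    fix g assume g: "g \<in> G"
    have "\<bar>C g\<bar> \<le> (\<Sum>g\<in>G. \<bar>C g\<bar>)" using g G(1) by (intro member_le_sum) auto
    moreover have "real M \<le> real m" using m(2) by simp
    ultimately have "C g \<le> real m" using M by linarith
    with C[OF g] show "AE z in circle_measure. norm (h g z) \<le> real m"
      by (auto elim: eventually_mono)
  next
    show "AE z in circle_measure. weight (js m) (shift z) * norm ((\<Sum>g\<in>G. g z * h g z) - 1) \<le> 1/250"
      using hk(3) K AE_circle_unit
    proof eventually_elim
      case (elim z)
      have "(\<Sum>g\<in>G. g z * h g z) - 1 = - ((1 - plateau_sum S (shift z)) * k z)"
        using elim(1) by (simp add: algebra_simps)
      then have "weight (js m) (shift z) * norm ((\<Sum>g\<in>G. g z * h g z) - 1) =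
          weight (js m) (shift z) * norm (1 - plateau_sum S (shift z)) * norm (k z)"
        by (simp only: norm_minus_cancel norm_mult mult.assoc)
      also have "\<dots> \<le> 4 * (1/2) ^ m * K"
        using elim m(1) by (intro mult_mono plateau_sum_near_scale Re_shift) (auto simp: weight_nonneg)
      finally show ?case using small by simp
    qed
  qed
  then show ?thesis ..
qed

end

theorem theorem5p3:
  shows "\<not> (\<exists>E. openin (gelfand_topology hinfty_plus_C) E \<and> E \<noteq> {} \<and>
               t_analytic_set hinfty_plus_C E)"
proof
  assume "\<exists>E. openin (gelfand_topology hinfty_plus_C) E \<and> E \<noteq> {} \<and> t_analytic_set hinfty_plus_C E"
  then obtain E \<phi> where E: "openin (gelfand_topology HC) E" "t_analytic_set HC E" and \<phi>: "\<phi> \<in> E" by blast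
  have char: "\<psi> \<in> character_space HC" if "\<psi> \<in> E" for \<psi> using E(2) that by (auto simp: t_analytic_set_def)
  define l where "l = \<phi> coordinate"
  have l: "norm l = 1" unfolding l_def by (rule character_continuous(2)[OF char[OF \<phi>] continuous_on_id])
  have fibre: "\<psi> coordinate = l" if "\<psi> \<in> E" for \<psi>
    unfolding l_def by (rule t_analytic_set_in_fibre[OF E(2) that \<phi>])
  interpret boundary_point l by unfold_locales (rule l)
  from gelfand_open_basic[OF E(1) \<phi>] obtain F where
    "finite F \<and> F \<subseteq> HC \<and> (\<forall>\<psi>\<in>character_space HC. (\<forall>f\<in>F. \<psi> f = \<phi> f) \<longrightarrow> \<psi> \<in> E)" ..
  then have F: "finite F" "F \<subseteq> HC"
    "\<And>\<psi>. \<psi> \<in> character_space HC \<Longrightarrow> (\<And>f. f \<in> F \<Longrightarrow> \<psi> f = \<phi> f) \<Longrightarrow> \<psi> \<in> E"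
    by blast+
  have "\<forall>f\<in>F. \<exists>u c. hardy u \<and> continuous_on (sphere 0 1) c \<and> f = cls u + cls c"
    using F(2) by (blast elim: HC_cases)
  from bchoice[OF this] obtain u where
    "\<forall>f\<in>F. \<exists>c. hardy (u f) \<and> continuous_on (sphere 0 1) c \<and> f = cls (u f) + cls c" ..
  from bchoice[OF this] obtain c where
    "\<forall>f\<in>F. hardy (u f) \<and> continuous_on (sphere 0 1) (c f) \<and> f = cls (u f) + cls (c f)" ..
  then have uc: "\<And>f. f \<in> F \<Longrightarrow> hardy (u f)" "\<And>f. f \<in> F \<Longrightarrow> continuous_on (sphere 0 1) (c f)"
    "\<And>f. f \<in> F \<Longrightarrow> f = cls (u f) + cls (c f)" by blast+
  \<comment> \<open>The function z - l pins a homomorphism to the fibre over \<open>l\<close>, where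
    the continuous part of each f in \<open>F\<close> is the constant c f l; the rest then forces
    agreement with \<open>\<phi>\<close> on \<open>F\<close>.\<close>
  define G where "G = insert (\<lambda>z. z - l) ((\<lambda>f z. u f z - \<phi> (cls (u f))) ` F)"
  have hardy_minus: "hardy (\<lambda>z. v z - w)" if "hardy v" for v w
    using hardy_add[OF that hardy_const[of "- w"]] by simp
  have hom_minus: "h (cls (\<lambda>z. v z - w)) = h (cls v) - w" if "H.hom h" "hardy v" for h v w
  proof -
    have "cls (\<lambda>z. v z - w) = cls v - scalar w"
      using that(2) by (simp add: cls_scalar cls_diff hardy_ess_bounded ess_bounded_const)
    then show ?thesis using that by (simp add: H_hom_diff H_hom_scalar hardy_cls)
  qed
  have G: "finite G" "\<And>g. g \<in> G \<Longrightarrow> hardy g"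
    using F(1) uc(1) by (auto simp: G_def intro: hardy_minus hardy_id)
  have \<phi>_hom: "H.hom \<phi>" by (rule character_hom[OF char[OF \<phi>]])
  have \<phi>_G: "\<phi> (cls g) = 0" if "g \<in> G" for g
    using that hom_minus[OF \<phi>_hom] uc(1) hardy_id by (auto simp: G_def l_def)
  \<comment> \<open>Common zeros of \<open>G\<close> among the homomorphisms of H^inf are
    restrictions of points of \<open>E\<close>; here openness of \<open>E\<close> enters.\<close>
  have lift: "\<exists>\<psi>\<in>E. \<forall>a. hardy a \<longrightarrow> \<psi> (cls a) = h (cls a)"
    if h: "H.hom h" "\<And>g. g \<in> G \<Longrightarrow> h (cls g) = 0" for h
  proof -
    have hl: "h coordinate = l" using h(2)[of "\<lambda>z. z - l"] hom_minus[OF h(1) hardy_id] by (simp add: G_def)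
    have hu: "h (cls (u f)) = \<phi> (cls (u f))" if "f \<in> F" for f
      using h(2)[of "\<lambda>z. u f z - \<phi> (cls (u f))"] hom_minus[OF h(1) uc(1)[OF that]] that by (simp add: G_def)
    obtain \<psi> where \<psi>: "\<psi> \<in> character_space HC"
      "\<And>f c. hardy f \<Longrightarrow> continuous_on (sphere 0 1) c \<Longrightarrow> \<psi> (cls f + cls c) = h (cls f) + c l"
      using hom_extension[OF char[OF \<phi>] h(1) hl l] by blast
    have "\<psi> f = \<phi> f" if f: "f \<in> F" for f
    proof -
      have "\<phi> f = \<phi> (cls (u f)) + \<phi> (cls (c f))"
        using uc[OF f] characterD(1)[OF char[OF \<phi>]] continuous_in_HC hinfty_in_HC hardy_cls by metis
      also have "\<dots> = h (cls (u f)) + c f l"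
        using hu[OF f] character_continuous(1)[OF char[OF \<phi>] uc(2)[OF f]] by (simp add: l_def)
      also have "\<dots> = \<psi> f" using \<psi>(2)[OF uc(1,2)[OF f]] uc(3)[OF f] by simp
      finally show ?thesis by simp
    qed
    then have "\<psi> \<in> E" by (intro F(3) \<psi>(1))
    moreover have "\<psi> (cls a) = h (cls a)" if "hardy a" for a
      using \<psi>(2)[OF that continuous_on_const[of _ 0]] by (simp flip: cls_zero)
    ultimately show ?thesis by blast
  qed
  obtain js where js: "sparse_scales js" "\<And>m. \<not> solvable G (real m) (js m)"
    using scales_not_solvable[OF not_all_scales_solvable[OF \<phi>_hom l_def[symmetric] G \<phi>_G]] by blast
  define a where "a S z = sparse_scales.plateau_sum js S (shift z)" for S z
  have a: "hardy (a S)" for S unfolding a_def by (rule hardy_plateau_sum[OF js(1)])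
  \<comment> \<open>If \<open>a S\<close> vanished on \<open>E\<close>, it would be 0, hence not 1,
    at every common zero of \<open>G\<close>, and \<open>solvable_on_plateaus\<close> would
    contradict the choice of \<open>js\<close>.\<close>
  have nonvanishing: "\<exists>\<psi>\<in>E. \<psi> (cls (a S)) \<noteq> 0" if S: "infinite S" for S
  proof (rule ccontr)
    assume vanish: "\<not> ?thesis"
    have "h (cls (a S)) \<noteq> 1" if h: "H.hom h" "\<And>g. g \<in> G \<Longrightarrow> h (cls g) = 0" for h
    proof -
      obtain \<psi> where "\<psi> \<in> E" "\<psi> (cls (a S)) = h (cls (a S))" using lift[OF h] a by blast
      with vanish show ?thesis by auto
    qed
    then show False
      using solvable_on_plateaus[OF js(1) G S] js(2) unfolding a_def by blast
  qed
  have "(\<forall>\<psi>\<in>E. \<psi> (cls (a {m. even m})) = 0) \<or> (\<forall>\<psi>\<in>E. \<psi> (cls (a {m. odd m})) = 0)"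
  proof (rule t_analytic_set_zero_divisors[OF E(2)])
    show "\<psi> (cls (a {m. even m})) * \<psi> (cls (a {m. odd m})) = 0" if "\<psi> \<in> E" for \<psi>
      unfolding a_def
      by (rule hom_plateau_sums_product[OF js(1) _ character_hom[OF char[OF that]] fibre[OF that]]) auto
  qed (intro hinfty_in_HC hardy_cls a)+
  moreover have "infinite {m::nat. even m}" "infinite {m::nat. odd m}"
    unfolding infinite_nat_iff_unbounded_le
    by (metis even_Suc le_SucI mem_Collect_eq order_refl)+
  ultimately show False using nonvanishing by blast
qed

end
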